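(* Let $r,k,\ell\in\mathbb{N}$, let $\widehat A_1,\dots,\widehat A_k,\widehat B_1,\dots,\widehat B_\ell\in M_r(\mathbb{C})$ be fixed, and let $P$ be a polynomial over $\mathbb{C}$ in $k+\ell$ noncommuting indeterminates without constant term. For $N\ge 2r$ let $U=U^{(N)}$ be an $N\times N$ Haar unitary random matrix and let $A_i=\begin{pmatrix}\widehat A_i&0\\0&0\end{pmatrix}$, $B_j=\begin{pmatrix}\widehat B_j&0\\0&0\end{pmatrix}\in M_N(\mathbb{C})$. Let $\{\mu_i^{(N)}\}_{i=1}^{2r}$ be the nontrivial eigenvalues (defined in the context) of $P(A_1U^*,\dots,A_kU^*,UB_1,\dots,UB_\ell)$, and let $\{\mu_i\}_{i=1}^{2r}$ be their deterministic almost sure limits as $N\to\infty$ (see the context), labeled so that $\mu_i^{(N)}\to\mu_i$ almost surely for each $i\in[2r]$. Assume that the values $\mu_1,\dots,\mu_{2r}$ appear without multiplicity, i.e. are pairwise distinct. Then for every $i\in[2r]$ the number $$\kappa_i:=\sup\{\kappa\in\mathbb{R}\mid N^{\frac{\kappa}{2}}(\mu_i^{(N)}-\mu_i)\text{ converges in law to a }\mathbb{C}\text{-valued random variable as }N\to\infty\}$$ belongs to $\mathbb{N}\cup\{\infty\}$. Here $\kappa_i=\infty$ means that $N^{\frac{\kappa}{2}}(\mu_i^{(N)}-\mu_i)$ converges in law to $0$ for all $\kappa\in\mathbb{R}$, which occurs only when $\mu_i^{(N)}=\mu_i$ almost surely for all sufficiently large $N\in\mathbb{N}$. Moreover, let $I:=\{i\in[2r]\mid\kappa_i<\infty\}$.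 Then the random vectors $\bigl(N^{\frac{\kappa_i}{2}}(\mu_i^{(N)}-\mu_i)\bigr)_{i\in I}$ converge in law, as $N\to\infty$, to $(P_i)_{i\in I}$, where $P_i=P_i(x_1,x_2,\dots,x_{2r^2})$, $i\in I$, are nonzero homogeneous polynomials (with complex coefficients) of degree $\kappa_i$ evaluated on a standard Gaussian random vector $(x_j)_{j\in[2r^2]}$ on $\mathbb{R}^{2r^2}$ (the same vector for all $i\in I$).
   Context: The number $r$ is fixed, $N$ is always taken sufficiently large (in particular $N\ge 2r$), and the random matrices $U^{(N)}$, for all $N$, are defined on a common probability space. $\mathbb{N}=\{1,2,\dots\}$, $[n]=\{1,\dots,n\}$. Eigenvalues are counted with algebraic multiplicity. Nontrivial eigenvalues. Write $U^{(N)}=(u_{ij})_{i,j\in[N]}$, let $\widehat U=(u_{ij})_{i,j\in[r]}$ be its upper-left $r\times r$ truncation, let $u_i$ be the $i$-th column of $U^{(N)}$ and $e_i$ the $i$-th standard basis vector of $\mathbb{C}^N$. Almost surely $\mathbf{B}=(e_1,\dots,e_r,u_1,\dots,u_r,e_{r+1},\dots,e_{N-r})$ is a basis of $\mathbb{C}^N$. With respect to $\mathbf B$, the matrix $P(A_1U^*,\dots,A_kU^*,UB_1,\dots,UB_\ell)$ is represented by a matrix whose last $N-2r$ rows vanish. The nontrivial eigenvalues are the $2r$ eigenvalues of the upper-left $2r\times 2r$ block of this representing matrix; this block equals $P(a_1,\dots,a_k,b_1,\dots,b_\ell)$ with $$a_i=\begin{pmatrix}\widehat A_i\widehat U^*&\widehat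 A_i\\0&0\end{pmatrix},\qquad b_j=\begin{pmatrix}0&0\\ \widehat B_j&\widehat B_j\widehat U\end{pmatrix}\in M_{2r}(\mathbb{C}).$$ Limits. The nontrivial eigenvalues converge almost surely, under suitable labeling, to the eigenvalues $\mu_1,\dots,\mu_{2r}$ of the deterministic matrix $\tilde M\in M_{2r}(\mathbb{C})$ obtained from $P(a_1,\dots,a_k,b_1,\dots,b_\ell)$ by replacing $\widehat U$ by $0$. *)

theory Defs
  imports
    "HOL-Probability.Probability"
    "HOL-Library.Poly_Mapping"
    "Jordan_Normal_Form.Schur_Decomposition"
    "Jordan_Normal_Form.Gauss_Jordan_Elimination"
begin

section \<open>Haar unitary random matrices\<close>

definition unitary_mat :: "nat \<Rightarrow> complex mat \<Rightarrow> bool" where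
  "unitary_mat N V \<longleftrightarrow>
     V \<in> carrier_mat N N \<and> V * mat_adjoint V = 1\<^sub>m N \<and> mat_adjoint V * V = 1\<^sub>m N"

text \<open>The law of an \<open>N \<times> N\<close> random matrix is taken to be the joint law of its entries.\<close>

definition mat_law :: "'w measure \<Rightarrow> nat \<Rightarrow> ('w \<Rightarrow> complex mat) \<Rightarrow> (nat \<times> nat \<Rightarrow> complex) measure" where
  "mat_law M N X =
     distr M (Pi\<^sub>M ({..<N} \<times> {..<N}) (\<lambda>_. borel)) (\<lambda>\<omega>. \<lambda>p\<in>{..<N} \<times> {..<N}. X \<omega> $$ p)"

text \<open>Haar measure is the unique translation invariant probability measure on the unitary
  group, so a random matrix is Haar distributed iff its law is invariant under translation by
  every fixed unitary matrix.\<close>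

definition haar_unitary :: "'w measure \<Rightarrow> nat \<Rightarrow> ('w \<Rightarrow> complex mat) \<Rightarrow> bool" where
  "haar_unitary M N U \<longleftrightarrow>
     (\<forall>\<omega>\<in>space M. unitary_mat N (U \<omega>)) \<and>
     (\<forall>i<N. \<forall>j<N. (\<lambda>\<omega>. U \<omega> $$ (i, j)) \<in> borel_measurable M) \<and>
     (\<forall>V. unitary_mat N V \<longrightarrow>
        mat_law M N (\<lambda>\<omega>. V * U \<omega>) = mat_law M N U \<and>
        mat_law M N (\<lambda>\<omega>. U \<omega> * V) = mat_law M N U)"


section \<open>Noncommutative polynomials\<close>

text \<open>A noncommutative polynomial is a finitely supported family of coefficients indexed by
  words; the letter \<open>i < m\<close> stands for the \<open>i\<close>-th of \<open>m\<close> indeterminates (counted from 0).\<close>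

type_synonym nc_poly = "nat list \<Rightarrow>\<^sub>0 complex"

definition nc_poly_in :: "nat \<Rightarrow> nc_poly \<Rightarrow> bool" where
  "nc_poly_in m P \<longleftrightarrow> (\<forall>w\<in>Poly_Mapping.keys P. set w \<subseteq> {..<m})"

definition nc_no_constant_term :: "nc_poly \<Rightarrow> bool" where
  "nc_no_constant_term P \<longleftrightarrow> Poly_Mapping.lookup P [] = 0"

definition word_eval :: "nat \<Rightarrow> complex mat list \<Rightarrow> nat list \<Rightarrow> complex mat" where
  "word_eval n Xs w = foldr (\<lambda>i Y. Xs ! i * Y) w (1\<^sub>m n)"

definition nc_eval :: "nat \<Rightarrow> nc_poly \<Rightarrow> complex mat list \<Rightarrow> complex mat" where
  "nc_eval n P Xs =
     Matrix.mat n n (\<lambda>p. \<Sum>w\<in>Poly_Mapping.keys P. Poly_Mapping.lookup P w * word_eval n Xs w $$ p)"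


section \<open>Nontrivial eigenvalues\<close>

definition eigenvalues_mset :: "complex mat \<Rightarrow> complex multiset" where
  "eigenvalues_mset A = proots (char_poly A)"

definition corner_embed :: "nat \<Rightarrow> nat \<Rightarrow> complex mat \<Rightarrow> complex mat" where
  "corner_embed r N A =
     four_block_mat A (0\<^sub>m r (N - r)) (0\<^sub>m (N - r) r) (0\<^sub>m (N - r) (N - r))"

definition upper_left_block :: "nat \<Rightarrow> complex mat \<Rightarrow> complex mat" where
  "upper_left_block m A = Matrix.mat m m (\<lambda>p. A $$ p)"

definition model_matrix ::
  "nat \<Rightarrow> nat \<Rightarrow> nat \<Rightarrow> nc_poly \<Rightarrow> (nat \<Rightarrow> complex mat) \<Rightarrow> (nat \<Rightarrow> complex mat)
     \<Rightarrow> nat \<Rightarrow> complex mat \<Rightarrow> complex mat" where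
  "model_matrix r k l P A B N U =
     nc_eval N P
       (map (\<lambda>i. corner_embed r N (A i) * mat_adjoint U) [0..<k] @
        map (\<lambda>j. U * corner_embed r N (B j)) [0..<l])"

text \<open>The matrix with columns
  \<open>e\<^sub>1, \<dots>, e\<^sub>r, u\<^sub>1, \<dots>, u\<^sub>r, e\<^sub>r\<^sub>+\<^sub>1, \<dots>, e\<^sub>N\<^sub>-\<^sub>r\<close>, where \<open>u\<^sub>i\<close> is the \<open>i\<close>-th column of \<open>U\<close>.\<close>

definition basis_matrix :: "nat \<Rightarrow> nat \<Rightarrow> complex mat \<Rightarrow> complex mat" where
  "basis_matrix r N U =
     mat_of_cols N (map (unit_vec N) [0..<r] @ map (col U) [0..<r] @ map (unit_vec N) [r..<N - r])"

text \<open>Meaningful only if the columns of \<open>S\<close> form a basis; for \<open>S = basis_matrix r N U\<close> with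
  \<open>U\<close> Haar distributed this holds almost surely.\<close>

definition representing_matrix :: "complex mat \<Rightarrow> complex mat \<Rightarrow> complex mat" where
  "representing_matrix S X = the (mat_inverse S) * X * S"

definition nontrivial_eigenvalues ::
  "nat \<Rightarrow> nat \<Rightarrow> nat \<Rightarrow> nc_poly \<Rightarrow> (nat \<Rightarrow> complex mat) \<Rightarrow> (nat \<Rightarrow> complex mat)
     \<Rightarrow> nat \<Rightarrow> complex mat \<Rightarrow> complex multiset" where
  "nontrivial_eigenvalues r k l P A B N U =
     eigenvalues_mset (upper_left_block (2 * r)
       (representing_matrix (basis_matrix r N U) (model_matrix r k l P A B N U)))"

text \<open>\<open>block_polynomial r k l P A B W\<close> is \<open>P(a\<^sub>1, \<dots>, a\<^sub>k, b\<^sub>1, \<dots>, b\<^sub>l)\<close> where \<open>W\<close> takes the place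
  of the \<open>r \<times> r\<close> truncation of \<open>U\<close>; the limit matrix is its value at \<open>W = 0\<close>.\<close>

definition a_block :: "nat \<Rightarrow> complex mat \<Rightarrow> complex mat \<Rightarrow> complex mat" where
  "a_block r A W = four_block_mat (A * mat_adjoint W) A (0\<^sub>m r r) (0\<^sub>m r r)"

definition b_block :: "nat \<Rightarrow> complex mat \<Rightarrow> complex mat \<Rightarrow> complex mat" where
  "b_block r B W = four_block_mat (0\<^sub>m r r) (0\<^sub>m r r) B (B * W)"

definition block_polynomial ::
  "nat \<Rightarrow> nat \<Rightarrow> nat \<Rightarrow> nc_poly \<Rightarrow> (nat \<Rightarrow> complex mat) \<Rightarrow> (nat \<Rightarrow> complex mat)
     \<Rightarrow> complex mat \<Rightarrow> complex mat" where
  "block_polynomial r k l P A B W =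
     nc_eval (2 * r) P
       (map (\<lambda>i. a_block r (A i) W) [0..<k] @ map (\<lambda>j. b_block r (B j) W) [0..<l])"

definition limit_matrix ::
  "nat \<Rightarrow> nat \<Rightarrow> nat \<Rightarrow> nc_poly \<Rightarrow> (nat \<Rightarrow> complex mat) \<Rightarrow> (nat \<Rightarrow> complex mat) \<Rightarrow> complex mat" where
  "limit_matrix r k l P A B = block_polynomial r k l P A B (0\<^sub>m r r)"


section \<open>Convergence in law\<close>

text \<open>The library's \<open>weak_conv_m\<close> is restricted to measures on the real line, where it is
  equivalent to the following by the portmanteau theorem.\<close>

definition converges_in_law ::
  "'w measure \<Rightarrow> (nat \<Rightarrow> 'w \<Rightarrow> 'a::topological_space) \<Rightarrow> 'a measure \<Rightarrow> bool" where
  "converges_in_law M X \<nu> \<longleftrightarrow>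
     (\<forall>f::'a \<Rightarrow> real. continuous_on UNIV f \<and> bounded (range f) \<longrightarrow>
        (\<lambda>n. \<integral>x. f x \<partial>distr M borel (X n)) \<longlonglongrightarrow> (\<integral>x. f x \<partial>\<nu>))"

definition scaled_deviation ::
  "(nat \<Rightarrow> 'w \<Rightarrow> complex) \<Rightarrow> complex \<Rightarrow> real \<Rightarrow> nat \<Rightarrow> 'w \<Rightarrow> complex" where
  "scaled_deviation X c \<kappa> N \<omega> = of_real (real N powr (\<kappa> / 2)) * (X N \<omega> - c)"

definition fluctuation_exponent ::
  "'w measure \<Rightarrow> (nat \<Rightarrow> 'w \<Rightarrow> complex) \<Rightarrow> complex \<Rightarrow> ereal" where
  "fluctuation_exponent M X c =
     Sup (ereal ` {\<kappa>. \<exists>\<nu>. prob_space \<nu> \<and> sets \<nu> = sets borel \<and>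
                        converges_in_law M (scaled_deviation X c \<kappa>) \<nu>})"


section \<open>Multivariate polynomials in Gaussian variables\<close>

text \<open>Keys are exponent vectors. The coefficients are complex, the variables are evaluated at
  real numbers.\<close>

type_synonym mv_poly = "(nat \<Rightarrow>\<^sub>0 nat) \<Rightarrow>\<^sub>0 complex"

definition mv_eval :: "mv_poly \<Rightarrow> (nat \<Rightarrow> real) \<Rightarrow> complex" where
  "mv_eval Q x =
     (\<Sum>m\<in>Poly_Mapping.keys Q. Poly_Mapping.lookup Q m *
        (\<Prod>j\<in>Poly_Mapping.keys m. of_real (x j) ^ Poly_Mapping.lookup m j))"

definition mv_poly_in :: "nat \<Rightarrow> mv_poly \<Rightarrow> bool" where
  "mv_poly_in n Q \<longleftrightarrow> (\<forall>m\<in>Poly_Mapping.keys Q. Poly_Mapping.keys m \<subseteq> {..<n})"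

definition mv_homogeneous :: "nat \<Rightarrow> mv_poly \<Rightarrow> bool" where
  "mv_homogeneous d Q \<longleftrightarrow>
     (\<forall>m\<in>Poly_Mapping.keys Q. (\<Sum>j\<in>Poly_Mapping.keys m. Poly_Mapping.lookup m j) = d)"

definition std_gaussian :: "nat \<Rightarrow> (nat \<Rightarrow> real) measure" where
  "std_gaussian n = Pi\<^sub>M {..<n} (\<lambda>_. std_normal_distribution)"

end

theory Submission
  imports Defs
begin

text \<open>Write \<open>q\<^sub>i(W)\<close> for the characteristic polynomial of \<open>P(a, b)\<close>, evaluated at \<open>\<mu>\<^sub>i\<close>, as a polynomial
  in the real and imaginary parts of the entries of \<open>W\<close>. Since the characteristic polynomial splits,
  \<open>q\<^sub>i(W) = \<Prod>\<^sub>j (\<mu>\<^sub>i - \<mu>\<^sub>j(W))\<close>, and as the limits are distinct the factors with \<open>j \<noteq> i\<close> converge to a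
  nonzero constant. Hence \<open>\<mu>\<^sub>i(W) - \<mu>\<^sub>i\<close> is asymptotically a constant multiple of \<open>q\<^sub>i(W)\<close>; no analytic
  perturbation theory is needed. Because \<open>\<surd>N\<close> times the truncation of \<open>U\<close> converges in law to a matrix of
  independent complex Gaussians, \<open>\<kappa>\<^sub>i\<close> is the degree of the lowest nonzero homogeneous component of
  \<open>q\<^sub>i\<close>, and \<open>\<kappa>\<^sub>i = \<infinity>\<close> iff \<open>q\<^sub>i\<close> vanishes identically.

  The Gaussian limit uses only invariance of the law: multiplying \<open>U\<close> by the discrete Fourier matrix
  and by diagonal matrices of fourth roots of unity turns the characteristic function of the
  truncation into the expectation of a product over the rows of \<open>U\<close>.\<close>

section \<open>The block form of the model\<close>

text \<open>The labelled eigenvalues are controlled only by almost sure convergence, with no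
  regularity as functions of the truncation. A product over all roots is symmetric in the labels, so
  it stays a polynomial however they are chosen. With \<open>W = X / sqrt N\<close> and
  \<open>X\<close> asymptotically standard Gaussian, the degree-e part of the polynomial has order
  N^(-e/2). The lowest degree d therefore fixes the scaling N^(d/2), and d is at least 1 because the
  limit is a root at W = 0. A nonzero polynomial has positive mean modulus under a Gaussian law, so
  no larger exponent is possible. Joint convergence follows since all coordinates are continuous
  functions of one \<open>X\<close>, of correction factors tending to 1, and of 1 / sqrt N. Without
  a density for Haar measure, the moment bounds and the almost sure nonsingularity of a corner of
  \<open>U\<close> must also come from multiplication by explicit unitary matrices. Fourth roots of
  unity suffice as phases because the sums of their first and second powers vanish: these are the
  only phase terms in a fourth moment |a + e b|^4.\<close>

lemma conjugate_eq_cnj: "conjugate (z::complex) = cnj z"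
  by (simp add: conjugate_complex_def)

lemma dim_mat_adjoint [simp]: "dim_row (mat_adjoint A) = dim_col A" "dim_col (mat_adjoint A) = dim_row A"
  by (simp_all add: mat_adjoint_def)

lemma mat_adjoint_carrier [intro]: "A \<in> carrier_mat n m \<Longrightarrow> mat_adjoint A \<in> carrier_mat m n"
  by (intro carrier_matI) simp_all

lemma mat_adjoint_index:
  fixes A :: "complex mat"
  assumes "A \<in> carrier_mat n m" "i < m" "j < n"
  shows "mat_adjoint A $$ (i, j) = cnj (A $$ (j, i))"
  using assms by (auto simp: mat_adjoint_def mat_of_rows_index conjugate_eq_cnj)

lemma mult_mat_index:
  assumes "A \<in> carrier_mat n m" "B \<in> carrier_mat m q" "i < n" "j < q"
  shows "(A * B) $$ (i, j) = (\<Sum>k<m. A $$ (i, k) * B $$ (k, j))"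
  using assms by (auto simp: scalar_prod_def atLeast0LessThan intro!: sum.cong)

lemma sum_delta_mult [simp]:
  fixes f :: "nat \<Rightarrow> complex"
  shows
  "(\<Sum>k<m. (if i = k then 1 else 0) * f k) = (if i < m then f i else (0::complex))"
  "(\<Sum>k<m. f k * (if k = i then 1 else 0)) = (if i < m then f i else (0::complex))"
proof -
  have "(\<Sum>k<m. (if i = k then 1 else 0) * f k) = (\<Sum>k<m. if i = k then f k else 0)"
    by (intro sum.cong) auto
  then show "(\<Sum>k<m. (if i = k then 1 else 0) * f k) = (if i < m then f i else (0::complex))"
    by simp
  have "(\<Sum>k<m. f k * (if k = i then 1 else 0)) = (\<Sum>k<m. if k = i then f k else 0)"
    by (intro sum.cong) auto
  then show "(\<Sum>k<m. f k * (if k = i then 1 else 0)) = (if i < m then f i else (0::complex))"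
    by simp
qed

section \<open>Intertwining relations for noncommutative polynomials\<close>

lemma word_eval_carrier:
  assumes "\<And>i. i < length Xs \<Longrightarrow> Xs ! i \<in> carrier_mat n n" "set w \<subseteq> {..<length Xs}"
  shows "word_eval n Xs w \<in> carrier_mat n n"
  using assms(2) by (induction w) (auto simp: word_eval_def intro!: mult_carrier_mat[OF assms(1)])

lemma nc_eval_carrier [simp]: "nc_eval n P Xs \<in> carrier_mat n n"
  by (simp add: nc_eval_def)

text \<open>The relation \<open>X * S = S * Y\<close> passes from letters to words by reassociation.
  As \<open>S\<close> may be rectangular, an N-dimensional model can be compared with a
  2r-dimensional one without inverting anything.\<close>

lemma word_eval_intertwine:
  assumes Xs: "\<And>i. i < length Xs \<Longrightarrow> Xs ! i \<in> carrier_mat N N"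
    and Ys: "\<And>i. i < length Xs \<Longrightarrow> Ys ! i \<in> carrier_mat m m"
    and len: "length Ys = length Xs"
    and S: "S \<in> carrier_mat N m"
    and XS: "\<And>i. i < length Xs \<Longrightarrow> Xs ! i * S = S * Ys ! i"
    and w: "set w \<subseteq> {..<length Xs}"
  shows "word_eval N Xs w * S = S * word_eval m Ys w"
  using w
proof (induction w)
  case Nil
  then show ?case using S by (simp add: word_eval_def)
next
  case (Cons i w)
  have i: "i < length Xs" and w: "set w \<subseteq> {..<length Xs}" using Cons.prems by auto
  have cX: "word_eval N Xs w \<in> carrier_mat N N" using word_eval_carrier[OF Xs w] .
  have cY: "word_eval m Ys w \<in> carrier_mat m m"
    using word_eval_carrier[of Ys m w] Ys w len by auto
  have "word_eval N Xs (i # w) * S = Xs ! i * (word_eval N Xs w * S)"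
    using assoc_mult_mat[OF Xs[OF i] cX S] by (simp add: word_eval_def)
  also have "\<dots> = (Xs ! i * S) * word_eval m Ys w"
    using assoc_mult_mat[OF Xs[OF i] S cY] Cons.IH[OF w] by simp
  also have "\<dots> = S * word_eval m Ys (i # w)"
    using assoc_mult_mat[OF S Ys[OF i] cY] XS[OF i] by (simp add: word_eval_def)
  finally show ?case .
qed

lemma nc_eval_intertwine:
  assumes Xs: "\<And>i. i < length Xs \<Longrightarrow> Xs ! i \<in> carrier_mat N N"
    and Ys: "\<And>i. i < length Xs \<Longrightarrow> Ys ! i \<in> carrier_mat m m"
    and len: "length Ys = length Xs"
    and S: "S \<in> carrier_mat N m"
    and XS: "\<And>i. i < length Xs \<Longrightarrow> Xs ! i * S = S * Ys ! i"
    and P: "nc_poly_in (length Xs) P"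
  shows "nc_eval N P Xs * S = S * nc_eval m P Ys"
proof (rule eq_matI)
  fix i j assume "i < dim_row (S * nc_eval m P Ys)" "j < dim_col (S * nc_eval m P Ys)"
  then have ij: "i < N" "j < m" using S by (auto simp: nc_eval_def)
  let ?K = "Poly_Mapping.keys P" and ?c = "Poly_Mapping.lookup P"
  have w: "set w \<subseteq> {..<length Xs}" if "w \<in> ?K" for w
    using P that by (auto simp: nc_poly_in_def)
  have cX: "word_eval N Xs w \<in> carrier_mat N N" if "w \<in> ?K" for w
    using word_eval_carrier[OF Xs w[OF that]] .
  have cY: "word_eval m Ys w \<in> carrier_mat m m" if "w \<in> ?K" for w
    using word_eval_carrier[of Ys m w] Ys w[OF that] len by auto
  have "(nc_eval N P Xs * S) $$ (i, j)
      = (\<Sum>h<N. (\<Sum>w\<in>?K. ?c w * word_eval N Xs w $$ (i, h)) * S $$ (h, j))"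
    using ij by (subst mult_mat_index[OF nc_eval_carrier S]) (auto simp: nc_eval_def)
  also have "\<dots> = (\<Sum>w\<in>?K. ?c w * (\<Sum>h<N. word_eval N Xs w $$ (i, h) * S $$ (h, j)))"
    by (simp only: sum_distrib_left sum_distrib_right mult.assoc) (rule sum.swap)
  also have "\<dots> = (\<Sum>w\<in>?K. ?c w * (word_eval N Xs w * S) $$ (i, j))"
    using ij cX by (intro sum.cong refl arg_cong2[of _ _ _ _ "(*)"] mult_mat_index[OF _ S, symmetric]) auto
  also have "\<dots> = (\<Sum>w\<in>?K. ?c w * (S * word_eval m Ys w) $$ (i, j))"
    using word_eval_intertwine[OF Xs Ys len S XS w] by simp
  also have "\<dots> = (\<Sum>w\<in>?K. ?c w * (\<Sum>h<m. S $$ (i, h) * word_eval m Ys w $$ (h, j)))"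
    using ij cY by (intro sum.cong refl arg_cong2[of _ _ _ _ "(*)"] mult_mat_index[OF S]) auto
  also have "\<dots> = (\<Sum>h<m. S $$ (i, h) * (\<Sum>w\<in>?K. ?c w * word_eval m Ys w $$ (h, j)))"
    by (simp only: sum_distrib_left sum_distrib_right mult.left_commute) (rule sum.swap)
  also have "\<dots> = (S * nc_eval m P Ys) $$ (i, j)"
    using ij by (subst mult_mat_index[OF S nc_eval_carrier]) (auto simp: nc_eval_def)
  finally show "(nc_eval N P Xs * S) $$ (i, j) = (S * nc_eval m P Ys) $$ (i, j)" .
qed (use S in \<open>auto simp: nc_eval_def\<close>)

text \<open>The coordinate inclusion for \<open>m \<le> n\<close> and the coordinate projection for
  \<open>n \<le> m\<close>. Corners and compressions become products with it, so associativity
  replaces index computations.\<close>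

definition trunc_id :: "nat \<Rightarrow> nat \<Rightarrow> complex mat" where
  "trunc_id n m = Matrix.mat n m (\<lambda>(i, j). if i = j then 1 else 0)"

lemma trunc_id_carrier [simp]: "trunc_id n m \<in> carrier_mat n m"
  by (simp add: trunc_id_def)

lemma trunc_id_mult:
  assumes "A \<in> carrier_mat m q" "m \<le> n"
  shows "trunc_id n m * A = Matrix.mat n q (\<lambda>(i, j). if i < m then A $$ (i, j) else 0)"
proof (rule eq_matI)
  fix i j assume "i < dim_row (Matrix.mat n q (\<lambda>(i, j). if i < m then A $$ (i, j) else 0))"
    "j < dim_col (Matrix.mat n q (\<lambda>(i, j). if i < m then A $$ (i, j) else 0))"
  then have ij: "i < n" "j < q" by auto
  have "(trunc_id n m * A) $$ (i, j) = (\<Sum>k<m. (if i = k then 1 else 0) * A $$ (k, j))"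
    using assms ij by (subst mult_mat_index[of _ n m _ q]) (auto simp: trunc_id_def simp del: sum_delta_mult intro!: sum.cong)
  then show "(trunc_id n m * A) $$ (i, j)
    = Matrix.mat n q (\<lambda>(i, j). if i < m then A $$ (i, j) else 0) $$ (i, j)"
    using ij by auto
qed (use assms in \<open>auto simp: trunc_id_def\<close>)

lemma mult_trunc_id:
  assumes "A \<in> carrier_mat q n" "m \<le> n"
  shows "A * trunc_id n m = Matrix.mat q m (\<lambda>p. A $$ p)"
proof (rule eq_matI)
  fix i j assume "i < dim_row (Matrix.mat q m (\<lambda>p. A $$ p))"
    "j < dim_col (Matrix.mat q m (\<lambda>p. A $$ p))"
  then have ij: "i < q" "j < m" by auto
  have "(A * trunc_id n m) $$ (i, j) = (\<Sum>k<n. A $$ (i, k) * (if k = j then 1 else 0))"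
    using assms ij by (subst mult_mat_index[of _ q n _ m]) (auto simp: trunc_id_def simp del: sum_delta_mult intro!: sum.cong)
  then show "(A * trunc_id n m) $$ (i, j) = Matrix.mat q m (\<lambda>p. A $$ p) $$ (i, j)"
    using ij assms by auto
qed (use assms in \<open>auto simp: trunc_id_def\<close>)

lemma trunc_id_mult':
  assumes "A \<in> carrier_mat n q" "m \<le> n"
  shows "trunc_id m n * A = Matrix.mat m q (\<lambda>p. A $$ p)"
proof (rule eq_matI)
  fix i j assume "i < dim_row (Matrix.mat m q (\<lambda>p. A $$ p))"
    "j < dim_col (Matrix.mat m q (\<lambda>p. A $$ p))"
  then have ij: "i < m" "j < q" by auto
  have "(trunc_id m n * A) $$ (i, j) = (\<Sum>k<n. (if i = k then 1 else 0) * A $$ (k, j))"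
    using assms ij by (subst mult_mat_index[of _ m n _ q]) (auto simp: trunc_id_def simp del: sum_delta_mult intro!: sum.cong)
  then show "(trunc_id m n * A) $$ (i, j) = Matrix.mat m q (\<lambda>p. A $$ p) $$ (i, j)"
    using ij assms by auto
qed (use assms in \<open>auto simp: trunc_id_def\<close>)

lemma upper_left_block_eq:
  assumes A: "A \<in> carrier_mat n n" and m: "m \<le> n"
  shows "upper_left_block m A = trunc_id m n * (A * trunc_id n m)"
proof -
  have "A * trunc_id n m \<in> carrier_mat n m"
    using A by (rule mult_carrier_mat) simp
  then have "trunc_id m n * (A * trunc_id n m) = Matrix.mat m m (\<lambda>p. (A * trunc_id n m) $$ p)"
    using m by (rule trunc_id_mult')
  also have "\<dots> = upper_left_block m A"
    unfolding mult_trunc_id[OF A m] upper_left_block_def using m by (intro eq_matI) auto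
  finally show ?thesis by simp
qed

lemma corner_embed_carrier:
  "A \<in> carrier_mat r r \<Longrightarrow> r \<le> N \<Longrightarrow> corner_embed r N A \<in> carrier_mat N N"
  using four_block_carrier_mat[of A r r "0\<^sub>m (N - r) (N - r)" "N - r" "N - r"]
  by (simp add: corner_embed_def)

lemma corner_embed_eq:
  assumes "A \<in> carrier_mat r r" "r \<le> N"
  shows "corner_embed r N A = trunc_id N r * (A * trunc_id r N)"
proof (rule eq_matI)
  fix i j assume "i < dim_row (trunc_id N r * (A * trunc_id r N))"
    "j < dim_col (trunc_id N r * (A * trunc_id r N))"
  then have ij: "i < N" "j < N" by (auto simp: trunc_id_def)
  have "(A * trunc_id r N) $$ (k, j) = (if j < r then A $$ (k, j) else 0)" if "k < r" for k
  proof -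
    have "(A * trunc_id r N) $$ (k, j) = (\<Sum>h<r. A $$ (k, h) * (if h = j then 1 else 0))"
      using assms ij that
      by (subst mult_mat_index[of _ r r _ N]) (auto simp: trunc_id_def simp del: sum_delta_mult intro!: sum.cong)
    then show ?thesis by auto
  qed
  moreover have "trunc_id N r * (A * trunc_id r N)
      = Matrix.mat N N (\<lambda>(i, j). if i < r then (A * trunc_id r N) $$ (i, j) else 0)"
    using assms by (intro trunc_id_mult) (auto intro!: mult_carrier_mat)
  ultimately show "corner_embed r N A $$ (i, j) = (trunc_id N r * (A * trunc_id r N)) $$ (i, j)"
    using ij assms by (auto simp: corner_embed_def)
qed (use assms in \<open>auto simp: corner_embed_def trunc_id_def\<close>)

text \<open>The matrix \<open>(E | U E)\<close> with columns e_1, ..., e_r, u_1, ..., u_r. Its lower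
  blocks have no rows; they are there so that the block multiplication rule applies.\<close>

definition frame :: "nat \<Rightarrow> nat \<Rightarrow> complex mat \<Rightarrow> complex mat" where
  "frame r N U =
     four_block_mat (trunc_id N r) (U * trunc_id N r) (0\<^sub>m 0 r) (0\<^sub>m 0 r)"

lemma frame_carrier [simp]: "frame r N U \<in> carrier_mat N (2 * r)"
  using four_block_carrier_mat[of "trunc_id N r" N r "0\<^sub>m 0 r" 0 r]
  by (simp add: frame_def mult_2)

lemma mult_frame:
  assumes U: "U \<in> carrier_mat N N" and X: "X \<in> carrier_mat N N"
  shows "X * frame r N U
    = four_block_mat (X * trunc_id N r) (X * (U * trunc_id N r)) (0\<^sub>m 0 r) (0\<^sub>m 0 r)"
proof -
  have X': "X = four_block_mat X (0\<^sub>m N 0) (0\<^sub>m 0 N) (0\<^sub>m 0 0)"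
    using X by (intro eq_matI) auto
  have UE: "U * trunc_id N r \<in> carrier_mat N r" using U by auto
  have XE: "X * trunc_id N r \<in> carrier_mat N r" using X by auto
  have XUE: "X * (U * trunc_id N r) \<in> carrier_mat N r" using X UE by auto
  have "X * frame r N U = four_block_mat X (0\<^sub>m N 0) (0\<^sub>m 0 N) (0\<^sub>m 0 0) * frame r N U"
    using X' by simp
  also have "\<dots> = four_block_mat (X * trunc_id N r + 0\<^sub>m N 0 * 0\<^sub>m 0 r)
      (X * (U * trunc_id N r) + 0\<^sub>m N 0 * 0\<^sub>m 0 r)
      (0\<^sub>m 0 N * trunc_id N r + 0\<^sub>m 0 0 * 0\<^sub>m 0 r)
      (0\<^sub>m 0 N * (U * trunc_id N r) + 0\<^sub>m 0 0 * 0\<^sub>m 0 r)"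
    unfolding frame_def
    by (rule mult_four_block_mat[of _ N N _ 0 _ 0 _ _ r _ r]) (use X UE in auto)
  also have "\<dots> = four_block_mat (X * trunc_id N r) (X * (U * trunc_id N r)) (0\<^sub>m 0 r) (0\<^sub>m 0 r)"
    using XE XUE UE by (intro arg_cong4[of _ _ _ _ _ _ _ _ four_block_mat] eq_matI) auto
  finally show ?thesis .
qed

lemma frame_mult:
  assumes U: "U \<in> carrier_mat N N"
    and "C1 \<in> carrier_mat r r" "C2 \<in> carrier_mat r r" "C3 \<in> carrier_mat r r" "C4 \<in> carrier_mat r r"
  shows "frame r N U * four_block_mat C1 C2 C3 C4
    = four_block_mat (trunc_id N r * C1 + U * trunc_id N r * C3)
        (trunc_id N r * C2 + U * trunc_id N r * C4) (0\<^sub>m 0 r) (0\<^sub>m 0 r)"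
proof -
  have UE: "U * trunc_id N r \<in> carrier_mat N r" using U by auto
  show ?thesis
    unfolding frame_def
    by (subst mult_four_block_mat[of _ N r _ r _ 0 _ _ r _ r])
       (use assms UE in \<open>auto intro!: arg_cong2[of _ _ _ _ "four_block_mat _ _"] eq_matI\<close>)
qed

lemma trunc_compress:
  assumes U: "U \<in> carrier_mat N N" and r: "r \<le> N"
  shows "trunc_id r N * (U * trunc_id N r) = upper_left_block r U"
    "trunc_id r N * (mat_adjoint U * trunc_id N r) = mat_adjoint (upper_left_block r U)"
proof -
  show "trunc_id r N * (U * trunc_id N r) = upper_left_block r U"
    using upper_left_block_eq[OF U r] by simp
  have c: "mat_adjoint U \<in> carrier_mat N N" using U by auto
  have "upper_left_block r U \<in> carrier_mat r r" by (simp add: upper_left_block_def)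
  then have *: "upper_left_block r (mat_adjoint U) = mat_adjoint (upper_left_block r U)"
    using U r
    by (intro eq_matI)
       (auto simp: upper_left_block_def mat_adjoint_index[of _ N N] mat_adjoint_index[of _ r r])
  show "trunc_id r N * (mat_adjoint U * trunc_id N r) = mat_adjoint (upper_left_block r U)"
    by (rule trans[OF upper_left_block_eq[OF c r, symmetric] *])
qed

lemma corner_embed_mult:
  assumes A: "A \<in> carrier_mat r r" and r: "r \<le> N" and B: "B \<in> carrier_mat N q"
  shows "corner_embed r N A * B = trunc_id N r * (A * (trunc_id r N * B))"
proof -
  have AF: "A * trunc_id r N \<in> carrier_mat r N" using A by (rule mult_carrier_mat) simp
  show ?thesis
    using assoc_mult_mat[OF trunc_id_carrier[of N r] AF B] assoc_mult_mat[OF A trunc_id_carrier B]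
    by (simp add: corner_embed_eq[OF A r])
qed

text \<open>On the columns of \<open>E\<close> the factor \<open>mat_adjoint U\<close> is compressed
  to the adjoint truncation; on the columns of \<open>U * E\<close> it cancels \<open>U\<close>.
  This cancellation is where unitarity enters, and it produces the bare block \<open>A\<close> in
  \<open>a_block\<close>.\<close>

lemma generator_frame_a:
  assumes U: "unitary_mat N U" and r: "r \<le> N" and A: "A \<in> carrier_mat r r"
  shows "(corner_embed r N A * mat_adjoint U) * frame r N U
    = frame r N U * a_block r A (upper_left_block r U)"
proof -
  have cU: "U \<in> carrier_mat N N" and UU: "mat_adjoint U * U = 1\<^sub>m N"
    using U by (auto simp: unitary_mat_def)
  have cV: "mat_adjoint U \<in> carrier_mat N N" using cU by auto
  let ?E = "trunc_id N r" and ?F = "trunc_id r N" and ?W = "upper_left_block r U"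
  have E: "?E \<in> carrier_mat N r" "?F \<in> carrier_mat r N" by simp_all
  have cW: "?W \<in> carrier_mat r r" by (simp add: upper_left_block_def)
  have cW': "mat_adjoint ?W \<in> carrier_mat r r" using cW by auto
  note ce = corner_embed_mult[OF A r]
  have 1: "corner_embed r N A * mat_adjoint U * ?E = ?E * (A * mat_adjoint ?W)"
  proof -
    have "corner_embed r N A * mat_adjoint U * ?E = corner_embed r N A * (mat_adjoint U * ?E)"
      by (rule assoc_mult_mat[OF corner_embed_carrier[OF A r] cV E(1)])
    then show ?thesis using ce[OF mult_carrier_mat[OF cV E(1)]] trunc_compress(2)[OF cU r] by simp
  qed
  have FE: "?F * ?E = 1\<^sub>m r"
    using trunc_id_mult'[of ?E N r r] r by (auto simp: trunc_id_def intro!: eq_matI)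
  have 2: "corner_embed r N A * mat_adjoint U * (U * ?E) = ?E * A"
  proof -
    have "corner_embed r N A * mat_adjoint U * (U * ?E)
        = corner_embed r N A * (mat_adjoint U * (U * ?E))"
      by (rule assoc_mult_mat[OF corner_embed_carrier[OF A r] cV mult_carrier_mat[OF cU E(1)]])
    also have "mat_adjoint U * (U * ?E) = ?E"
      by (simp add: UU left_mult_one_mat[OF E(1)] flip: assoc_mult_mat[OF cV cU E(1)])
    finally show ?thesis using ce[OF E(1)] FE A by simp
  qed
  have "(corner_embed r N A * mat_adjoint U) * frame r N U
      = four_block_mat (?E * (A * mat_adjoint ?W)) (?E * A) (0\<^sub>m 0 r) (0\<^sub>m 0 r)"
    using corner_embed_carrier[OF A r] cV by (subst mult_frame[OF cU]) (auto simp: 1 2)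
  also have "\<dots> = frame r N U * a_block r A ?W"
  proof -
    have UE: "U * ?E \<in> carrier_mat N r" using cU by (rule mult_carrier_mat) simp
    have AW: "A * mat_adjoint ?W \<in> carrier_mat r r" using A cW' by (rule mult_carrier_mat)
    have "?E * (A * mat_adjoint ?W) \<in> carrier_mat N r" "?E * A \<in> carrier_mat N r"
      by (rule mult_carrier_mat[OF E(1) AW], rule mult_carrier_mat[OF E(1) A])
    then show ?thesis
      unfolding a_block_def frame_mult[OF cU AW A zero_carrier_mat zero_carrier_mat]
      by (simp add: right_mult_zero_mat[OF UE])
  qed
  finally show ?thesis .
qed

lemma generator_frame_b:
  assumes cU: "U \<in> carrier_mat N N" and r: "r \<le> N" and A: "A \<in> carrier_mat r r"
  shows "(U * corner_embed r N A) * frame r N U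
    = frame r N U * b_block r A (upper_left_block r U)"
proof -
  let ?E = "trunc_id N r" and ?F = "trunc_id r N" and ?W = "upper_left_block r U"
  have E: "?E \<in> carrier_mat N r" "?F \<in> carrier_mat r N" by simp_all
  have cW: "?W \<in> carrier_mat r r" by (simp add: upper_left_block_def)
  have ce: "U * corner_embed r N A * B = U * ?E * (A * (?F * B))" if B: "B \<in> carrier_mat N q" for B q
  proof -
    have "A * (?F * B) \<in> carrier_mat r q"
      using A by (rule mult_carrier_mat) (rule mult_carrier_mat[OF E(2) B])
    then show ?thesis
      using assoc_mult_mat[OF cU corner_embed_carrier[OF A r] B] assoc_mult_mat[OF cU E(1)]
      by (simp add: corner_embed_mult[OF A r B])
  qed
  have FE: "?F * ?E = 1\<^sub>m r"
    using trunc_id_mult'[of ?E N r r] r by (auto simp: trunc_id_def intro!: eq_matI)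
  have "(U * corner_embed r N A) * frame r N U
      = four_block_mat (U * ?E * A) (U * ?E * (A * ?W)) (0\<^sub>m 0 r) (0\<^sub>m 0 r)"
    using corner_embed_carrier[OF A r] cU ce[OF E(1)] ce[OF mult_carrier_mat[OF cU E(1)]] FE A
      trunc_compress(1)[OF cU r]
    by (subst mult_frame[OF cU]) auto
  also have "\<dots> = frame r N U * b_block r A ?W"
  proof -
    have UE: "U * ?E \<in> carrier_mat N r" using cU by (rule mult_carrier_mat) simp
    have AW: "A * ?W \<in> carrier_mat r r" using A cW by (rule mult_carrier_mat)
    have "U * ?E * (A * ?W) \<in> carrier_mat N r" "U * ?E * A \<in> carrier_mat N r"
      by (rule mult_carrier_mat[OF UE AW], rule mult_carrier_mat[OF UE A])
    then show ?thesis
      unfolding b_block_def frame_mult[OF cU zero_carrier_mat zero_carrier_mat A AW]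
      by (simp add: right_mult_zero_mat[OF E(1)])
  qed
  finally show ?thesis .
qed

section \<open>Invertibility of the change of basis\<close>

lemma basis_matrix_carrier:
  assumes "2 * r \<le> N"
  shows "basis_matrix r N U \<in> carrier_mat N N"
  using assms by (auto simp: basis_matrix_def)

lemma basis_matrix_index:
  assumes N: "2 * r \<le> N" and U: "U \<in> carrier_mat N N" and i: "i < N" and j: "j < N"
  shows "basis_matrix r N U $$ (i, j) =
    (if j < r then (if i = j then 1 else 0)
     else if j < 2 * r then U $$ (i, j - r) else (if i = j - r then 1 else 0))"
  using assms by (auto simp: basis_matrix_def mat_of_cols_index nth_append)

lemma basis_matrix_trunc:
  assumes N: "2 * r \<le> N" and U: "U \<in> carrier_mat N N"
  shows "basis_matrix r N U * trunc_id N (2 * r) = frame r N U"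
proof -
  have r: "r \<le> N" using N by simp
  show ?thesis
    unfolding mult_trunc_id[OF basis_matrix_carrier[OF N] N] frame_def mult_trunc_id[OF U r]
    using N U r by (intro eq_matI) (auto simp: basis_matrix_index trunc_id_def)
qed

definition lower_corner :: "nat \<Rightarrow> nat \<Rightarrow> complex mat \<Rightarrow> complex mat" where
  "lower_corner r N U = Matrix.mat r r (\<lambda>(i, j). U $$ (N - r + i, j))"

text \<open>In the last \<open>r\<close> rows every unit vector of the basis vanishes, so a kernel
  vector restricted to the coefficients of the u_j lies in the kernel of the lower corner and is
  zero. The remaining columns are distinct unit vectors.\<close>

lemma basis_matrix_det:
  assumes N: "2 * r \<le> N" and U: "U \<in> carrier_mat N N"
    and D: "Determinant.det (lower_corner r N U) \<noteq> 0"
  shows "Determinant.det (basis_matrix r N U) \<noteq> 0"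
proof
  assume "Determinant.det (basis_matrix r N U) = 0"
  then obtain v where v: "v \<in> carrier_vec N" "v \<noteq> 0\<^sub>v N"
    and Sv: "basis_matrix r N U *\<^sub>v v = 0\<^sub>v N"
    using det_0_iff_vec_prod_zero_field[OF basis_matrix_carrier[OF N]] by blast
  have eq: "(\<Sum>j<N. basis_matrix r N U $$ (i, j) * vec_index v j) = 0" if "i < N" for i
    using arg_cong[OF Sv, of "\<lambda>x. vec_index x i"] that v(1) basis_matrix_carrier[OF N, of U]
    by (auto simp: scalar_prod_def atLeast0LessThan)
  let ?e = "\<lambda>i j. (if i = j then 1 else 0) :: complex"
  have split: "(\<Sum>j<N. f j) = (\<Sum>j<r. f j) + (\<Sum>j<r. f (r + j)) + (\<Sum>j<N - 2 * r. f (2 * r + j))"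
    for f :: "nat \<Rightarrow> complex"
  proof -
    have "(\<Sum>j<N. f j) = (\<Sum>j<2*r. f j) + (\<Sum>j<N-2*r. f (2*r + j))"
      using sum.nat_group[of f] sum.atLeastLessThan_concat[of 0 "2*r" N f]
        sum.shift_bounds_nat_ivl[of f 0 "2*r" "N - 2*r"] N
      by (simp add: atLeast0LessThan add.commute)
    moreover have "(\<Sum>j<2*r. f j) = (\<Sum>j<r. f j) + (\<Sum>j<r. f (r + j))"
      using sum.atLeastLessThan_concat[of 0 r "2*r" f]
        sum.shift_bounds_nat_ivl[of f 0 r r] N
      by (simp add: atLeast0LessThan add.commute mult_2)
    ultimately show ?thesis by simp
  qed
  have rows: "(\<Sum>j<r. ?e i j * vec_index v j) + (\<Sum>j<r. U $$ (i, j) * vec_index v (r + j))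
      + (\<Sum>j<N - 2 * r. ?e i (r + j) * vec_index v (2 * r + j)) = 0" if "i < N" for i
  proof -
    have "(\<Sum>j<r. basis_matrix r N U $$ (i, j) * vec_index v j)
        = (\<Sum>j<r. ?e i j * vec_index v j)"
      using that N U by (intro sum.cong) (auto simp: basis_matrix_index)
    moreover have "(\<Sum>j<r. basis_matrix r N U $$ (i, r + j) * vec_index v (r + j))
        = (\<Sum>j<r. U $$ (i, j) * vec_index v (r + j))"
      using that N U by (intro sum.cong) (auto simp: basis_matrix_index)
    moreover have "(\<Sum>j<N - 2 * r. basis_matrix r N U $$ (i, 2 * r + j) * vec_index v (2 * r + j))
        = (\<Sum>j<N - 2 * r. ?e i (r + j) * vec_index v (2 * r + j))"
      using that N U by (intro sum.cong) (auto simp: basis_matrix_index)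
    ultimately show ?thesis using eq[OF that] split by simp
  qed
  define y where "y = Matrix.vec r (\<lambda>j. vec_index v (r + j))"
  have "lower_corner r N U *\<^sub>v y = 0\<^sub>v r"
  proof (rule eq_vecI)
    fix i assume "i < dim_vec (0\<^sub>v r :: complex Matrix.vec)"
    then have i: "i < r" by simp
    have "(\<Sum>j<r. ?e (N - r + i) j * vec_index v j) = 0"
      using i N by (intro sum.neutral) auto
    moreover have "(\<Sum>j<N - 2 * r. ?e (N - r + i) (r + j) * vec_index v (2 * r + j)) = 0"
      using i N by (intro sum.neutral) auto
    ultimately have "(\<Sum>j<r. U $$ (N - r + i, j) * vec_index v (r + j)) = 0"
      using rows[of "N - r + i"] i N by simp
    then show "vec_index (lower_corner r N U *\<^sub>v y) i = vec_index (0\<^sub>v r) i"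
      using i by (simp add: lower_corner_def y_def scalar_prod_def atLeast0LessThan)
  qed (simp add: lower_corner_def)
  moreover have "lower_corner r N U \<in> carrier_mat r r" "y \<in> carrier_vec r"
    by (auto simp: lower_corner_def y_def)
  ultimately have "y = 0\<^sub>v r"
    using D det_0_iff_vec_prod_zero_field[of "lower_corner r N U" r] by blast
  then have mid: "vec_index v (r + j) = 0" if "j < r" for j
  proof -
    have "vec_index y j = 0" using \<open>y = 0\<^sub>v r\<close> that by simp
    then show ?thesis using that by (simp add: y_def)
  qed
  then have rows': "(\<Sum>j<r. ?e i j * vec_index v j)
      + (\<Sum>j<N - 2 * r. ?e i (r + j) * vec_index v (2 * r + j)) = 0" if "i < N" for i
    using rows[OF that] by simp
  have low: "vec_index v j = 0" if j: "j < r" for j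
  proof -
    have "(\<Sum>h<r. ?e j h * vec_index v h) = (\<Sum>h<r. if j = h then vec_index v h else 0)"
      by (intro sum.cong) auto
    moreover have "(\<Sum>h<N - 2 * r. ?e j (r + h) * vec_index v (2 * r + h)) = 0"
      using j by (intro sum.neutral) auto
    ultimately show ?thesis using rows'[of j] j N by auto
  qed
  have high: "vec_index v (2 * r + j) = 0" if j: "j < N - 2 * r" for j
  proof -
    have "(\<Sum>h<r. ?e (r + j) h * vec_index v h) = 0"
      by (intro sum.neutral) auto
    moreover have "(\<Sum>h<N - 2 * r. ?e (r + j) (r + h) * vec_index v (2 * r + h))
        = (\<Sum>h<N - 2 * r. if j = h then vec_index v (2 * r + h) else 0)"
      by (intro sum.cong) auto
    ultimately show ?thesis using rows'[of "r + j"] j N by auto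
  qed
  have "vec_index v j = 0" if "j < N" for j
    using low[of j] mid[of "j - r"] high[of "j - 2 * r"] that
    by (cases "j < r"; cases "j < 2 * r") auto
  then have "v = 0\<^sub>v N" using v(1) by (intro eq_vecI) auto
  with v(2) show False by simp
qed

text \<open>The span of the frame is invariant under the model matrix, which acts on it through the
  block polynomial.\<close>

theorem nontrivial_eigenvalues_eq:
  assumes N: "2 * r \<le> N" and U: "unitary_mat N U"
    and A: "\<And>i. i < k \<Longrightarrow> A i \<in> carrier_mat r r" and B: "\<And>j. j < l \<Longrightarrow> B j \<in> carrier_mat r r"
    and P: "nc_poly_in (k + l) P"
    and D: "Determinant.det (lower_corner r N U) \<noteq> 0"
  shows "nontrivial_eigenvalues r k l P A B N U
    = eigenvalues_mset (block_polynomial r k l P A B (upper_left_block r U))"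
proof -
  have cU: "U \<in> carrier_mat N N" using U by (simp add: unitary_mat_def)
  have cV: "mat_adjoint U \<in> carrier_mat N N" using cU by auto
  have r: "r \<le> N" using N by simp
  let ?S = "basis_matrix r N U" and ?W = "upper_left_block r U"
  let ?X = "model_matrix r k l P A B N U" and ?Y = "block_polynomial r k l P A B ?W"
  have cS: "?S \<in> carrier_mat N N" by (rule basis_matrix_carrier[OF N])
  have "?S \<in> Units (ring_mat TYPE(complex) N ())"
    by (rule det_non_zero_imp_unit[OF cS basis_matrix_det[OF N cU D]])
  then obtain S' where inv: "mat_inverse ?S = Some S'"
    using mat_inverse(1)[OF cS, of "()"] by (cases "mat_inverse ?S") auto
  have S': "S' * ?S = 1\<^sub>m N" "S' \<in> carrier_mat N N"
    using mat_inverse(2)[OF cS inv] by auto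
  have cW: "?W \<in> carrier_mat r r" by (simp add: upper_left_block_def)
  have ca: "a_block r (A i) ?W \<in> carrier_mat (2 * r) (2 * r)" if "i < k" for i
    using A[OF that] cW by (auto simp: a_block_def mult_2 mat_adjoint_def)
  have cb: "b_block r (B i) ?W \<in> carrier_mat (2 * r) (2 * r)" if "i < l" for i
    using B[OF that] cW by (auto simp: b_block_def mult_2)
  have XS: "?X * frame r N U = frame r N U * ?Y"
    unfolding model_matrix_def block_polynomial_def
  proof (rule nc_eval_intertwine, goal_cases)
    case (1 i)
    then show ?case
      using corner_embed_carrier[OF A r, of i] corner_embed_carrier[OF B r, of "i - k"] cU cV
      by (auto simp: nth_append)
  next
    case (2 i)
    then show ?case using ca[of i] cb[of "i - k"] by (auto simp: nth_append)
  next
    case (5 i)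
    then show ?case
      using generator_frame_a[OF U r A, of i] generator_frame_b[OF cU r B, of "i - k"]
      by (auto simp: nth_append)
  qed (use P in auto)
  have cX: "?X \<in> carrier_mat N N" and cY: "?Y \<in> carrier_mat (2 * r) (2 * r)"
    by (simp_all add: model_matrix_def block_polynomial_def)
  let ?E = "trunc_id N (2 * r)"
  have cE: "?E \<in> carrier_mat N (2 * r)" by simp
  \<comment> \<open>The first 2r columns of the representing matrix are the block polynomial above
    zeros, and they already contain the upper-left block.\<close>
  have "S' * ?X * ?S * ?E = ?E * ?Y"
  proof -
    have "S' * ?X * ?S * ?E = S' * (?X * (?S * ?E))"
      using S'(2) cX cS cE by (simp add: assoc_mult_mat[of _ N N _ N _ "2 * r"])
    also have "\<dots> = S' * ((?S * ?E) * ?Y)"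
      by (simp add: basis_matrix_trunc[OF N cU] XS)
    also have "\<dots> = ((S' * ?S) * ?E) * ?Y"
      using S'(2) cS cE cY
      by (simp add: assoc_mult_mat[of _ N N _ N _ "2 * r"] assoc_mult_mat[of _ N N _ "2*r" _ "2 * r"]
        assoc_mult_mat[of _ N "2*r" _ "2*r" _ "2 * r"])
    finally show ?thesis by (simp add: S'(1) left_mult_one_mat[OF cE])
  qed
  moreover have "S' * ?X * ?S \<in> carrier_mat N N" using S'(2) cX cS by simp
  ultimately have "upper_left_block (2 * r) (S' * ?X * ?S) = trunc_id (2 * r) N * (?E * ?Y)"
    using upper_left_block_eq[of _ N "2 * r"] N by simp
  also have "\<dots> = ?Y"
    using cY N
    by (subst trunc_id_mult[OF cY N], subst trunc_id_mult'[of _ N _ "2 * r"])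
      (auto intro!: eq_matI)
  finally show ?thesis
    by (simp add: nontrivial_eigenvalues_def representing_matrix_def inv)
qed

section \<open>Haar unitary matrices and their minors\<close>

lemma unitary_matI:
  assumes V: "V \<in> carrier_mat N N"
    and orth: "\<And>i k. i < N \<Longrightarrow> k < N \<Longrightarrow>
      (\<Sum>j<N. V $$ (i, j) * cnj (V $$ (k, j))) = (if i = k then 1 else 0)"
  shows "unitary_mat N V"
proof -
  have c: "mat_adjoint V \<in> carrier_mat N N" using V by auto
  have 1: "V * mat_adjoint V = 1\<^sub>m N"
  proof (rule eq_matI)
    fix i k assume "i < dim_row (1\<^sub>m N :: complex mat)" "k < dim_col (1\<^sub>m N :: complex mat)"
    then have ik: "i < N" "k < N" by auto
    have "(V * mat_adjoint V) $$ (i, k) = (\<Sum>j<N. V $$ (i, j) * cnj (V $$ (k, j)))"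
      by (subst mult_mat_index[OF V c ik]) (auto simp: mat_adjoint_index[OF V] ik intro!: sum.cong)
    then show "(V * mat_adjoint V) $$ (i, k) = (1\<^sub>m N) $$ (i, k)"
      using orth[OF ik] ik by simp
  qed (use V in simp_all)
  show ?thesis
    using 1 mat_mult_left_right_inverse[OF V c 1] V by (simp add: unitary_mat_def)
qed

lemma unitary_mat_rows:
  assumes "unitary_mat N V" "i < N" "k < N"
  shows "(\<Sum>j<N. V $$ (i, j) * cnj (V $$ (k, j))) = (if i = k then 1 else 0)"
proof -
  have V: "V \<in> carrier_mat N N" and 1: "V * mat_adjoint V = 1\<^sub>m N"
    using assms by (auto simp: unitary_mat_def)
  have c: "mat_adjoint V \<in> carrier_mat N N" using V by auto
  have "(V * mat_adjoint V) $$ (i, k) = (\<Sum>j<N. V $$ (i, j) * cnj (V $$ (k, j)))"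
    by (subst mult_mat_index[OF V c assms(2,3)])
      (auto simp: mat_adjoint_index[OF V] assms(2,3) intro!: sum.cong)
  then show ?thesis using 1 assms by simp
qed

lemma unitary_mat_cols:
  assumes "unitary_mat N V" "i < N" "k < N"
  shows "(\<Sum>j<N. V $$ (j, i) * cnj (V $$ (j, k))) = (if i = k then 1 else 0)"
proof -
  have V: "V \<in> carrier_mat N N" and 1: "mat_adjoint V * V = 1\<^sub>m N"
    using assms by (auto simp: unitary_mat_def)
  have c: "mat_adjoint V \<in> carrier_mat N N" using V by auto
  have "(mat_adjoint V * V) $$ (k, i) = (\<Sum>j<N. V $$ (j, i) * cnj (V $$ (j, k)))"
    by (subst mult_mat_index[OF c V assms(3,2)])
      (auto simp: mat_adjoint_index[OF V] assms(2,3) mult.commute intro!: sum.cong)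
  then show ?thesis using 1 assms by auto
qed

lemma borel_measurable_det:
  fixes f :: "'a \<Rightarrow> nat \<times> nat \<Rightarrow> complex"
  assumes "\<And>i j. i < n \<Longrightarrow> j < n \<Longrightarrow> (\<lambda>\<omega>. f \<omega> (i, j)) \<in> borel_measurable M"
  shows "(\<lambda>\<omega>. Determinant.det (Matrix.mat n n (f \<omega>))) \<in> borel_measurable M"
proof -
  have eq: "Determinant.det (Matrix.mat n n (f \<omega>))
    = (\<Sum>p | p permutes {0..<n}. signof p * (\<Prod>i = 0..<n. f \<omega> (i, p i)))" for \<omega>
    by (subst det_def'[of _ n]) (auto simp: permutes_in_image intro!: sum.cong prod.cong)
  have "(\<lambda>\<omega>. f \<omega> (i, p i)) \<in> borel_measurable M" if "p permutes {0..<n}" "i \<in> {0..<n}" for p i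
    using assms[of i "p i"] that permutes_in_image[of p "{0..<n}" i] by auto
  then show ?thesis unfolding eq
    by (intro borel_measurable_sum borel_measurable_times borel_measurable_const borel_measurable_prod)
       auto
qed

text \<open>Generalised permutation matrices: \<open>p = id\<close> gives the row phases,
  \<open>c = 1\<close> the exchange of rows.\<close>

definition monomial_mat :: "nat \<Rightarrow> (nat \<Rightarrow> complex) \<Rightarrow> (nat \<Rightarrow> nat) \<Rightarrow> complex mat" where
  "monomial_mat N c p = Matrix.mat N N (\<lambda>(i, j). if j = p i then c i else 0)"

lemma monomial_mat_mult:
  assumes "p permutes {..<N}" "U \<in> carrier_mat N N" "i < N" "j < N"
  shows "(monomial_mat N c p * U) $$ (i, j) = c i * U $$ (p i, j)"
proof -
  have "p i < N" using assms permutes_in_image[of p "{..<N}" i] by auto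
  have "(monomial_mat N c p * U) $$ (i, j) = (\<Sum>k<N. monomial_mat N c p $$ (i, k) * U $$ (k, j))"
    using assms by (intro mult_mat_index[of _ N N _ N]) (auto simp: monomial_mat_def)
  also have "\<dots> = (\<Sum>k<N. if k = p i then c i * U $$ (k, j) else 0)"
    using assms by (intro sum.cong) (auto simp: monomial_mat_def)
  finally show ?thesis using \<open>p i < N\<close> by simp
qed

lemma unitary_monomial_mat:
  assumes p: "p permutes {..<N}" and c: "\<And>i. i < N \<Longrightarrow> norm (c i) = 1"
  shows "unitary_mat N (monomial_mat N c p)"
proof (rule unitary_matI)
  fix i k assume ik: "i < N" "k < N"
  have pi: "p i < N" using ik permutes_in_image[OF p, of i] by auto
  have "(\<Sum>j<N. monomial_mat N c p $$ (i, j) * cnj (monomial_mat N c p $$ (k, j)))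
     = (\<Sum>j<N. if j = p i then (if p i = p k then c i * cnj (c k) else 0) else 0)"
    using ik by (intro sum.cong) (auto simp: monomial_mat_def)
  also have "\<dots> = (if i = k then c i * cnj (c k) else 0)"
    using pi permutes_inj[OF p] by (auto simp: inj_eq)
  also have "\<dots> = (if i = k then 1 else 0)"
    using c[OF ik(1)] by (auto simp flip: complex_norm_square)
  finally show "(\<Sum>j<N. monomial_mat N c p $$ (i, j) * cnj (monomial_mat N c p $$ (k, j)))
    = (if i = k then 1 else 0)" .
qed (simp add: monomial_mat_def)

text \<open>All entries have modulus 1 / sqrt N. Left multiplication thus writes each row of the
  truncation as an evenly weighted sum over all rows of \<open>U\<close>, which is what makes it a
  sum of many small contributions.\<close>

definition dft_mat :: "nat \<Rightarrow> complex mat" where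
  "dft_mat N = Matrix.mat N N (\<lambda>(i, j). cis (2 * pi * real i * real j / real N) / of_real (sqrt N))"

lemma sum_cis_roots:
  fixes d :: int
  assumes "N > 0" "\<not> int N dvd d"
  shows "(\<Sum>j<N. cis (2 * pi * of_int d * real j / real N)) = 0"
proof -
  define z where "z = cis (2 * pi * of_int d / real N)"
  have zj: "cis (2 * pi * of_int d * real j / real N) = z ^ j" for j
    unfolding z_def Complex.DeMoivre by (simp add: mult_ac)
  have zN: "z ^ N = 1"
    using assms(1) cis_multiple_2pi[of "of_int d"] unfolding z_def Complex.DeMoivre by (simp add: mult.assoc)
  have "z \<noteq> 1"
  proof
    assume "z = 1"
    then have "cos (2 * pi * of_int d / real N) = 1"
      by (metis z_def cis.simps(1) one_complex.simps(1))
    then obtain x :: int where "2 * pi * of_int d / real N = of_int x * 2 * pi"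
      using cos_one_2pi_int by auto
    then have "of_int d = (of_int x * real N)" using assms(1) by (simp add: field_simps)
    then have "d = x * int N" by (metis of_int_eq_iff of_int_mult of_int_of_nat_eq)
    with assms(2) show False by simp
  qed
  then show ?thesis using geometric_sum[of z N] zN by (simp add: zj)
qed

lemma unitary_dft_mat:
  assumes "N > 0"
  shows "unitary_mat N (dft_mat N)"
proof (rule unitary_matI)
  fix i k assume ik: "i < N" "k < N"
  have "(\<Sum>j<N. dft_mat N $$ (i, j) * cnj (dft_mat N $$ (k, j)))
     = (\<Sum>j<N. cis (2 * pi * of_int (int i - int k) * real j / real N) / of_nat N)"
  proof (intro sum.cong refl)
    fix j assume "j \<in> {..<N}"
    have "of_real (sqrt N) * of_real (sqrt N) = (of_nat N :: complex)"
      by (simp flip: of_real_mult)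
    moreover have "cis (2 * pi * real i * real j / real N) * cnj (cis (2 * pi * real k * real j / real N))
       = cis (2 * pi * of_int (int i - int k) * real j / real N)"
      by (simp add: cis_cnj cis_mult diff_divide_distrib algebra_simps)
    ultimately show "dft_mat N $$ (i, j) * cnj (dft_mat N $$ (k, j))
       = cis (2 * pi * of_int (int i - int k) * real j / real N) / of_nat N"
      using ik \<open>j \<in> {..<N}\<close> by (simp add: dft_mat_def)
  qed
  also have "\<dots> = (if i = k then 1 else 0)"
  proof (cases "i = k")
    case False
    then have "\<not> int N dvd int i - int k"
      using ik zdvd_imp_le[of "int N" "\<bar>int i - int k\<bar>"] by auto
    then show ?thesis
      using False sum_cis_roots[OF assms, of "int i - int k"] by (simp flip: sum_divide_distrib)
  qed (use assms in simp)
  finally show "(\<Sum>j<N. dft_mat N $$ (i, j) * cnj (dft_mat N $$ (k, j))) = (if i = k then 1 else 0)" .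
qed (simp add: dft_mat_def)

definition householder :: "nat \<Rightarrow> (nat \<Rightarrow> real) \<Rightarrow> complex mat" where
  "householder N v = Matrix.mat N N (\<lambda>(i, j).
     (if i = j then 1 else 0) - of_real (2 / (\<Sum>k<N. v k * v k) * v i * v j))"

lemma unitary_householder:
  assumes "(\<Sum>k<N. v k * v k) > 0"
  shows "unitary_mat N (householder N v)"
proof (rule unitary_matI)
  fix i k assume ik: "i < N" "k < N"
  define c where "c = 2 / (\<Sum>k<N. v k * v k)"
  have c: "c * (\<Sum>k<N. v k * v k) = 2" using assms by (simp add: c_def)
  let ?d = "\<lambda>i j. (if i = j then 1 else 0) :: real"
  have "(\<Sum>j<N. householder N v $$ (i, j) * cnj (householder N v $$ (k, j)))
     = of_real (\<Sum>j<N. (?d i j - c * v i * v j) * (?d k j - c * v k * v j))"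
    unfolding of_real_sum using ik
    by (intro sum.cong) (auto simp: householder_def c_def)
  also have "(\<Sum>j<N. (?d i j - c * v i * v j) * (?d k j - c * v k * v j))
     = (\<Sum>j<N. if i = j then ?d k i else 0) - (\<Sum>j<N. if i = j then c * v k * v i else 0)
      - (\<Sum>j<N. if k = j then c * v k * v i else 0) + (\<Sum>j<N. c * v i * v k * (c * (v j * v j)))"
    unfolding sum_subtractf[symmetric] sum.distrib[symmetric]
    by (intro sum.cong) (auto simp: algebra_simps)
  also have "\<dots> = ?d i k"
    unfolding sum_distrib_left[symmetric] c using ik by simp
  finally show "(\<Sum>j<N. householder N v $$ (i, j) * cnj (householder N v $$ (k, j)))
    = (if i = k then 1 else 0)" by simp
qed (simp add: householder_def)

lemma mult_householder:
  assumes "U \<in> carrier_mat N N" "i < N" "j < N"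
  shows "(U * householder N v) $$ (i, j)
    = U $$ (i, j) - of_real (2 / (\<Sum>k<N. v k * v k) * v j) * (\<Sum>k<N. U $$ (i, k) * of_real (v k))"
proof -
  let ?c = "complex_of_real (2 / (\<Sum>k<N. v k * v k) * v j)"
  have "(U * householder N v) $$ (i, j)
     = (\<Sum>k<N. U $$ (i, k) * (if k = j then 1 else 0) - ?c * (U $$ (i, k) * of_real (v k)))"
    using assms
    by (subst mult_mat_index[of _ N N _ N])
      (auto simp: householder_def algebra_simps simp del: sum_delta_mult intro!: sum.cong)
  then show ?thesis
    using assms by (simp only: sum_subtractf sum_delta_mult) (simp add: sum_distrib_left)
qed

section \<open>Expectations under an invariant law\<close>

locale haar_matrix = prob_space M for M :: "'w measure" +
  fixes N :: nat and U :: "'w \<Rightarrow> complex mat"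
  assumes haar: "haar_unitary M N U"
begin

abbreviation idx :: "(nat \<times> nat) set" where "idx \<equiv> {..<N} \<times> {..<N}"

lemma unitary: "\<omega> \<in> space M \<Longrightarrow> unitary_mat N (U \<omega>)"
  using haar by (simp add: haar_unitary_def)

lemma carrier: "\<omega> \<in> space M \<Longrightarrow> U \<omega> \<in> carrier_mat N N"
  using unitary by (simp add: unitary_mat_def)

lemma entry_measurable [measurable]:
  "i < N \<Longrightarrow> j < N \<Longrightarrow> (\<lambda>\<omega>. U \<omega> $$ (i, j)) \<in> borel_measurable M"
  using haar by (simp add: haar_unitary_def)

lemma entry_measurable' [measurable]:
  "p \<in> idx \<Longrightarrow> (\<lambda>\<omega>. U \<omega> $$ p) \<in> borel_measurable M"
  using entry_measurable by (cases p) auto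

lemma left_mult_measurable:
  assumes "V \<in> carrier_mat N N" "p \<in> idx"
  shows "(\<lambda>\<omega>. (V * U \<omega>) $$ p) \<in> borel_measurable M"
proof -
  obtain i j where p: "p = (i, j)" "i < N" "j < N" using assms(2) by auto
  have "(\<lambda>\<omega>. \<Sum>k<N. V $$ (i, k) * U \<omega> $$ (k, j)) \<in> borel_measurable M"
    using p by measurable
  then show ?thesis
    by (subst measurable_cong[where g = "\<lambda>\<omega>. \<Sum>k<N. V $$ (i, k) * U \<omega> $$ (k, j)"])
       (auto simp: p mult_mat_index[OF assms(1) carrier])
qed

lemma right_mult_measurable:
  assumes "V \<in> carrier_mat N N" "p \<in> idx"
  shows "(\<lambda>\<omega>. (U \<omega> * V) $$ p) \<in> borel_measurable M"
proof -
  obtain i j where p: "p = (i, j)" "i < N" "j < N" using assms(2) by auto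
  have "(\<lambda>\<omega>. \<Sum>k<N. U \<omega> $$ (i, k) * V $$ (k, j)) \<in> borel_measurable M"
    using p by measurable
  then show ?thesis
    by (subst measurable_cong[where g = "\<lambda>\<omega>. \<Sum>k<N. U \<omega> $$ (i, k) * V $$ (k, j)"])
       (auto simp: p mult_mat_index[OF carrier assms(1)])
qed

text \<open>\<open>mat_law\<close> lives on functions restricted to \<open>idx\<close>, whereas
  \<open>F\<close> is applied to the unrestricted entry function. The assumption
  \<open>local\<close> bridges the two.\<close>

lemma expectation_mat_law:
  fixes F :: "(nat \<times> nat \<Rightarrow> complex) \<Rightarrow> 'b::{banach, second_countable_topology}"
  assumes X: "\<And>p. p \<in> idx \<Longrightarrow> (\<lambda>\<omega>. X \<omega> $$ p) \<in> borel_measurable M"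
    and law: "mat_law M N X = mat_law M N U"
    and F: "F \<in> borel_measurable (Pi\<^sub>M idx (\<lambda>_. borel))"
    and local: "\<And>x y. (\<And>p. p \<in> idx \<Longrightarrow> x p = y p) \<Longrightarrow> F x = F y"
  shows "(\<integral>\<omega>. F (\<lambda>p. X \<omega> $$ p) \<partial>M) = (\<integral>\<omega>. F (\<lambda>p. U \<omega> $$ p) \<partial>M)"
proof -
  have eq: "(\<integral>\<omega>. F (\<lambda>p. Y \<omega> $$ p) \<partial>M) = integral\<^sup>L (mat_law M N Y) F"
    if Y: "\<And>p. p \<in> idx \<Longrightarrow> (\<lambda>\<omega>. Y \<omega> $$ p) \<in> borel_measurable M" for Y
  proof -
    have "(\<integral>\<omega>. F (\<lambda>p. Y \<omega> $$ p) \<partial>M) = (\<integral>\<omega>. F (\<lambda>p\<in>idx. Y \<omega> $$ p) \<partial>M)"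
      by (intro Bochner_Integration.integral_cong refl local) auto
    also have "\<dots> = integral\<^sup>L (mat_law M N Y) F"
      unfolding mat_law_def using Y F by (intro integral_distr[symmetric] measurable_restrict) auto
    finally show ?thesis .
  qed
  show ?thesis using eq[OF X] eq[OF entry_measurable'] law by simp
qed

lemma expectation_left_mult:
  fixes F :: "(nat \<times> nat \<Rightarrow> complex) \<Rightarrow> 'b::{banach, second_countable_topology}"
  assumes V: "unitary_mat N V"
    and F: "F \<in> borel_measurable (Pi\<^sub>M idx (\<lambda>_. borel))"
    and local: "\<And>x y. (\<And>p. p \<in> idx \<Longrightarrow> x p = y p) \<Longrightarrow> F x = F y"
  shows "(\<integral>\<omega>. F (\<lambda>p. (V * U \<omega>) $$ p) \<partial>M) = (\<integral>\<omega>. F (\<lambda>p. U \<omega> $$ p) \<partial>M)"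
  using V haar
  by (intro expectation_mat_law F local left_mult_measurable)
     (auto simp: haar_unitary_def unitary_mat_def)

lemma expectation_right_mult:
  fixes F :: "(nat \<times> nat \<Rightarrow> complex) \<Rightarrow> 'b::{banach, second_countable_topology}"
  assumes V: "unitary_mat N V"
    and F: "F \<in> borel_measurable (Pi\<^sub>M idx (\<lambda>_. borel))"
    and local: "\<And>x y. (\<And>p. p \<in> idx \<Longrightarrow> x p = y p) \<Longrightarrow> F x = F y"
  shows "(\<integral>\<omega>. F (\<lambda>p. (U \<omega> * V) $$ p) \<partial>M) = (\<integral>\<omega>. F (\<lambda>p. U \<omega> $$ p) \<partial>M)"
  using V haar
  by (intro expectation_mat_law F local right_mult_measurable)
     (auto simp: haar_unitary_def unitary_mat_def)

lemma expectation_monomial: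
  fixes F :: "(nat \<times> nat \<Rightarrow> complex) \<Rightarrow> 'b::{banach, second_countable_topology}"
  assumes p: "p permutes {..<N}" and c: "\<And>i. i < N \<Longrightarrow> norm (c i) = 1"
    and F: "F \<in> borel_measurable (Pi\<^sub>M idx (\<lambda>_. borel))"
    and local: "\<And>x y. (\<And>p. p \<in> idx \<Longrightarrow> x p = y p) \<Longrightarrow> F x = F y"
  shows "(\<integral>\<omega>. F (\<lambda>(i, j). c i * U \<omega> $$ (p i, j)) \<partial>M) = (\<integral>\<omega>. F (\<lambda>p. U \<omega> $$ p) \<partial>M)"
proof -
  have "(\<integral>\<omega>. F (\<lambda>(i, j). c i * U \<omega> $$ (p i, j)) \<partial>M)
    = (\<integral>\<omega>. F (\<lambda>q. (monomial_mat N c p * U \<omega>) $$ q) \<partial>M)"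
    by (intro Bochner_Integration.integral_cong refl local)
       (auto simp: monomial_mat_mult[OF p carrier])
  then show ?thesis using expectation_left_mult[OF unitary_monomial_mat[OF p c] F local] by simp
qed

text \<open>Cofactor expansion along the last column expresses the bordered minor as a linear functional
  of that column. Multiplying \<open>U\<close> from the right by Householder reflections along the moment
  curve \<open>(1, t, t\<^sup>2, \<dots>)\<close> turns its vanishing into the vanishing at \<open>t\<close> of one random polynomial,
  so a positive probability would force too many roots.\<close>

lemma minor_nonzero:
  assumes "r \<le> N" "j \<le> r"
  shows "AE \<omega> in M. Determinant.det (Matrix.mat j j (\<lambda>(a, b). U \<omega> $$ (N - r + a, b))) \<noteq> 0"
  using assms(2)
proof (induction j)
  case 0
  then show ?case by (simp add: det_def)
next
  case (Suc j)
  define row where "row a = N - r + a" for a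
  have row: "row a < N" if "a \<le> j" for a using that Suc.prems assms(1) by (auto simp: row_def)
  have jN: "j < N" using Suc.prems assms(1) by simp
  define T :: "(nat \<times> nat \<Rightarrow> complex) \<Rightarrow> complex mat"
    where "T x = Matrix.mat (Suc j) (Suc j) (\<lambda>(a, b). x (row a, b))" for x
  \<comment> \<open>By expansion along the last column, \<open>y x c\<close> is the determinant of
    \<open>T x\<close> with that column replaced by column \<open>c\<close> of \<open>x\<close>; the
    cofactors do not involve it. Hence it is zero for \<open>c < j\<close>, where two columns
    coincide.\<close>
  define y where "y x c = (\<Sum>a<Suc j. x (row a, c) * cofactor (T x) a j)" for x c
  have T: "T x \<in> carrier_mat (Suc j) (Suc j)" for x by (simp add: T_def)
  have detT: "Determinant.det (T x) = y x j" for x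
    unfolding y_def
    by (subst laplace_expansion_column[OF T, of j]) (auto simp: T_def intro!: sum.cong)
  have cof: "cofactor (T x) a j = cofactor (T x') a j"
    if "\<And>a b. a \<le> j \<Longrightarrow> b < j \<Longrightarrow> x (row a, b) = x' (row a, b)" for x x' a
    unfolding cofactor_def
    by (intro arg_cong[of _ _ "\<lambda>D. _ * Determinant.det D"] eq_matI)
       (auto simp: mat_delete_def T_def intro!: that)
  have low: "y x c = 0" if c: "c < j" for x c
  proof -
    define x' where "x' = (\<lambda>(a, b). if b = j then x (a, c) else x (a, b))"
    have "cofactor (T x) a j = cofactor (T x') a j" for a
      by (rule cof) (auto simp: x'_def)
    then have "y x c = y x' j" by (auto simp: y_def x'_def intro!: sum.cong)
    also have "\<dots> = 0"
      unfolding detT[symmetric]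
      by (rule det_identical_columns[OF T, of c j]) (use c in \<open>auto simp: T_def x'_def intro!: eq_vecI\<close>)
    finally show ?thesis .
  qed
  \<comment> \<open>Pairing \<open>y\<close> with the conjugate of row \<open>row j\<close> returns,
    by orthonormality of the rows, the cofactor at \<open>(j, j)\<close>. This is the smaller minor,
    nonzero by induction.\<close>
  have nonzero: "AE \<omega> in M. \<exists>c\<in>{j..<N}. y (\<lambda>p. U \<omega> $$ p) c \<noteq> 0"
    using Suc.IH[OF Suc_leD[OF Suc.prems]] AE_space
  proof eventually_elim
    case (elim \<omega>)
    let ?u = "\<lambda>p. U \<omega> $$ p"
    show ?case
    proof (rule ccontr)
      assume "\<not> ?thesis"
      then have all: "y ?u c = 0" if "c < N" for c using low[of c] that by (cases "c < j") auto
      have "cofactor (T ?u) j j = (\<Sum>a<Suc j. cofactor (T ?u) a j * (if a = j then 1 else 0))"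
        by simp
      also have "\<dots> = (\<Sum>a<Suc j. cofactor (T ?u) a j * (\<Sum>c<N. ?u (row a, c) * cnj (?u (row j, c))))"
        using row by (intro sum.cong refl arg_cong2[of _ _ _ _ "(*)"])
          (auto simp: unitary_mat_rows[OF unitary[OF elim(2)]] row_def)
      also have "\<dots> = (\<Sum>c<N. y ?u c * cnj (?u (row j, c)))"
        unfolding y_def sum_distrib_left sum_distrib_right
        by (subst sum.swap) (simp add: mult_ac)
      also have "\<dots> = 0" using all by simp
      finally have "cofactor (T ?u) j j = 0" .
      moreover have "mat_delete (T ?u) j j = Matrix.mat j j (\<lambda>(a, b). U \<omega> $$ (N - r + a, b))"
        by (auto simp: mat_delete_def T_def row_def intro!: eq_matI)
      ultimately show False using elim(1) by (simp add: cofactor_def)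
    qed
  qed
  \<comment> \<open>This is the reflected minor multiplied by the squared length of
    \<open>v t\<close>, which clears the denominator of the Householder matrix: the first sum is
    that squared length, the second the pairing of \<open>v t\<close> with \<open>y\<close>.\<close>
  define q where "q x = Polynomial.smult (y x j) (\<Sum>k<N - j. monom 1 (2 * k))
      - Polynomial.smult 2 (\<Sum>k<N - j. monom (y x (j + k)) k)" for x
  have q_degree: "degree (q x) \<le> 2 * N" for x
    unfolding q_def
    by (intro degree_diff_le order.trans[OF degree_smult_le] degree_sum_le)
       (auto intro!: order.trans[OF degree_monom_le])
  have q_nonzero: "q x \<noteq> 0" if c: "c \<in> {j..<N}" "y x c \<noteq> 0" for x c
  proof
    assume q0: "q x = 0"
    have co: "coeff (q x) m = y x j * (\<Sum>k<N - j. if 2 * k = m then 1 else 0)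
        - 2 * (\<Sum>k<N - j. if k = m then y x (j + k) else 0)" for m
      by (simp add: q_def coeff_sum)
    \<comment> \<open>At degree 0 the two sums give \<open>y x j - 2 * y x j\<close>. So
      \<open>q x = 0\<close> forces \<open>y x j = 0\<close>; the first sum then disappears and the
      other coefficients force every later \<open>y x c\<close> to vanish.\<close>
    have "(\<Sum>k<N - j. if 2 * k = 0 then 1 else 0) = (\<Sum>k<N - j. if k = 0 then 1 else (0::complex))"
      by (intro sum.cong) auto
    then have "coeff (q x) 0 = - y x j" using co[of 0] jN by simp
    then have "y x j = 0" using q0 by simp
    moreover have "c - j < N - j" "j + (c - j) = c" using c(1) by auto
    ultimately have "coeff (q x) (c - j) = - 2 * y x c" using co[of "c - j"] by simp
    then show False using q0 c by simp
  qed
  \<comment> \<open>The zeros in front keep the first \<open>j\<close> columns, hence the cofactors,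
    unchanged under the reflection. The entry at \<open>k = j\<close> is 1 even for
    \<open>t = 0\<close>, so \<open>v t\<close> never vanishes.\<close>
  define v where "v t k = (if k < j then 0 else t ^ (k - j) :: real)" for t k
  have shift: "(\<Sum>k<N. if k < j then 0 else g (k - j)) = (\<Sum>k<N - j. g k)" for g :: "nat \<Rightarrow> 'x::comm_monoid_add"
    using sum.atLeastLessThan_concat[of 0 j N "\<lambda>k. if k < j then 0 else g (k - j)"]
      sum.shift_bounds_nat_ivl[of "\<lambda>k. if k < j then 0 else g (k - j)" 0 j "N - j"] jN
    by (simp add: atLeast0LessThan add.commute)
  have norm_v: "(\<Sum>k<N. v t k * v t k) = (\<Sum>k<N - j. t ^ (2 * k))" for t
    by (subst shift[symmetric]) (auto simp: v_def power_even_eq power2_eq_square intro!: sum.cong)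
  have norm_pos: "(\<Sum>k<N. v t k * v t k) > 0" for t
    by (rule sum_pos2[of _ j]) (use jN in \<open>auto simp: v_def\<close>)
  have reflect: "of_real (\<Sum>k<N. v t k * v t k)
      * Determinant.det (T (\<lambda>p. (U \<omega> * householder N (v t)) $$ p)) = poly (q (\<lambda>p. U \<omega> $$ p)) (of_real t)"
    if \<omega>: "\<omega> \<in> space M" for \<omega> t
  proof -
    let ?u = "\<lambda>p. U \<omega> $$ p" and ?w = "\<lambda>p. (U \<omega> * householder N (v t)) $$ p"
    let ?s = "\<Sum>k<N. v t k * v t k"
    have "cofactor (T ?w) a j = cofactor (T ?u) a j" for a
    proof (rule cof)
      fix a b assume ab: "a \<le> j" "b < j"
      then have "b < N" using jN by simp
      then show "?w (row a, b) = ?u (row a, b)"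
        using mult_householder[OF carrier[OF \<omega>] row[OF ab(1)], of b "v t"] ab by (simp add: v_def)
    qed
    then have "Determinant.det (T ?w) = (\<Sum>a<Suc j. ?w (row a, j) * cofactor (T ?u) a j)"
      unfolding detT y_def by simp
    also have "\<dots> = (\<Sum>a<Suc j. ?u (row a, j) * cofactor (T ?u) a j
        - of_real (2 / ?s) * (\<Sum>k<N. of_real (v t k) * (?u (row a, k) * cofactor (T ?u) a j)))"
      by (intro sum.cong refl, subst mult_householder[OF carrier[OF \<omega>]])
         (auto simp: row jN v_def sum_distrib_left sum_distrib_right algebra_simps)
    also have "\<dots> = y ?u j - of_real (2 / ?s) * (\<Sum>k<N. of_real (v t k) * y ?u k)"
    proof -
      have "(\<Sum>a<Suc j. g a - c * (\<Sum>k<N. f k * h a k))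
        = (\<Sum>a<Suc j. g a) - c * (\<Sum>k<N. f k * (\<Sum>a<Suc j. h a k))"
        for g f :: "nat \<Rightarrow> complex" and h :: "nat \<Rightarrow> nat \<Rightarrow> complex" and c
      proof -
        have "(\<Sum>a<Suc j. c * (\<Sum>k<N. f k * h a k)) = c * (\<Sum>k<N. f k * (\<Sum>a<Suc j. h a k))"
          unfolding sum_distrib_left by (rule sum.swap)
        then show ?thesis by (simp only: sum_subtractf)
      qed
      then show ?thesis unfolding y_def .
    qed
    also have "(\<Sum>k<N. of_real (v t k) * y ?u k) = (\<Sum>k<N - j. of_real t ^ k * y ?u (j + k))"
      by (subst shift[symmetric]) (auto simp: v_def intro!: sum.cong)
    finally have "Determinant.det (T ?w)
        = y ?u j - of_real (2 / ?s) * (\<Sum>k<N - j. of_real t ^ k * y ?u (j + k))" .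
    moreover have "complex_of_real ?s * of_real (2 / ?s) = 2"
    proof -
      have "?s * (2 / ?s) = 2" using norm_pos[of t] by simp
      then show ?thesis by (metis of_real_mult of_real_numeral)
    qed
    ultimately have "of_real ?s * Determinant.det (T ?w)
        = of_real ?s * y ?u j - 2 * (\<Sum>k<N - j. of_real t ^ k * y ?u (j + k))"
      by (simp only: right_diff_distrib mult.assoc[symmetric])
    then show ?thesis
      by (simp add: q_def norm_v poly_sum poly_monom mult.commute)
  qed
  define F where "F x = (of_bool (Determinant.det (T x) = 0) :: real)" for x
  have F_measurable: "F \<in> borel_measurable (Pi\<^sub>M idx (\<lambda>_. borel))"
  proof -
    have "(\<lambda>x. Determinant.det (T x)) \<in> borel_measurable (Pi\<^sub>M idx (\<lambda>_. borel))"
      unfolding T_def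
      by (rule borel_measurable_det) (use row jN in \<open>auto intro!: measurable_component_singleton\<close>)
    then show ?thesis unfolding F_def of_bool_def by measurable
  qed
  have F_local: "F x = F x'" if "\<And>p. p \<in> idx \<Longrightarrow> x p = x' p" for x x'
  proof -
    have "T x = T x'" unfolding T_def
      by (intro eq_matI) (use row jN in \<open>auto intro!: that\<close>)
    then show ?thesis by (simp add: F_def)
  qed
  define p where "p = expectation (\<lambda>\<omega>. F (\<lambda>p. U \<omega> $$ p))"
  have FU: "(\<lambda>\<omega>. F (\<lambda>p. U \<omega> $$ p)) \<in> borel_measurable M"
  proof -
    have "(\<lambda>\<omega>. Determinant.det (T (\<lambda>p. U \<omega> $$ p))) \<in> borel_measurable M"
      unfolding T_def by (rule borel_measurable_det) (use row jN in auto)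
    then show ?thesis unfolding F_def of_bool_def by measurable
  qed
  have FV: "(\<lambda>\<omega>. F (\<lambda>p. (U \<omega> * householder N (v t)) $$ p)) \<in> borel_measurable M" for t
  proof -
    have "(\<lambda>\<omega>. Determinant.det (T (\<lambda>p. (U \<omega> * householder N (v t)) $$ p))) \<in> borel_measurable M"
      unfolding T_def using row jN
      by (intro borel_measurable_det) (auto intro!: right_mult_measurable simp: householder_def)
    then show ?thesis unfolding F_def of_bool_def by measurable
  qed
  \<comment> \<open>Each of the \<open>K\<close> reflected matrices has the law of \<open>U\<close>,
    so \<open>K * p\<close> is the expected number of parameters \<open>t < K\<close> with singular
    minor. These parameters are roots of one nonzero polynomial of degree at most 2N.\<close>
  have bound: "real K * p \<le> real (2 * N)" for K
  proof -
    have "real K * p = (\<Sum>t<K. expectation (\<lambda>\<omega>. F (\<lambda>p. (U \<omega> * householder N (v (real t))) $$ p)))"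
      using expectation_right_mult[OF unitary_householder[OF norm_pos] F_measurable F_local]
      by (simp add: p_def)
    also have "\<dots> = expectation (\<lambda>\<omega>. \<Sum>t<K. F (\<lambda>p. (U \<omega> * householder N (v (real t))) $$ p))"
      by (intro Bochner_Integration.integral_sum[symmetric] integrable_const_bound[where B = 1] FV)
         (auto simp: F_def)
    also have "\<dots> \<le> expectation (\<lambda>\<omega>. real (2 * N))"
    proof (rule integral_mono_AE)
      show "integrable M (\<lambda>\<omega>. \<Sum>t<K. F (\<lambda>p. (U \<omega> * householder N (v (real t))) $$ p))"
        by (intro Bochner_Integration.integrable_sum integrable_const_bound[where B = 1] FV)
           (auto simp: F_def)
      show "AE \<omega> in M. (\<Sum>t<K. F (\<lambda>p. (U \<omega> * householder N (v (real t))) $$ p)) \<le> real (2 * N)"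
        using nonzero AE_space
      proof eventually_elim
        case (elim \<omega>)
        let ?q = "q (\<lambda>p. U \<omega> $$ p)"
        have q0: "?q \<noteq> 0" using elim(1) q_nonzero by blast
        have "(\<Sum>t<K. F (\<lambda>p. (U \<omega> * householder N (v (real t))) $$ p))
          = (\<Sum>t<K. of_bool (poly ?q (of_real (real t)) = 0))"
        proof (intro sum.cong refl)
          fix t
          have s: "complex_of_real (\<Sum>k<N. v (real t) k * v (real t) k) \<noteq> 0"
            using norm_pos[of "real t"] by (metis less_irrefl of_real_eq_0_iff)
          show "F (\<lambda>p. (U \<omega> * householder N (v (real t))) $$ p)
            = of_bool (poly ?q (of_real (real t)) = 0)"
            unfolding F_def reflect[OF elim(2), symmetric] using s by simp
        qed
        also have "\<dots> = real (card {t \<in> {..<K}. poly ?q (of_real (real t)) = 0})"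
          by (simp add: of_bool_def sum.If_cases Int_def)
        also have "card {t \<in> {..<K}. poly ?q (of_real (real t)) = 0} \<le> card {z. poly ?q z = 0}"
          by (rule card_inj_on_le[of "\<lambda>t. of_real (real t)"]) (auto simp: inj_on_def poly_roots_finite[OF q0])
        also have "card {z. poly ?q z = 0} \<le> 2 * N"
          using card_poly_roots_bound[OF q0] q_degree order.trans by blast
        finally show ?case by simp
      qed
    qed simp
    also have "\<dots> = real (2 * N)" by (simp add: prob_space)
    finally show ?thesis .
  qed
  have "p \<ge> 0" by (simp add: p_def F_def)
  have "p = 0"
  proof (rule ccontr)
    assume "p \<noteq> 0"
    with \<open>p \<ge> 0\<close> obtain K where "real (2 * N) < real K * p"
      using reals_Archimedean3[of p] by auto
    with bound[of K] show False by simp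
  qed
  then have "AE \<omega> in M. F (\<lambda>p. U \<omega> $$ p) = 0"
    unfolding p_def using FU
    by (subst (asm) integral_nonneg_eq_0_iff_AE)
       (auto simp: F_def intro!: integrable_const_bound[where B = 1])
  then show ?case by (auto simp: F_def T_def row_def)
qed

lemma lower_corner_nonzero:
  assumes "r \<le> N"
  shows "AE \<omega> in M. Determinant.det (lower_corner r N (U \<omega>)) \<noteq> 0"
  using minor_nonzero[OF assms order.refl] by (simp add: lower_corner_def)

end

section \<open>The characteristic function of the truncation\<close>

text \<open>The average of \<open>cis (sqrt 2 * Re (e * z))\<close> over the fourth roots of unity
  \<open>e\<close>. The factor \<open>sqrt 2\<close> makes it agree with exp(-|z|^2 / 2) up to order
  |z|^4.\<close>

definition phase_kernel :: "complex \<Rightarrow> real" where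
  "phase_kernel z = (cos (sqrt 2 * Re z) + cos (sqrt 2 * Im z)) / 2"

text \<open>The cubic term of the exponential series is purely imaginary, so the real part inherits
  the fourth-order remainder, with constant (sqrt 2)^4 / 4! = 1/6.\<close>

lemma cos_quadratic_bound: "\<bar>cos (sqrt 2 * a) - (1 - a\<^sup>2)\<bar> \<le> a ^ 4 / 6"
proof -
  let ?D = "iexp (sqrt 2 * a) - (\<Sum>k\<le>3. (\<i> * (sqrt 2 * a)) ^ k / fact k)"
  have "Re ?D = cos (sqrt 2 * a) - (1 - a\<^sup>2)"
    by (simp add: numeral_3_eq_3 power2_eq_square Re_exp fact_numeral field_simps)
  then have "\<bar>cos (sqrt 2 * a) - (1 - a\<^sup>2)\<bar> \<le> norm ?D"
    using abs_Re_le_cmod[of ?D] by (simp only:)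
  also have "\<dots> \<le> \<bar>sqrt 2 * a\<bar> ^ Suc 3 / fact (Suc 3)"
    by (rule iexp_approx1)
  also have "\<dots> = a ^ 4 / 6"
  proof -
    have "\<bar>sqrt 2 * a\<bar> ^ 4 = (sqrt 2 * a) ^ 4" by (rule power_even_abs) simp
    also have "\<dots> = ((sqrt 2)\<^sup>2)\<^sup>2 * a ^ 4" unfolding power_mult_distrib power_mult[symmetric] by simp
    also have "((sqrt 2)\<^sup>2)\<^sup>2 = (4::real)" by simp
    finally show ?thesis by (simp add: fact_numeral)
  qed
  finally show ?thesis .
qed

text \<open>The upper bound comes from multiplying by 1 + u: exp(-u) (1 + u) is at most 1, while (1
  - u + u^2) (1 + u) = 1 + u^3.\<close>

lemma exp_quadratic_bound: "u \<ge> 0 \<Longrightarrow> \<bar>exp (- u) - (1 - u)\<bar> \<le> (u::real)\<^sup>2"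
proof -
  assume u: "u \<ge> 0"
  have "1 - u \<le> exp (- u)" using exp_ge_add_one_self[of "-u"] by simp
  moreover have "exp (- u) \<le> 1 - u + u\<^sup>2"
  proof -
    have "exp (- u) * (1 + u) \<le> exp (- u) * exp u"
      using exp_ge_add_one_self[of u] by (intro mult_left_mono) auto
    also have "\<dots> = 1" by (simp flip: exp_add)
    also have "1 \<le> (1 - u + u\<^sup>2) * (1 + u)" using u by (simp add: algebra_simps power2_eq_square)
    finally show ?thesis using u by (simp add: mult_le_cancel_right)
  qed
  ultimately show ?thesis by (simp add: abs_le_iff)
qed

text \<open>Both functions are compared with 1 - |z|^2 / 2. The errors are at most 1/12 and 1/4 of
  |z|^4, so the constant 1 is generous.\<close>

lemma phase_kernel_approx: "\<bar>phase_kernel z - exp (- ((norm z)\<^sup>2 / 2))\<bar> \<le> norm z ^ 4"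
proof -
  let ?a = "Re z" and ?b = "Im z"
  have z: "(norm z)\<^sup>2 = ?a\<^sup>2 + ?b\<^sup>2" by (rule cmod_power2)
  have z4: "norm z ^ 4 = (?a\<^sup>2 + ?b\<^sup>2)\<^sup>2"
    unfolding z[symmetric] power_mult[symmetric] by simp
  have 1: "phase_kernel z - exp (- ((norm z)\<^sup>2 / 2))
     = (cos (sqrt 2 * ?a) - (1 - ?a\<^sup>2)) / 2 + (cos (sqrt 2 * ?b) - (1 - ?b\<^sup>2)) / 2
       - (exp (- ((norm z)\<^sup>2 / 2)) - (1 - (norm z)\<^sup>2 / 2))"
    by (simp add: phase_kernel_def z field_simps)
  have 2: "\<bar>exp (- ((norm z)\<^sup>2 / 2)) - (1 - (norm z)\<^sup>2 / 2)\<bar> \<le> norm z ^ 4 / 4"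
    using exp_quadratic_bound[of "(norm z)\<^sup>2 / 2"] by (simp add: power_divide)
  have 3: "?a ^ 4 / 6 + ?b ^ 4 / 6 \<le> norm z ^ 4 / 6"
  proof -
    have "0 \<le> ?a\<^sup>2 * ?b\<^sup>2" by simp
    then show ?thesis unfolding z4 by (simp add: power2_eq_square power4_eq_xxxx algebra_simps)
  qed
  have aux: "\<bar>k\<bar> \<le> x" if "k = A / 2 + B / 2 - C" "\<bar>C\<bar> \<le> x / 4" "p / 6 + q / 6 \<le> x / 6" "x \<ge> 0"
    "\<bar>A\<bar> \<le> p / 6" "\<bar>B\<bar> \<le> q / 6" for k A B C x p q :: real
    using that by (auto simp: abs_le_iff)
  show ?thesis
    by (rule aux[OF 1 2 3 _ cos_quadratic_bound cos_quadratic_bound]) simp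
qed

lemma abs_phase_kernel_le: "\<bar>phase_kernel z\<bar> \<le> 1"
proof -
  have "\<bar>(x + y) / 2\<bar> \<le> 1" if "\<bar>x\<bar> \<le> 1" "\<bar>y\<bar> \<le> 1" for x y :: real
    using that by (auto simp: abs_le_iff)
  then show ?thesis unfolding phase_kernel_def by (meson abs_cos_le_one)
qed

lemma exp_minus_lipschitz:
  fixes a b :: real
  assumes "a \<ge> 0" "b \<ge> 0"
  shows "\<bar>exp (- a) - exp (- b)\<bar> \<le> \<bar>a - b\<bar>"
proof -
  have le: "exp (- a) - exp (- b) \<le> b - a" if "0 \<le> a" "a \<le> b" for a b :: real
  proof -
    have "exp (- a) - exp (- b) = exp (- a) * (1 - exp (- (b - a)))"
      by (simp add: algebra_simps flip: exp_add)
    also have "\<dots> \<le> 1 * (b - a)"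
    proof (intro mult_mono)
      show "1 - exp (- (b - a)) \<le> b - a"
        unfolding minus_diff_eq using exp_ge_add_one_self[of "a - b"] by linarith
    qed (use that in auto)
    finally show ?thesis by simp
  qed
  show ?thesis
  proof (cases "a \<le> b")
    case True
    then have "exp (- b) \<le> exp (- a)" by simp
    then show ?thesis using le[OF assms(1) True] True by simp
  next
    case False
    then have "exp (- a) \<le> exp (- b)" by simp
    then show ?thesis using le[of b a] assms False by simp
  qed
qed

text \<open>The Cauchy-Schwarz inequality applied twice.\<close>

lemma power4_sum_le:
  fixes y :: "nat \<Rightarrow> real"
  assumes "\<And>j. y j \<ge> 0"
  shows "(\<Sum>j<r. y j) ^ 4 \<le> real r ^ 3 * (\<Sum>j<r. y j ^ 4)"
proof -
  have "(\<Sum>j<r. y j) ^ 4 = ((\<Sum>j<r. y j)\<^sup>2)\<^sup>2" by simp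
  also have "\<dots> \<le> ((\<Sum>j<r. (y j)\<^sup>2) * real r)\<^sup>2"
    using sum_squared_le_sum_of_squares[of y "{..<r}"] by (intro power_mono) auto
  also have "\<dots> = (\<Sum>j<r. (y j)\<^sup>2)\<^sup>2 * (real r)\<^sup>2" by (simp add: power_mult_distrib)
  also have "\<dots> \<le> ((\<Sum>j<r. ((y j)\<^sup>2)\<^sup>2) * real r) * (real r)\<^sup>2"
    using sum_squared_le_sum_of_squares[of "\<lambda>j. (y j)\<^sup>2" "{..<r}"] by (intro mult_right_mono) auto
  also have "\<dots> = real r ^ 3 * (\<Sum>j<r. y j ^ 4)"
    by (simp add: power3_eq_cube power4_eq_xxxx power2_eq_square mult.assoc)
  finally show ?thesis .
qed

section \<open>Moments of the entries of a Haar unitary matrix\<close>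

context haar_matrix
begin

text \<open>The functionals to which invariance applies and whose integrals exist. Boundedness is
  asked only on the unit polydisc, where the entries of a unitary matrix lie, so polynomials in the
  entries qualify and the class is closed under sums, products and continuous maps.\<close>

definition tame :: "((nat \<times> nat \<Rightarrow> complex) \<Rightarrow> 'b::{banach, second_countable_topology}) \<Rightarrow> bool" where
  "tame F \<longleftrightarrow> F \<in> borel_measurable (Pi\<^sub>M idx (\<lambda>_. borel)) \<and>
     (\<forall>x y. (\<forall>p\<in>idx. x p = y p) \<longrightarrow> F x = F y) \<and>
     (\<exists>C. \<forall>x. (\<forall>p\<in>idx. norm (x p) \<le> 1) \<longrightarrow> norm (F x) \<le> C)"

lemma tame_const: "tame (\<lambda>_. c)"
  by (auto simp: tame_def)

lemma tame_coord: "i < N \<Longrightarrow> j < N \<Longrightarrow> tame (\<lambda>x. x (i, j))"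
  by (auto simp: tame_def intro!: measurable_component_singleton exI[of _ 1])

text \<open>A continuous \<open>g\<close> is bounded on the closed ball containing the values of
  \<open>F\<close> on the polydisc, because that ball is compact.\<close>

lemma tame_cont:
  fixes F :: "(nat \<times> nat \<Rightarrow> complex) \<Rightarrow> 'b::{banach, second_countable_topology, heine_borel}"
    and g :: "'b \<Rightarrow> 'c::{banach, second_countable_topology}"
  assumes g: "continuous_on UNIV g" and F: "tame F"
  shows "tame (\<lambda>x. g (F x))"
proof -
  obtain C where C: "\<And>x. (\<forall>p\<in>idx. norm (x p) \<le> 1) \<Longrightarrow> norm (F x) \<le> C"
    using F by (auto simp: tame_def)
  have "compact (g ` cball 0 C)"
    by (intro compact_continuous_image continuous_on_subset[OF g]) auto
  then obtain D where "\<And>y. y \<in> cball 0 C \<Longrightarrow> norm (g y) \<le> D"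
    by (meson compact_imp_bounded bounded_iff imageI)
  then have "\<exists>D. \<forall>x. (\<forall>p\<in>idx. norm (x p) \<le> 1) \<longrightarrow> norm (g (F x)) \<le> D"
    using C by (auto intro!: exI[of _ D])
  moreover have "(\<lambda>x. g (F x)) \<in> borel_measurable (Pi\<^sub>M idx (\<lambda>_. borel))"
    using F borel_measurable_continuous_onI[OF g] by (auto simp: tame_def)
  moreover have "g (F x) = g (F y)" if "\<forall>p\<in>idx. x p = y p" for x y
    using F that unfolding tame_def by metis
  ultimately show ?thesis unfolding tame_def by blast
qed

lemma tame_add: "tame F \<Longrightarrow> tame G \<Longrightarrow> tame (\<lambda>x. F x + G x)"
proof -
  assume F: "tame F" and G: "tame G"
  obtain C D where "\<And>x. (\<forall>p\<in>idx. norm (x p) \<le> 1) \<Longrightarrow> norm (F x) \<le> C"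
    "\<And>x. (\<forall>p\<in>idx. norm (x p) \<le> 1) \<Longrightarrow> norm (G x) \<le> D"
    using F G unfolding tame_def by metis
  then have "\<exists>D. \<forall>x. (\<forall>p\<in>idx. norm (x p) \<le> 1) \<longrightarrow> norm (F x + G x) \<le> D"
    by (intro exI[of _ "C + D"]) (meson norm_triangle_mono)
  moreover have "F x + G x = F y + G y" if "\<forall>p\<in>idx. x p = y p" for x y
    using F G that unfolding tame_def by metis
  ultimately show ?thesis using F G unfolding tame_def by auto
qed

lemma tame_mult:
  fixes F G :: "(nat \<times> nat \<Rightarrow> complex) \<Rightarrow> 'b::{banach, second_countable_topology, real_normed_algebra}"
  shows "tame F \<Longrightarrow> tame G \<Longrightarrow> tame (\<lambda>x. F x * G x)"
proof -
  assume F: "tame F" and G: "tame G"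
  obtain C D where CD: "\<And>x. (\<forall>p\<in>idx. norm (x p) \<le> 1) \<Longrightarrow> norm (F x) \<le> C"
    "\<And>x. (\<forall>p\<in>idx. norm (x p) \<le> 1) \<Longrightarrow> norm (G x) \<le> D"
    using F G unfolding tame_def by metis
  have "norm (F x * G x) \<le> C * D" if "\<forall>p\<in>idx. norm (x p) \<le> 1" for x
    using CD[OF that] norm_mult_ineq[of "F x" "G x"]
    by (meson mult_mono' norm_ge_zero order_trans)
  then have "\<exists>D. \<forall>x. (\<forall>p\<in>idx. norm (x p) \<le> 1) \<longrightarrow> norm (F x * G x) \<le> D"
    by blast
  moreover have "F x * G x = F y * G y" if "\<forall>p\<in>idx. x p = y p" for x y
    using F G that unfolding tame_def by metis
  ultimately show ?thesis using F G unfolding tame_def by auto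
qed

lemma tame_sum: "(\<And>i. i \<in> A \<Longrightarrow> tame (F i)) \<Longrightarrow> tame (\<lambda>x. \<Sum>i\<in>A. F i x)"
  by (induction A rule: infinite_finite_induct) (auto intro: tame_const tame_add)

lemma tame_prod:
  fixes F :: "'i \<Rightarrow> (nat \<times> nat \<Rightarrow> complex) \<Rightarrow> 'b::{banach, second_countable_topology, real_normed_field}"
  shows "(\<And>i. i \<in> A \<Longrightarrow> tame (F i)) \<Longrightarrow> tame (\<lambda>x. \<Prod>i\<in>A. F i x)"
  by (induction A rule: infinite_finite_induct) (auto intro: tame_const tame_mult)

lemma entry_norm_le:
  assumes "\<omega> \<in> space M" "i < N" "j < N"
  shows "norm (U \<omega> $$ (i, j)) \<le> 1"
proof -
  have "(\<Sum>k<N. (norm (U \<omega> $$ (i, k)))\<^sup>2) = 1"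
  proof -
    have "complex_of_real (\<Sum>k<N. (norm (U \<omega> $$ (i, k)))\<^sup>2) = 1"
      using unitary_mat_rows[OF unitary[OF assms(1)] assms(2,2)]
      by (simp add: complex_norm_square del: of_real_power)
    then show ?thesis by (metis of_real_eq_1_iff)
  qed
  moreover have "(norm (U \<omega> $$ (i, j)))\<^sup>2 \<le> (\<Sum>k<N. (norm (U \<omega> $$ (i, k)))\<^sup>2)"
    using assms by (intro member_le_sum) auto
  ultimately show ?thesis by (simp add: abs_square_le_1)
qed

lemma tame_integrable:
  assumes F: "tame F"
    and X: "\<And>p. p \<in> idx \<Longrightarrow> (\<lambda>\<omega>. X \<omega> p) \<in> borel_measurable M"
    and X1: "\<And>\<omega> p. \<omega> \<in> space M \<Longrightarrow> p \<in> idx \<Longrightarrow> norm (X \<omega> p) \<le> 1"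
  shows "integrable M (\<lambda>\<omega>. F (X \<omega>))"
proof -
  obtain C where C: "\<And>x. (\<forall>p\<in>idx. norm (x p) \<le> 1) \<Longrightarrow> norm (F x) \<le> C"
    using F by (auto simp: tame_def)
  have "(\<lambda>\<omega>. F (\<lambda>p\<in>idx. X \<omega> p)) \<in> borel_measurable M"
    using F X by (auto simp: tame_def intro!: measurable_compose[OF measurable_restrict])
  moreover have "F (\<lambda>p\<in>idx. X \<omega> p) = F (X \<omega>)" for \<omega>
  proof -
    have "\<forall>p\<in>idx. (\<lambda>p\<in>idx. X \<omega> p) p = X \<omega> p" by simp
    then show ?thesis using F unfolding tame_def by blast
  qed
  ultimately have "(\<lambda>\<omega>. F (X \<omega>)) \<in> borel_measurable M" by simp
  then show ?thesis
    using C X1 by (intro integrable_const_bound[where B = C]) auto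
qed

lemma tame_integrable_U: "tame F \<Longrightarrow> integrable M (\<lambda>\<omega>. F (\<lambda>p. U \<omega> $$ p))"
  by (rule tame_integrable) (auto intro: entry_norm_le)

lemma tame_expectation_left_mult:
  assumes "unitary_mat N V" "tame F"
  shows "(\<integral>\<omega>. F (\<lambda>p. (V * U \<omega>) $$ p) \<partial>M) = (\<integral>\<omega>. F (\<lambda>p. U \<omega> $$ p) \<partial>M)"
  using assms(2) unfolding tame_def by (intro expectation_left_mult[OF assms(1)]) blast+

definition scale_row :: "nat \<Rightarrow> complex \<Rightarrow> (nat \<times> nat \<Rightarrow> complex) \<Rightarrow> nat \<times> nat \<Rightarrow> complex" where
  "scale_row n e x = (\<lambda>(i, j). (if i = n then e else 1) * x (i, j))"

text \<open>Multiplying one row by a phase is left multiplication by a diagonal unitary matrix, so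
  all four terms have the same expectation. The sum is kept inside one integral so that
  cancellations can be used pointwise.\<close>

lemma phase_average:
  assumes F: "tame F"
  shows "4 *\<^sub>R (\<integral>\<omega>. F (\<lambda>p. U \<omega> $$ p) \<partial>M) =
    (\<integral>\<omega>. F (scale_row n 1 (\<lambda>p. U \<omega> $$ p)) + F (scale_row n \<i> (\<lambda>p. U \<omega> $$ p))
       + F (scale_row n (-1) (\<lambda>p. U \<omega> $$ p)) + F (scale_row n (-\<i>) (\<lambda>p. U \<omega> $$ p)) \<partial>M)"
proof -
  have int: "integrable M (\<lambda>\<omega>. F (scale_row n e (\<lambda>p. U \<omega> $$ p)))" if "norm e = 1" for e
    by (rule tame_integrable[OF F]) (auto simp: scale_row_def norm_mult that intro!: entry_norm_le)
  have eq: "(\<integral>\<omega>. F (scale_row n e (\<lambda>p. U \<omega> $$ p)) \<partial>M) = (\<integral>\<omega>. F (\<lambda>p. U \<omega> $$ p) \<partial>M)"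
    if "norm e = 1" for e
    using expectation_monomial[of id "\<lambda>i. if i = n then e else 1" F] F that
    unfolding tame_def scale_row_def by (auto simp: permutes_id)
  show ?thesis
    using int eq by (simp add: scaleR_add_left[of 1 3, simplified] scaleR_add_left[of 1 2, simplified]
        scaleR_2)
qed

text \<open>Averaging over a phase of row \<open>n\<close> moves its contribution from \<open>T n\<close> to \<open>s (Suc n)\<close>; the potential
  \<open>G n\<close> is chosen so that its expectation can only grow, and \<open>G N = 2\<close>.\<close>

lemma fourth_moment_sum:
  assumes j: "j < N" and w: "\<And>m. norm (w m) = 1"
  shows "expectation (\<lambda>\<omega>. (norm (\<Sum>m<N. w m * U \<omega> $$ (m, j))) ^ 4) \<le> 2"
proof -
  define T where "T n x = (\<Sum>m=n..<N. w m * x (m, j))" for n and x :: "nat \<times> nat \<Rightarrow> complex"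
  define s where "s n x = (\<Sum>m<n. (norm (x (m, j)))\<^sup>2)" for n and x :: "nat \<times> nat \<Rightarrow> complex"
  \<comment> \<open>With \<open>a\<close> the tail after row \<open>n\<close> and \<open>b\<close>
    the contribution of row \<open>n\<close>, the phase average of |a + e b|^4 is |a|^4 + |b|^4 + 4
    |a|^2 |b|^2. The coefficient 4 absorbs the last term; matching the products of
    \<open>s n x\<close> with |b|^2 then forces the coefficient 2. What is left over is a gain of
    |b|^4.\<close>
  define G where "G n x = (norm (T n x)) ^ 4 + 4 * (norm (T n x))\<^sup>2 * s n x + 2 * (s n x)\<^sup>2" for n x
  have tT: "tame (T n)" for n
    unfolding T_def using j by (intro tame_sum tame_mult tame_const tame_coord) auto
  have tnT: "tame (\<lambda>x. norm (T n x))" for n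
    by (rule tame_cont[OF _ tT]) (intro continuous_intros)
  have ts: "tame (s n)" if "n \<le> N" for n
    unfolding s_def using j that
    by (intro tame_sum tame_cont[where g = "\<lambda>z. (norm z)\<^sup>2"] tame_coord continuous_intros) auto
  have tG: "tame (G n)" if "n \<le> N" for n
    unfolding G_def power2_eq_square power4_eq_xxxx
    by (intro tame_add tame_mult tame_const tnT ts that)
  have step: "expectation (\<lambda>\<omega>. G n (\<lambda>p. U \<omega> $$ p)) \<le> expectation (\<lambda>\<omega>. G (Suc n) (\<lambda>p. U \<omega> $$ p))"
    if n: "n < N" for n
  proof -
    have avg: "G n (scale_row n 1 x) + G n (scale_row n \<i> x) + G n (scale_row n (-1) x)
        + G n (scale_row n (-\<i>) x) \<le> 4 * G (Suc n) x" for x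
    proof -
      define a b where "a = T (Suc n) x" and "b = w n * x (n, j)"
      have T: "T n (scale_row n e x) = a + e * b" for e
      proof -
        have "T n (scale_row n e x) = w n * (e * x (n, j)) + (\<Sum>m=Suc n..<N. w m * scale_row n e x (m, j))"
          using n by (simp add: T_def sum.atLeast_Suc_lessThan scale_row_def)
        also have "(\<Sum>m=Suc n..<N. w m * scale_row n e x (m, j)) = a"
          unfolding a_def T_def by (intro sum.cong) (auto simp: scale_row_def)
        finally show ?thesis by (simp add: b_def)
      qed
      have s: "s n (scale_row n e x) = s n x" for e
        by (auto simp: s_def scale_row_def)
      have s': "s (Suc n) x = s n x + (norm b)\<^sup>2"
        by (simp add: s_def b_def norm_mult w)
      have sq: "(norm (a + 1 * b))\<^sup>2 + (norm (a + \<i> * b))\<^sup>2 + (norm (a + (-1) * b))\<^sup>2 + (norm (a + (-\<i>) * b))\<^sup>2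
         = 4 * ((norm a)\<^sup>2 + (norm b)\<^sup>2)"
        by (simp add: cmod_power2) (simp add: power2_eq_square algebra_simps)
      have fo: "(norm (a + 1 * b))^4 + (norm (a + \<i> * b))^4 + (norm (a + (-1) * b))^4 + (norm (a + (-\<i>) * b))^4
         = 4 * ((norm a)^4 + (norm b)^4 + 4 * (norm a)\<^sup>2 * (norm b)\<^sup>2)"
      proof -
        have 4: "norm z ^ 4 = ((norm z)\<^sup>2)\<^sup>2" for z :: complex by simp
        show ?thesis unfolding 4 cmod_power2
          by simp (simp add: power2_eq_square algebra_simps)
      qed
      have "G n (scale_row n 1 x) + G n (scale_row n \<i> x) + G n (scale_row n (-1) x)
        + G n (scale_row n (-\<i>) x) = ((norm (a + 1 * b))^4 + (norm (a + \<i> * b))^4 + (norm (a + (-1) * b))^4 + (norm (a + (-\<i>) * b))^4)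
        + 4 * s n x * ((norm (a + 1 * b))\<^sup>2 + (norm (a + \<i> * b))\<^sup>2 + (norm (a + (-1) * b))\<^sup>2 + (norm (a + (-\<i>) * b))\<^sup>2)
        + 8 * (s n x)\<^sup>2"
        unfolding G_def T s by (simp add: algebra_simps)
      also have "\<dots> = 4 * G (Suc n) x - 4 * (norm b)^4"
        unfolding fo sq G_def s' a_def[symmetric]
        by (simp add: power2_eq_square power4_eq_xxxx algebra_simps)
      finally show ?thesis by simp
    qed
    have "4 * expectation (\<lambda>\<omega>. G n (\<lambda>p. U \<omega> $$ p))
      \<le> expectation (\<lambda>\<omega>. 4 * G (Suc n) (\<lambda>p. U \<omega> $$ p))"
      unfolding phase_average[OF tG, of n n, simplified, OF less_imp_le[OF n]]
    proof (rule integral_mono)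
      have int: "integrable M (\<lambda>\<omega>. G n (scale_row n e (\<lambda>p. U \<omega> $$ p)))" if "norm e = 1" for e
        using n by (intro tame_integrable[OF tG])
          (auto simp: scale_row_def norm_mult that intro!: entry_norm_le)
      show "integrable M (\<lambda>\<omega>. G n (scale_row n 1 (($$) (U \<omega>))) + G n (scale_row n \<i> (($$) (U \<omega>)))
          + G n (scale_row n (- 1) (($$) (U \<omega>))) + G n (scale_row n (- \<i>) (($$) (U \<omega>))))"
        by (intro Bochner_Integration.integrable_add int) auto
      show "integrable M (\<lambda>\<omega>. 4 * G (Suc n) (($$) (U \<omega>)))"
        using n by (intro integrable_mult_right tame_integrable_U tG) auto
    qed (rule avg)
    then show ?thesis by simp
  qed
  have "expectation (\<lambda>\<omega>. G 0 (\<lambda>p. U \<omega> $$ p)) \<le> expectation (\<lambda>\<omega>. G n (\<lambda>p. U \<omega> $$ p))" if "n \<le> N" for n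
    using that by (induction n) (auto intro: order.trans[OF _ step])
  from this[of N] have "expectation (\<lambda>\<omega>. (norm (\<Sum>m<N. w m * U \<omega> $$ (m, j))) ^ 4)
      \<le> expectation (\<lambda>\<omega>. G N (\<lambda>p. U \<omega> $$ p))"
    by (simp add: G_def T_def s_def atLeast0LessThan)
  also have "\<dots> = expectation (\<lambda>\<omega>. 2)"
  proof (rule Bochner_Integration.integral_cong[OF refl])
    fix \<omega> assume \<omega>: "\<omega> \<in> space M"
    have "complex_of_real (\<Sum>k<N. (norm (U \<omega> $$ (k, j)))\<^sup>2) = 1"
      using unitary_mat_cols[OF unitary[OF \<omega>] j j]
      by (simp add: complex_norm_square del: of_real_power)
    then have "s N (\<lambda>p. U \<omega> $$ p) = 1" unfolding s_def by (metis of_real_eq_1_iff)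
    then show "G N (\<lambda>p. U \<omega> $$ p) = 2" by (simp add: G_def T_def)
  qed
  finally show ?thesis by (simp add: prob_space)
qed

lemma dft_mult:
  assumes "\<omega> \<in> space M" "i < N" "j < N"
  shows "(dft_mat N * U \<omega>) $$ (i, j)
    = (\<Sum>m<N. cis (2 * pi * real i * real m / real N) * U \<omega> $$ (m, j)) / of_real (sqrt N)"
  using assms
  by (subst mult_mat_index[of _ N N _ N])
     (auto simp: dft_mat_def carrier sum_divide_distrib intro!: sum.cong)

text \<open>By invariance under the Fourier matrix, one entry has the law of a phase-weighted column
  sum divided by sqrt N; the bound 2 for such a sum is divided by N^2.\<close>

lemma fourth_moment:
  assumes "m < N" "j < N"
  shows "expectation (\<lambda>\<omega>. (norm (U \<omega> $$ (m, j))) ^ 4) \<le> 2 / (real N)\<^sup>2"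
proof -
  have N: "N > 0" using assms by simp
  have t: "tame (\<lambda>x. (norm (x (m, j))) ^ 4)"
    using assms by (intro tame_cont[where g = "\<lambda>z. (norm z) ^ 4"] tame_coord continuous_intros)
  have "expectation (\<lambda>\<omega>. (norm (U \<omega> $$ (m, j))) ^ 4)
    = expectation (\<lambda>\<omega>. (norm ((dft_mat N * U \<omega>) $$ (m, j))) ^ 4)"
    using tame_expectation_left_mult[OF unitary_dft_mat[OF N] t] by simp
  also have "\<dots> = expectation (\<lambda>\<omega>. (norm (\<Sum>k<N. cis (2 * pi * real m * real k / real N) * U \<omega> $$ (k, j))) ^ 4 / (real N)\<^sup>2)"
  proof (rule Bochner_Integration.integral_cong[OF refl])
    fix \<omega> assume "\<omega> \<in> space M"
    have "sqrt (real N) ^ 4 = (real N)\<^sup>2"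
      by (metis mult_2 numeral_Bit0 of_nat_0_le_iff power_add power2_eq_square real_sqrt_pow2)
    then show "(norm ((dft_mat N * U \<omega>) $$ (m, j))) ^ 4
      = (norm (\<Sum>k<N. cis (2 * pi * real m * real k / real N) * U \<omega> $$ (k, j))) ^ 4 / (real N)\<^sup>2"
      by (simp add: dft_mult[OF \<open>\<omega> \<in> space M\<close> assms] norm_divide power_divide)
  qed
  also have "\<dots> \<le> 2 / (real N)\<^sup>2"
    using fourth_moment_sum[OF assms(2), of "\<lambda>k. cis (2 * pi * real m * real k / real N)"]
    by (simp add: divide_right_mono)
  finally show ?thesis .
qed

text \<open>Deduced from the fourth moment by completing a square: x^2 is at most N x^4 / 2 + 1 /
  (2N). This gives 3 / (2N); only the order 1/N matters later.\<close>

lemma second_moment: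
  assumes "m < N" "j < N"
  shows "expectation (\<lambda>\<omega>. (norm (U \<omega> $$ (m, j)))\<^sup>2) \<le> 2 / real N"
proof -
  have t2: "tame (\<lambda>x. (norm (x (m, j)))\<^sup>2)"
    using assms by (intro tame_cont[where g = "\<lambda>z. (norm z)\<^sup>2"] tame_coord continuous_intros)
  have t4: "tame (\<lambda>x. (norm (x (m, j))) ^ 4)"
    using assms by (intro tame_cont[where g = "\<lambda>z. (norm z) ^ 4"] tame_coord continuous_intros)
  have N: "real N > 0" using assms by simp
  have "expectation (\<lambda>\<omega>. (norm (U \<omega> $$ (m, j)))\<^sup>2)
    \<le> expectation (\<lambda>\<omega>. real N / 2 * (norm (U \<omega> $$ (m, j))) ^ 4 + 1 / (2 * real N))"
  proof (rule integral_mono)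
    fix \<omega>
    have "0 \<le> (real N * (norm (U \<omega> $$ (m, j)))\<^sup>2 - 1)\<^sup>2 / (2 * real N)" by simp
    also have "\<dots> = real N / 2 * (norm (U \<omega> $$ (m, j))) ^ 4 + 1 / (2 * real N) - (norm (U \<omega> $$ (m, j)))\<^sup>2"
      using N by (simp add: field_simps power2_eq_square power4_eq_xxxx)
    finally show "(norm (U \<omega> $$ (m, j)))\<^sup>2 \<le> real N / 2 * (norm (U \<omega> $$ (m, j))) ^ 4 + 1 / (2 * real N)"
      by simp
  qed (use tame_integrable_U[OF t2] tame_integrable_U[OF t4] in auto)
  also have "\<dots> = real N / 2 * expectation (\<lambda>\<omega>. (norm (U \<omega> $$ (m, j))) ^ 4) + 1 / (2 * real N)"
    using tame_integrable_U[OF t4] by (simp add: prob_space)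
  also have "\<dots> \<le> real N / 2 * (2 / (real N)\<^sup>2) + 1 / (2 * real N)"
    using fourth_moment[OF assms] by (intro add_right_mono mult_left_mono) auto
  also have "\<dots> \<le> 2 / real N" using N by (simp add: field_simps power2_eq_square)
  finally show ?thesis .
qed

lemma expectation_permute_rows:
  assumes F: "tame F" and p: "p permutes {..<N}"
  shows "(\<integral>\<omega>. F (\<lambda>(i, j). U \<omega> $$ (p i, j)) \<partial>M) = (\<integral>\<omega>. F (\<lambda>p. U \<omega> $$ p) \<partial>M)"
  using expectation_monomial[OF p, of "\<lambda>_. 1" F] F unfolding tame_def by simp

text \<open>By exchangeability of the rows the covariances \<open>c m n\<close> with \<open>m \<noteq> n\<close> are all equal, so they are
  annihilated by the weights \<open>w\<close> and only the \<open>N\<close> diagonal terms of size \<open>O(N\<^sup>-\<^sup>2)\<close> remain.\<close>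

lemma row_correlation:
  fixes w :: "nat \<Rightarrow> complex"
  assumes j: "j < N" "j' < N" and w: "\<And>m. norm (w m) = 1" and w0: "(\<Sum>m<N. w m) = 0"
  shows "expectation (\<lambda>\<omega>. (norm (\<Sum>m<N. w m * (U \<omega> $$ (m, j) * cnj (U \<omega> $$ (m, j')))))\<^sup>2) \<le> 4 / real N"
proof -
  have N2: "N \<ge> 2"
  proof (rule ccontr)
    assume "\<not> N \<ge> 2"
    then have "N = 1" using j by simp
    then show False using w0 w[of 0] by simp
  qed
  define X where "X m x = x (m, j) * cnj (x (m, j'))" for m and x :: "nat \<times> nat \<Rightarrow> complex"
  define c where "c m n = (\<integral>\<omega>. X m (\<lambda>p. U \<omega> $$ p) * cnj (X n (\<lambda>p. U \<omega> $$ p)) \<partial>M)" for m n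
  have tcoord: "tame (\<lambda>x. cnj (x (m, i)))" if "m < N" "i < N" for m i
    using that by (intro tame_cont[where g = cnj] tame_coord continuous_intros)
  have tX: "tame (X m)" "tame (\<lambda>x. cnj (X m x))" if "m < N" for m
    unfolding X_def complex_cnj_mult complex_cnj_cnj using that j
    by (intro tame_mult tame_coord tcoord; simp)+
  have tXX: "tame (\<lambda>x. X m x * cnj (X n x))" if "m < N" "n < N" for m n
    using that by (intro tame_mult tX)
  have c_perm: "c (p m) (p n) = c m n" if p: "p permutes {..<N}" and "m < N" "n < N" for p m n
    using expectation_permute_rows[OF tXX[OF that(2,3)] p] by (simp add: c_def X_def)
  have c_const: "c m n = c 0 1" if "m < N" "n < N" "m \<noteq> n" for m n
  proof -
    \<comment> \<open>With this \<open>k\<close> the permutation below sends 0 to \<open>m\<close>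
      and 1 to \<open>n\<close>. The condition \<open>m \<noteq> n\<close> gives
      \<open>k \<noteq> 0\<close>, so the inner transposition fixes 0.\<close>
    define k where "k = Transposition.transpose 0 m n"
    have k: "k < N" "k \<noteq> 0" using that N2 by (auto simp: k_def Transposition.transpose_def)
    have p: "Transposition.transpose 0 m \<circ> Transposition.transpose 1 k permutes {..<N}"
      using that k N2 by (intro permutes_compose permutes_swap_id) auto
    have "Transposition.transpose 1 k 0 = 0" using k by (simp add: Transposition.transpose_def)
    then show ?thesis
      using c_perm[OF p, of 0 1] N2 by (simp add: k_def)
  qed
  have c_bound: "norm (c m n) \<le> 2 / (real N)\<^sup>2" if "m < N" "n < N" for m n
  proof -
    have t4: "tame (\<lambda>x. (norm (x (a, b))) ^ 4)" if "a < N" "b < N" for a b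
      using that by (intro tame_cont[where g = "\<lambda>z. (norm z) ^ 4"] tame_coord continuous_intros)
    let ?u = "\<lambda>\<omega> a b. (norm (U \<omega> $$ (a, b))) ^ 4"
    have amgm: "p * q * (s * t) \<le> (p ^ 4 + q ^ 4 + s ^ 4 + t ^ 4) / 4" for p q s t :: real
    proof -
      have "0 \<le> (p\<^sup>2 - q\<^sup>2)\<^sup>2 + (s\<^sup>2 - t\<^sup>2)\<^sup>2 + 2 * (p * q - s * t)\<^sup>2" by simp
      also have "\<dots> = p ^ 4 + q ^ 4 + s ^ 4 + t ^ 4 - 4 * (p * q * (s * t))"
        by (simp add: power2_eq_square power4_eq_xxxx algebra_simps)
      finally show ?thesis by simp
    qed
    have "norm (c m n) \<le> expectation (\<lambda>\<omega>. norm (X m (\<lambda>p. U \<omega> $$ p) * cnj (X n (\<lambda>p. U \<omega> $$ p))))"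
      unfolding c_def by (rule integral_norm_bound)
    also have "\<dots> \<le> expectation (\<lambda>\<omega>. (?u \<omega> m j + ?u \<omega> m j' + ?u \<omega> n j + ?u \<omega> n j') / 4)"
    proof (rule integral_mono)
      show "integrable M (\<lambda>\<omega>. norm (X m (\<lambda>p. U \<omega> $$ p) * cnj (X n (\<lambda>p. U \<omega> $$ p))))"
        by (intro integrable_norm tame_integrable_U tXX that)
      show "integrable M (\<lambda>\<omega>. (?u \<omega> m j + ?u \<omega> m j' + ?u \<omega> n j + ?u \<omega> n j') / 4)"
        using that j
        by (intro Bochner_Integration.integrable_divide Bochner_Integration.integrable_add
            tame_integrable_U[of "\<lambda>x. (norm (x (_, _))) ^ 4"] t4)
      fix \<omega>
      show "norm (X m (\<lambda>p. U \<omega> $$ p) * cnj (X n (\<lambda>p. U \<omega> $$ p)))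
        \<le> (?u \<omega> m j + ?u \<omega> m j' + ?u \<omega> n j + ?u \<omega> n j') / 4"
        using amgm[of "norm (U \<omega> $$ (m, j))" "norm (U \<omega> $$ (m, j'))"
          "norm (U \<omega> $$ (n, j))" "norm (U \<omega> $$ (n, j'))"]
        by (simp only: X_def norm_mult complex_mod_cnj)
    qed
    also have "\<dots> = (expectation (\<lambda>\<omega>. ?u \<omega> m j) + expectation (\<lambda>\<omega>. ?u \<omega> m j')
        + expectation (\<lambda>\<omega>. ?u \<omega> n j) + expectation (\<lambda>\<omega>. ?u \<omega> n j')) / 4"
      using tame_integrable_U[OF t4] that j by simp
    also have "\<dots> \<le> 2 / (real N)\<^sup>2"
      using fourth_moment[OF that(1) j(1)] fourth_moment[OF that(1) j(2)]
        fourth_moment[OF that(2) j(1)] fourth_moment[OF that(2) j(2)] by simp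
    finally show ?thesis .
  qed
  let ?S = "\<lambda>\<omega>. \<Sum>m<N. w m * X m (\<lambda>p. U \<omega> $$ p)"
  have tS: "tame (\<lambda>x. (norm (\<Sum>m<N. w m * X m x))\<^sup>2)"
    by (intro tame_cont[where g = "\<lambda>z. (norm z)\<^sup>2"] tame_sum tame_mult tame_const tX continuous_intros) auto
  have "complex_of_real (expectation (\<lambda>\<omega>. (norm (?S \<omega>))\<^sup>2)) = (\<integral>\<omega>. ?S \<omega> * cnj (?S \<omega>) \<partial>M)"
    unfolding integral_complex_of_real[symmetric] complex_norm_square ..
  also have "\<dots> = (\<integral>\<omega>. (\<Sum>m<N. \<Sum>n<N. w m * cnj (w n) * (X m (\<lambda>p. U \<omega> $$ p) * cnj (X n (\<lambda>p. U \<omega> $$ p)))) \<partial>M)"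
    by (simp add: sum_product mult_ac)
  also have "\<dots> = (\<Sum>m<N. \<Sum>n<N. w m * cnj (w n) * c m n)"
  proof -
    have int: "integrable M (\<lambda>\<omega>. w m * cnj (w n) * (X m (\<lambda>p. U \<omega> $$ p) * cnj (X n (\<lambda>p. U \<omega> $$ p))))"
      if "m \<in> {..<N}" "n \<in> {..<N}" for m n
      using that by (intro integrable_mult_right tame_integrable_U[OF tXX]) auto
    have "(\<integral>\<omega>. (\<Sum>m<N. \<Sum>n<N. w m * cnj (w n) * (X m (\<lambda>p. U \<omega> $$ p) * cnj (X n (\<lambda>p. U \<omega> $$ p)))) \<partial>M)
      = (\<Sum>m<N. (\<integral>\<omega>. (\<Sum>n<N. w m * cnj (w n) * (X m (\<lambda>p. U \<omega> $$ p) * cnj (X n (\<lambda>p. U \<omega> $$ p)))) \<partial>M))"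
      by (intro Bochner_Integration.integral_sum Bochner_Integration.integrable_sum int)
    also have "\<dots> = (\<Sum>m<N. \<Sum>n<N. (\<integral>\<omega>. w m * cnj (w n) * (X m (\<lambda>p. U \<omega> $$ p) * cnj (X n (\<lambda>p. U \<omega> $$ p))) \<partial>M))"
      by (intro sum.cong refl Bochner_Integration.integral_sum int)
    finally show ?thesis by (simp add: c_def)
  qed
  also have "\<dots> = (\<Sum>m<N. \<Sum>n<N. w m * cnj (w n) * c 0 1 + (if n = m then c m m - c 0 1 else 0))"
  proof (intro sum.cong refl)
    fix m n assume "m \<in> {..<N}" "n \<in> {..<N}"
    moreover have "w m * cnj (w m) = 1" using w[of m] by (simp flip: complex_norm_square)
    ultimately show "w m * cnj (w n) * c m n
      = w m * cnj (w n) * c 0 1 + (if n = m then c m m - c 0 1 else 0)"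
      using c_const[of m n] by auto
  qed
  also have "\<dots> = (\<Sum>m<N. w m) * cnj (\<Sum>m<N. w m) * c 0 1 + (\<Sum>m<N. c m m - c 0 1)"
  proof -
    have "(\<Sum>m<N. \<Sum>n<N. if n = m then c m m - c 0 1 else 0) = (\<Sum>m<N. c m m - c 0 1)"
      by simp
    moreover have "(\<Sum>m<N. \<Sum>n<N. w m * cnj (w n) * d) = (\<Sum>m<N. w m) * cnj (\<Sum>m<N. w m) * d" for d
      unfolding cnj_sum sum_product by (simp only: sum_distrib_right)
    ultimately show ?thesis unfolding sum.distrib by (simp only:)
  qed
  also have "\<dots> = (\<Sum>m<N. c m m - c 0 1)" by (simp add: w0)
  finally have "norm (complex_of_real (expectation (\<lambda>\<omega>. (norm (?S \<omega>))\<^sup>2))) \<le> (\<Sum>m<N. norm (c m m - c 0 1))"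
    by (metis norm_sum)
  also have "\<dots> \<le> (\<Sum>m<N. 4 / (real N)\<^sup>2)"
  proof (rule sum_mono)
    fix m assume "m \<in> {..<N}"
    then show "norm (c m m - c 0 1) \<le> 4 / (real N)\<^sup>2"
      using norm_triangle_ineq4[of "c m m" "c 0 1"] c_bound[of m m] c_bound[of 0 1] N2 by simp
  qed
  also have "\<dots> = 4 / real N" using N2 by (simp add: power2_eq_square)
  finally show ?thesis by (simp add: X_def)
qed

text \<open>After applying the Fourier matrix the exponent is a sum of contributions \<open>Z m\<close> of the single rows
  of \<open>U\<close>. Averaging over the phases row by row replaces the exponential of the \<open>m\<close>-th contribution by
  \<open>phase_kernel (Z m)\<close>, which is close to \<open>exp (- \<bar>Z m\<bar>\<^sup>2 / 2)\<close>; the sum of the \<open>\<bar>Z m\<bar>\<^sup>2\<close> concentrates.\<close>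

theorem char_approx:
  fixes h :: "nat \<times> nat \<Rightarrow> complex"
  assumes r: "r \<le> N" and N: "N > 0"
  defines "B \<equiv> {..<r} \<times> {..<r}"
  defines "H \<equiv> \<Sum>p\<in>B. (norm (h p))\<^sup>2" and "K \<equiv> \<Sum>p\<in>B. norm (h p)"
  shows "norm ((\<integral>\<omega>. cis (sqrt (2 * real N) * Re (\<Sum>p\<in>B. cnj (h p) * U \<omega> $$ p)) \<partial>M) - of_real (exp (- (H / 2))))
    \<le> 2 * K ^ 4 * real r ^ 4 / real N + K\<^sup>2 / sqrt (real N)"
proof -
  define W where "W i m = cis (2 * pi * real i * real m / real N)" for i m :: nat
  have W1: "norm (W i m) = 1" for i m by (simp add: W_def)
  \<comment> \<open>After the Fourier transform the factor 1 / sqrt N cancels the sqrt N in the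
    exponent, leaving sqrt 2 times the real part of the sum of the \<open>Z m\<close>. Each
    \<open>Z m\<close> is linear in row \<open>m\<close> and involves no other row.\<close>
  define Z where "Z m x = (\<Sum>p\<in>B. cnj (h p) * (W (fst p) m * x (m, snd p)))"
    for m and x :: "nat \<times> nat \<Rightarrow> complex"
  have BN: "fst p < N" "snd p < N" if "p \<in> B" for p using that r by (auto simp: B_def)
  have tZ: "tame (Z m)" if "m < N" for m
    unfolding Z_def using that BN by (intro tame_sum tame_mult tame_const tame_coord) auto
  \<comment> \<open>Interpolation: rows below \<open>n\<close> have already been averaged, rows from
    \<open>n\<close> on still sit in the exponential. The expectation is independent of
    \<open>n\<close>.\<close>
  define L where "L n x = (\<Prod>m<n. complex_of_real (phase_kernel (Z m x))) * cis (sqrt 2 * Re (\<Sum>m=n..<N. Z m x))"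
    for n x
  have tL: "tame (L n)" if "n \<le> N" for n
    unfolding L_def using that
    by (intro tame_mult tame_prod
        tame_cont[where g = "\<lambda>z. complex_of_real (phase_kernel z)"]
        tame_cont[where g = "\<lambda>z. cis (sqrt 2 * Re z)"] tame_sum tZ)
       (auto simp: phase_kernel_def intro!: continuous_intros)
  have step: "(\<integral>\<omega>. L n (\<lambda>p. U \<omega> $$ p) \<partial>M) = (\<integral>\<omega>. L (Suc n) (\<lambda>p. U \<omega> $$ p) \<partial>M)" if n: "n < N" for n
  proof -
    have avg: "L n (scale_row n 1 x) + L n (scale_row n \<i> x) + L n (scale_row n (-1) x) + L n (scale_row n (-\<i>) x)
      = 4 *\<^sub>R L (Suc n) x" for x
    proof -
      define z R where "z = Z n x" and "R = (\<Sum>m=Suc n..<N. Z m x)"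
      have Zs: "Z m (scale_row n e x) = (if m = n then e * Z m x else Z m x)" for m e
        by (auto simp: Z_def scale_row_def sum_distrib_left mult_ac intro!: sum.cong)
      have "(\<Sum>m=n..<N. Z m (scale_row n e x)) = e * z + R" for e
      proof -
        have "(\<Sum>m=Suc n..<N. Z m (scale_row n e x)) = R"
          unfolding R_def by (intro sum.cong) (auto simp: Zs)
        then show ?thesis using n by (simp add: sum.atLeast_Suc_lessThan Zs z_def)
      qed
      moreover have "(\<Prod>m<n. complex_of_real (phase_kernel (Z m (scale_row n e x))))
        = (\<Prod>m<n. complex_of_real (phase_kernel (Z m x)))" for e
        by (intro prod.cong) (auto simp: Zs)
      ultimately have Ls: "L n (scale_row n e x)
        = (\<Prod>m<n. complex_of_real (phase_kernel (Z m x))) * (cis (sqrt 2 * Re (e * z)) * cis (sqrt 2 * Re R))" for e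
        by (simp add: L_def cis_mult distrib_left)
      have "cis (sqrt 2 * Re (1 * z)) + cis (sqrt 2 * Re (\<i> * z)) + cis (sqrt 2 * Re (- 1 * z)) + cis (sqrt 2 * Re (- \<i> * z))
        = 4 * of_real (phase_kernel z)"
        by (simp add: complex_eq_iff phase_kernel_def)
      then have "L n (scale_row n 1 x) + L n (scale_row n \<i> x) + L n (scale_row n (-1) x) + L n (scale_row n (-\<i>) x)
        = (\<Prod>m<n. complex_of_real (phase_kernel (Z m x))) * ((4 * of_real (phase_kernel z)) * cis (sqrt 2 * Re R))"
        unfolding Ls by (simp only: distrib_left[symmetric] distrib_right[symmetric])
      also have "\<dots> = 4 *\<^sub>R L (Suc n) x"
        by (simp add: L_def z_def R_def scaleR_conv_of_real)
      finally show ?thesis .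
    qed
    have "4 *\<^sub>R (\<integral>\<omega>. L n (\<lambda>p. U \<omega> $$ p) \<partial>M) = 4 *\<^sub>R (\<integral>\<omega>. L (Suc n) (\<lambda>p. U \<omega> $$ p) \<partial>M)"
      unfolding phase_average[OF tL[OF less_imp_le[OF n]], of n] avg by simp
    then show ?thesis by simp
  qed
  have "(\<integral>\<omega>. L 0 (\<lambda>p. U \<omega> $$ p) \<partial>M) = (\<integral>\<omega>. L n (\<lambda>p. U \<omega> $$ p) \<partial>M)" if "n \<le> N" for n
    using that by (induction n) (simp_all add: step)
  from this[of N] have L0N: "(\<integral>\<omega>. L 0 (\<lambda>p. U \<omega> $$ p) \<partial>M)
      = (\<integral>\<omega>. complex_of_real (\<Prod>m<N. phase_kernel (Z m (\<lambda>p. U \<omega> $$ p))) \<partial>M)"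
    by (simp add: L_def)
  have char: "(\<integral>\<omega>. cis (sqrt (2 * real N) * Re (\<Sum>p\<in>B. cnj (h p) * U \<omega> $$ p)) \<partial>M)
     = (\<integral>\<omega>. L 0 (\<lambda>p. U \<omega> $$ p) \<partial>M)"
  proof -
    have t: "tame (\<lambda>x. cis (sqrt (2 * real N) * Re (\<Sum>p\<in>B. cnj (h p) * x p)))"
    proof (rule tame_cont[where g = "\<lambda>z. cis (sqrt (2 * real N) * Re z)"])
      show "tame (\<lambda>x. \<Sum>p\<in>B. cnj (h p) * x p)"
        using tame_coord BN by (intro tame_sum tame_mult tame_const) (metis prod.collapse)
    qed (intro continuous_intros)
    have "(\<integral>\<omega>. cis (sqrt (2 * real N) * Re (\<Sum>p\<in>B. cnj (h p) * U \<omega> $$ p)) \<partial>M)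
      = (\<integral>\<omega>. cis (sqrt (2 * real N) * Re (\<Sum>p\<in>B. cnj (h p) * (dft_mat N * U \<omega>) $$ p)) \<partial>M)"
      using tame_expectation_left_mult[OF unitary_dft_mat[OF N] t] by simp
    also have "\<dots> = (\<integral>\<omega>. L 0 (\<lambda>p. U \<omega> $$ p) \<partial>M)"
    proof (rule Bochner_Integration.integral_cong[OF refl])
      fix \<omega> assume \<omega>: "\<omega> \<in> space M"
      have "(\<Sum>p\<in>B. cnj (h p) * (dft_mat N * U \<omega>) $$ p)
        = (\<Sum>p\<in>B. \<Sum>m<N. cnj (h p) * (W (fst p) m * U \<omega> $$ (m, snd p))) / of_real (sqrt N)"
        unfolding sum_divide_distrib
      proof (intro sum.cong refl)
        fix p assume p: "p \<in> B"
        have "(dft_mat N * U \<omega>) $$ (fst p, snd p)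
          = (\<Sum>m<N. W (fst p) m * U \<omega> $$ (m, snd p)) / of_real (sqrt N)"
          using dft_mult[OF \<omega> BN[OF p]] by (simp add: W_def)
        then show "cnj (h p) * (dft_mat N * U \<omega>) $$ p
          = (\<Sum>m<N. cnj (h p) * (W (fst p) m * U \<omega> $$ (m, snd p)) / of_real (sqrt N))"
          by (simp add: sum_distrib_left sum_divide_distrib)
      qed
      also have "\<dots> = (\<Sum>m<N. Z m (\<lambda>p. U \<omega> $$ p)) / of_real (sqrt N)"
        unfolding Z_def by (subst sum.swap) simp
      finally have "sqrt (2 * real N) * Re (\<Sum>p\<in>B. cnj (h p) * (dft_mat N * U \<omega>) $$ p)
        = sqrt 2 * Re (\<Sum>m<N. Z m (\<lambda>p. U \<omega> $$ p))"
        using N by (simp add: real_sqrt_mult Re_divide_of_real)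
      then show "cis (sqrt (2 * real N) * Re (\<Sum>p\<in>B. cnj (h p) * (dft_mat N * U \<omega>) $$ p))
        = L 0 (\<lambda>p. U \<omega> $$ p)"
        by (simp add: L_def atLeast0LessThan)
    qed
    finally show ?thesis .
  qed
  let ?Z = "\<lambda>m \<omega>. Z m (\<lambda>p. U \<omega> $$ p)"
  have t4: "tame (\<lambda>x. (norm (x (m, j))) ^ 4)" if "m < N" "j < N" for m j
    using that by (intro tame_cont[where g = "\<lambda>z. (norm z) ^ 4"] tame_coord continuous_intros)
  have tZ4: "tame (\<lambda>x. (norm (Z m x)) ^ 4)" if "m < N" for m
    using that by (intro tame_cont[where g = "\<lambda>z. (norm z) ^ 4"] tZ continuous_intros)
  have tZ2: "tame (\<lambda>x. (norm (Z m x))\<^sup>2)" if "m < N" for m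
    using that by (intro tame_cont[where g = "\<lambda>z. (norm z)\<^sup>2"] tZ continuous_intros)
  have tsum: "tame (\<lambda>x. \<bar>(\<Sum>m<N. (norm (Z m x))\<^sup>2) - H\<bar>)"
    by (rule tame_cont[where g = "\<lambda>z. \<bar>z - H\<bar>"])
       (auto intro!: continuous_intros tame_sum tZ2)
  have K0: "K \<ge> 0" unfolding K_def by (intro sum_nonneg) auto
  have H0: "H \<ge> 0" unfolding H_def by (intro sum_nonneg) auto
  have Z4: "(norm (Z m x)) ^ 4 \<le> K ^ 4 * (real r ^ 3 * (\<Sum>j<r. (norm (x (m, j))) ^ 4))" for m x
  proof -
    have "norm (Z m x) \<le> (\<Sum>p\<in>B. norm (h p) * norm (x (m, snd p)))"
      unfolding Z_def by (rule order.trans[OF norm_sum]) (simp add: norm_mult W1)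
    also have "\<dots> \<le> (\<Sum>p\<in>B. norm (h p) * (\<Sum>j<r. norm (x (m, j))))"
    proof (intro sum_mono mult_left_mono)
      fix p assume "p \<in> B"
      then show "norm (x (m, snd p)) \<le> (\<Sum>j<r. norm (x (m, j)))"
        by (intro member_le_sum) (auto simp: B_def)
    qed simp
    also have "\<dots> = K * (\<Sum>j<r. norm (x (m, j)))" by (simp add: K_def sum_distrib_right)
    finally have "(norm (Z m x)) ^ 4 \<le> (K * (\<Sum>j<r. norm (x (m, j)))) ^ 4"
      by (intro power_mono) auto
    also have "\<dots> = K ^ 4 * (\<Sum>j<r. norm (x (m, j))) ^ 4" by (rule power_mult_distrib)
    also have "\<dots> \<le> K ^ 4 * (real r ^ 3 * (\<Sum>j<r. (norm (x (m, j))) ^ 4))"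
      using power4_sum_le[of "\<lambda>j. norm (x (m, j))" r] by (intro mult_left_mono) auto
    finally show ?thesis .
  qed
  have EZ4: "expectation (\<lambda>\<omega>. (norm (?Z m \<omega>)) ^ 4) \<le> 2 * K ^ 4 * real r ^ 4 / (real N)\<^sup>2" if m: "m < N" for m
  proof -
    have jN: "j < N" if "j \<in> {..<r}" for j using that r by simp
    have "expectation (\<lambda>\<omega>. (norm (?Z m \<omega>)) ^ 4)
      \<le> expectation (\<lambda>\<omega>. K ^ 4 * (real r ^ 3 * (\<Sum>j<r. (norm (U \<omega> $$ (m, j))) ^ 4)))"
      using m jN by (intro integral_mono Z4 tame_integrable_U[OF tZ4] integrable_mult_right
          Bochner_Integration.integrable_sum tame_integrable_U[OF t4])
    also have "\<dots> = K ^ 4 * (real r ^ 3 * (\<Sum>j<r. expectation (\<lambda>\<omega>. (norm (U \<omega> $$ (m, j))) ^ 4)))"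
      using m jN tame_integrable_U[OF t4] by (simp add: Bochner_Integration.integral_sum)
    also have "\<dots> \<le> K ^ 4 * (real r ^ 3 * (\<Sum>j<r. 2 / (real N)\<^sup>2))"
      using fourth_moment[OF m jN] K0 by (intro mult_left_mono sum_mono) auto
    also have "\<dots> = 2 * K ^ 4 * real r ^ 4 / (real N)\<^sup>2"
      by (simp add: power4_eq_xxxx power3_eq_cube)
    finally show ?thesis .
  qed
  \<comment> \<open>Expanding the sum of the squared moduli of the \<open>Z m\<close> and
    subtracting \<open>H\<close> leaves the coefficients \<open>cnj (h p) * h q\<close> against
    these deviations from orthonormality. If the row indices of \<open>p\<close> and
    \<open>q\<close> agree, they vanish by orthonormality of the columns; otherwise the weights form
    a nontrivial character with sum zero, and \<open>row_correlation\<close> applies.\<close>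
  define S where "S p q x = (\<Sum>m<N. W (fst p) m * cnj (W (fst q) m) * (x (m, snd p) * cnj (x (m, snd q))))
      - (if p = q then 1 else 0)" for p q and x :: "nat \<times> nat \<Rightarrow> complex"
  have tS: "tame (S p q)" if "p \<in> B" "q \<in> B" for p q
    unfolding S_def diff_conv_add_uminus using BN[OF that(1)] BN[OF that(2)]
    by (intro tame_add tame_sum tame_mult tame_const tame_coord
        tame_cont[where g = cnj] continuous_intros) auto
  have ES: "expectation (\<lambda>\<omega>. norm (S p q (\<lambda>p. U \<omega> $$ p))) \<le> 2 / sqrt (real N)" if pq: "p \<in> B" "q \<in> B" for p q
  proof (cases "fst p = fst q")
    case True
    have "S p q (\<lambda>p. U \<omega> $$ p) = 0" if \<omega>: "\<omega> \<in> space M" for \<omega>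
    proof -
      have WW: "W i m * cnj (W i m) = 1" for i m
        using W1[of i m] by (simp flip: complex_norm_square)
      have "(\<Sum>m<N. W (fst p) m * cnj (W (fst q) m) * (U \<omega> $$ (m, snd p) * cnj (U \<omega> $$ (m, snd q))))
        = (if snd p = snd q then 1 else 0)"
        using unitary_mat_cols[OF unitary[OF \<omega>] BN(2)[OF pq(1)] BN(2)[OF pq(2)]] True
        by (simp add: WW)
      then show ?thesis using True by (simp add: S_def prod_eq_iff)
    qed
    then have "expectation (\<lambda>\<omega>. norm (S p q (\<lambda>p. U \<omega> $$ p))) = expectation (\<lambda>\<omega>. 0)"
      by (intro Bochner_Integration.integral_cong) auto
    then show ?thesis by simp
  next
    case False
    let ?w = "\<lambda>m. W (fst p) m * cnj (W (fst q) m)"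
    have w: "?w m = cis (2 * pi * of_int (int (fst p) - int (fst q)) * real m / real N)" for m
      by (simp add: W_def cis_cnj cis_mult algebra_simps diff_divide_distrib)
    have "\<not> int N dvd int (fst p) - int (fst q)"
      using False BN(1)[OF pq(1)] BN(1)[OF pq(2)]
        zdvd_imp_le[of "int N" "\<bar>int (fst p) - int (fst q)\<bar>"] by auto
    then have w0: "(\<Sum>m<N. ?w m) = 0" unfolding w by (rule sum_cis_roots[OF N])
    have "expectation (\<lambda>\<omega>. (norm (\<Sum>m<N. ?w m * (U \<omega> $$ (m, snd p) * cnj (U \<omega> $$ (m, snd q)))))\<^sup>2) \<le> 4 / real N"
      using BN(2)[OF pq(1)] BN(2)[OF pq(2)] w0 by (intro row_correlation) (auto simp: norm_mult W1)
    then have S2: "expectation (\<lambda>\<omega>. (norm (S p q (\<lambda>p. U \<omega> $$ p)))\<^sup>2) \<le> 4 / real N"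
      using False by (auto simp: S_def)
    have t1: "tame (\<lambda>x. norm (S p q x))" and t2: "tame (\<lambda>x. (norm (S p q x))\<^sup>2)"
      using tS[OF pq] by (auto intro!: tame_cont[of norm] tame_cont[of "\<lambda>z. (norm z)\<^sup>2"] continuous_intros)
    have sN: "sqrt (real N) > 0" using N by simp
    \<comment> \<open>From second to first moment by x \<le> c x^2 / 4 + 1 / c; with c = sqrt N the
      two terms balance when the second moment is 4 / N.\<close>
    have "expectation (\<lambda>\<omega>. norm (S p q (\<lambda>p. U \<omega> $$ p)))
      \<le> expectation (\<lambda>\<omega>. sqrt (real N) / 4 * (norm (S p q (\<lambda>p. U \<omega> $$ p)))\<^sup>2 + 1 / sqrt (real N))"
    proof (rule integral_mono)
      fix \<omega>
      let ?s = "norm (S p q (\<lambda>p. U \<omega> $$ p))" and ?c = "sqrt (real N)"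
      have "0 \<le> (?c * ?s / 2 - 1)\<^sup>2 / ?c" using sN by simp
      also have "\<dots> = ?c / 4 * ?s\<^sup>2 + 1 / ?c - ?s"
        using sN by (simp add: field_simps power2_eq_square)
      finally show "?s \<le> ?c / 4 * ?s\<^sup>2 + 1 / ?c" by simp
    qed (use tame_integrable_U[OF t1] tame_integrable_U[OF t2] in auto)
    also have "\<dots> = sqrt (real N) / 4 * expectation (\<lambda>\<omega>. (norm (S p q (\<lambda>p. U \<omega> $$ p)))\<^sup>2) + 1 / sqrt (real N)"
      using tame_integrable_U[OF t2] by (simp add: prob_space)
    also have "\<dots> \<le> sqrt (real N) / 4 * (4 / real N) + 1 / sqrt (real N)"
      using S2 by (intro add_right_mono mult_left_mono) auto
    also have "\<dots> = 2 / sqrt (real N)"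
      using N by (simp add: field_simps)
    finally show ?thesis .
  qed
  have Zsum: "\<bar>(\<Sum>m<N. (norm (Z m x))\<^sup>2) - H\<bar> \<le> (\<Sum>p\<in>B. \<Sum>q\<in>B. norm (h p) * norm (h q) * norm (S p q x))" for x
  proof -
    have "complex_of_real ((\<Sum>m<N. (norm (Z m x))\<^sup>2) - H)
      = (\<Sum>m<N. Z m x * cnj (Z m x)) - (\<Sum>p\<in>B. cnj (h p) * h p)"
      by (simp add: H_def complex_norm_square mult.commute del: of_real_power)
    also have "(\<Sum>m<N. Z m x * cnj (Z m x))
      = (\<Sum>p\<in>B. \<Sum>q\<in>B. cnj (h p) * h q * (\<Sum>m<N. W (fst p) m * cnj (W (fst q) m) * (x (m, snd p) * cnj (x (m, snd q)))))"
    proof -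
      have "Z m x * cnj (Z m x) = (\<Sum>p\<in>B. \<Sum>q\<in>B. cnj (h p) * h q * (W (fst p) m * cnj (W (fst q) m) * (x (m, snd p) * cnj (x (m, snd q)))))" for m
        unfolding Z_def cnj_sum sum_product by (intro sum.cong refl) (simp add: mult_ac)
      then have "(\<Sum>m<N. Z m x * cnj (Z m x)) = (\<Sum>m<N. \<Sum>p\<in>B. \<Sum>q\<in>B. cnj (h p) * h q * (W (fst p) m * cnj (W (fst q) m) * (x (m, snd p) * cnj (x (m, snd q)))))"
        by simp
      also have "\<dots> = (\<Sum>p\<in>B. \<Sum>m<N. \<Sum>q\<in>B. cnj (h p) * h q * (W (fst p) m * cnj (W (fst q) m) * (x (m, snd p) * cnj (x (m, snd q)))))"
        by (rule sum.swap)
      also have "\<dots> = (\<Sum>p\<in>B. \<Sum>q\<in>B. \<Sum>m<N. cnj (h p) * h q * (W (fst p) m * cnj (W (fst q) m) * (x (m, snd p) * cnj (x (m, snd q)))))"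
        by (intro sum.cong refl sum.swap)
      finally show ?thesis by (simp only: sum_distrib_left)
    qed
    also have "(\<Sum>p\<in>B. cnj (h p) * h p) = (\<Sum>p\<in>B. \<Sum>q\<in>B. cnj (h p) * h q * (if p = q then 1 else 0))"
    proof (intro sum.cong refl)
      fix p assume "p \<in> B"
      have "(\<Sum>q\<in>B. cnj (h p) * h q * (if p = q then 1 else 0)) = (\<Sum>q\<in>B. if p = q then cnj (h p) * h p else 0)"
        by (intro sum.cong) auto
      then show "cnj (h p) * h p = (\<Sum>q\<in>B. cnj (h p) * h q * (if p = q then 1 else 0))"
        using \<open>p \<in> B\<close> by (simp add: B_def)
    qed
    finally have "complex_of_real ((\<Sum>m<N. (norm (Z m x))\<^sup>2) - H)
      = (\<Sum>p\<in>B. \<Sum>q\<in>B. cnj (h p) * h q * S p q x)"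
      by (simp only: S_def right_diff_distrib sum_subtractf)
    then have "\<bar>(\<Sum>m<N. (norm (Z m x))\<^sup>2) - H\<bar> = norm (\<Sum>p\<in>B. \<Sum>q\<in>B. cnj (h p) * h q * S p q x)"
      by (metis norm_of_real)
    also have "\<dots> \<le> (\<Sum>p\<in>B. \<Sum>q\<in>B. norm (cnj (h p) * h q * S p q x))"
      by (intro order.trans[OF norm_sum] sum_mono order.refl)
    finally show ?thesis by (simp add: norm_mult)
  qed
  have EZsum: "expectation (\<lambda>\<omega>. \<bar>(\<Sum>m<N. (norm (?Z m \<omega>))\<^sup>2) - H\<bar>) \<le> 2 * K\<^sup>2 / sqrt (real N)"
  proof -
    have int: "integrable M (\<lambda>\<omega>. norm (h p) * norm (h q) * norm (S p q (\<lambda>p. U \<omega> $$ p)))"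
      if "p \<in> B" "q \<in> B" for p q
      using that by (intro integrable_mult_right integrable_norm tame_integrable_U tS)
    have "expectation (\<lambda>\<omega>. \<bar>(\<Sum>m<N. (norm (?Z m \<omega>))\<^sup>2) - H\<bar>)
      \<le> expectation (\<lambda>\<omega>. \<Sum>p\<in>B. \<Sum>q\<in>B. norm (h p) * norm (h q) * norm (S p q (\<lambda>p. U \<omega> $$ p)))"
      by (intro integral_mono tame_integrable_U[OF tsum] Zsum Bochner_Integration.integrable_sum int)
    also have "\<dots> = (\<Sum>p\<in>B. expectation (\<lambda>\<omega>. \<Sum>q\<in>B. norm (h p) * norm (h q) * norm (S p q (\<lambda>p. U \<omega> $$ p))))"
      by (intro Bochner_Integration.integral_sum Bochner_Integration.integrable_sum int)
    also have "\<dots> = (\<Sum>p\<in>B. \<Sum>q\<in>B. expectation (\<lambda>\<omega>. norm (h p) * norm (h q) * norm (S p q (\<lambda>p. U \<omega> $$ p))))"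
      by (intro sum.cong refl Bochner_Integration.integral_sum int)
    also have "\<dots> \<le> (\<Sum>p\<in>B. \<Sum>q\<in>B. norm (h p) * norm (h q) * (2 / sqrt (real N)))"
      unfolding integral_mult_right_zero using ES by (intro sum_mono mult_left_mono) auto
    also have "\<dots> = K * K * (2 / sqrt (real N))"
      unfolding K_def sum_product by (simp only: sum_distrib_right)
    finally show ?thesis by (simp add: power2_eq_square mult_ac)
  qed
  \<comment> \<open>All factors have modulus at most 1, so the difference of the two products is
    bounded by the sum of the differences of factors. The remaining error is that of exp(-s/2) in
    its exponent.\<close>
  have pointwise: "\<bar>(\<Prod>m<N. phase_kernel (Z m x)) - exp (- (H / 2))\<bar>
     \<le> (\<Sum>m<N. (norm (Z m x)) ^ 4) + \<bar>(\<Sum>m<N. (norm (Z m x))\<^sup>2) - H\<bar> / 2" for x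
  proof -
    have "\<bar>(\<Prod>m<N. phase_kernel (Z m x)) - (\<Prod>m<N. exp (- ((norm (Z m x))\<^sup>2 / 2)))\<bar>
      \<le> (\<Sum>m<N. \<bar>phase_kernel (Z m x) - exp (- ((norm (Z m x))\<^sup>2 / 2))\<bar>)"
      using norm_prod_diff[of "{..<N}" "\<lambda>m. phase_kernel (Z m x)" "\<lambda>m. exp (- ((norm (Z m x))\<^sup>2 / 2))"]
      by (simp add: abs_phase_kernel_le)
    also have "\<dots> \<le> (\<Sum>m<N. (norm (Z m x)) ^ 4)"
      by (intro sum_mono phase_kernel_approx)
    finally have 1: "\<bar>(\<Prod>m<N. phase_kernel (Z m x)) - (\<Prod>m<N. exp (- ((norm (Z m x))\<^sup>2 / 2)))\<bar>
      \<le> (\<Sum>m<N. (norm (Z m x)) ^ 4)" .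
    have e: "(\<Prod>m<N. exp (- ((norm (Z m x))\<^sup>2 / 2))) = exp (- ((\<Sum>m<N. (norm (Z m x))\<^sup>2) / 2))"
      by (simp add: exp_sum[symmetric] sum_negf sum_divide_distrib)
    have "\<bar>exp (- ((\<Sum>m<N. (norm (Z m x))\<^sup>2) / 2)) - exp (- (H / 2))\<bar>
       \<le> \<bar>(\<Sum>m<N. (norm (Z m x))\<^sup>2) / 2 - H / 2\<bar>"
      using H0 by (intro exp_minus_lipschitz) (auto intro!: sum_nonneg)
    also have "\<dots> = \<bar>(\<Sum>m<N. (norm (Z m x))\<^sup>2) - H\<bar> / 2"
      by (simp flip: diff_divide_distrib)
    finally have 2: "\<bar>exp (- ((\<Sum>m<N. (norm (Z m x))\<^sup>2) / 2)) - exp (- (H / 2))\<bar>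
       \<le> \<bar>(\<Sum>m<N. (norm (Z m x))\<^sup>2) - H\<bar> / 2" .
    show ?thesis using 1 2 unfolding e by linarith
  qed
  have tprod: "tame (\<lambda>x. \<Prod>m<N. phase_kernel (Z m x))"
    by (intro tame_prod tame_cont[where g = phase_kernel] tZ) (auto simp: phase_kernel_def[abs_def] intro!: continuous_intros)
  have "norm ((\<integral>\<omega>. L 0 (\<lambda>p. U \<omega> $$ p) \<partial>M) - of_real (exp (- (H / 2))))
    = \<bar>expectation (\<lambda>\<omega>. (\<Prod>m<N. phase_kernel (?Z m \<omega>)) - exp (- (H / 2)))\<bar>"
  proof -
    have "(\<integral>\<omega>. L 0 (\<lambda>p. U \<omega> $$ p) \<partial>M) - of_real (exp (- (H / 2)))
      = of_real (expectation (\<lambda>\<omega>. \<Prod>m<N. phase_kernel (?Z m \<omega>)) - exp (- (H / 2)))"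
      unfolding L0N integral_complex_of_real by simp
    also have "expectation (\<lambda>\<omega>. \<Prod>m<N. phase_kernel (?Z m \<omega>)) - exp (- (H / 2))
      = expectation (\<lambda>\<omega>. (\<Prod>m<N. phase_kernel (?Z m \<omega>)) - exp (- (H / 2)))"
      using tame_integrable_U[OF tprod] by (simp add: prob_space)
    finally show ?thesis by (simp only: norm_of_real)
  qed
  also have "\<dots> \<le> expectation (\<lambda>\<omega>. \<bar>(\<Prod>m<N. phase_kernel (?Z m \<omega>)) - exp (- (H / 2))\<bar>)"
    using integral_norm_bound[of M "\<lambda>\<omega>. (\<Prod>m<N. phase_kernel (?Z m \<omega>)) - exp (- (H / 2))"] by simp
  also have "\<dots> \<le> expectation (\<lambda>\<omega>. (\<Sum>m<N. (norm (?Z m \<omega>)) ^ 4) + \<bar>(\<Sum>m<N. (norm (?Z m \<omega>))\<^sup>2) - H\<bar> / 2)"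
  proof (rule integral_mono)
    show "integrable M (\<lambda>\<omega>. \<bar>(\<Prod>m<N. phase_kernel (?Z m \<omega>)) - exp (- (H / 2))\<bar>)"
      using tame_integrable_U[OF tprod] by auto
    show "integrable M (\<lambda>\<omega>. (\<Sum>m<N. (norm (?Z m \<omega>)) ^ 4) + \<bar>(\<Sum>m<N. (norm (?Z m \<omega>))\<^sup>2) - H\<bar> / 2)"
      by (intro Bochner_Integration.integrable_add Bochner_Integration.integrable_sum
          Bochner_Integration.integrable_divide tame_integrable_U[OF tsum] tame_integrable_U[OF tZ4]) auto
  qed (rule pointwise)
  also have "\<dots> = (\<Sum>m<N. expectation (\<lambda>\<omega>. (norm (?Z m \<omega>)) ^ 4))
      + expectation (\<lambda>\<omega>. \<bar>(\<Sum>m<N. (norm (?Z m \<omega>))\<^sup>2) - H\<bar>) / 2"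
  proof -
    have i4: "integrable M (\<lambda>\<omega>. (norm (?Z m \<omega>)) ^ 4)" if "m \<in> {..<N}" for m
      using that tame_integrable_U[OF tZ4] by simp
    show ?thesis
      using tame_integrable_U[OF tsum] i4
      by (subst Bochner_Integration.integral_add) (auto simp: Bochner_Integration.integral_sum)
  qed
  also have "\<dots> \<le> (\<Sum>m<N. 2 * K ^ 4 * real r ^ 4 / (real N)\<^sup>2) + (2 * K\<^sup>2 / sqrt (real N)) / 2"
    using EZ4 EZsum by (intro add_mono sum_mono divide_right_mono) auto
  also have "\<dots> = 2 * K ^ 4 * real r ^ 4 / real N + K\<^sup>2 / sqrt (real N)"
    using N by (simp add: power2_eq_square)
  finally show ?thesis unfolding char .
qed

end

section \<open>Convergence from characteristic functions\<close>

text \<open>The algebra for the Stone-Weierstrass theorem, restricted to the first \<open>n\<close>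
  coordinates of a function on all naturals.\<close>

inductive coord_poly :: "nat \<Rightarrow> ((nat \<Rightarrow> real) \<Rightarrow> real) \<Rightarrow> bool" for n where
  const: "coord_poly n (\<lambda>_. c)"
| coord: "j < n \<Longrightarrow> coord_poly n (\<lambda>x. x j)"
| add: "coord_poly n f \<Longrightarrow> coord_poly n g \<Longrightarrow> coord_poly n (\<lambda>x. f x + g x)"
| mult: "coord_poly n f \<Longrightarrow> coord_poly n g \<Longrightarrow> coord_poly n (\<lambda>x. f x * g x)"

inductive trig_poly :: "nat \<Rightarrow> ((nat \<Rightarrow> real) \<Rightarrow> complex) \<Rightarrow> bool" for n where
  cis: "trig_poly n (\<lambda>x. c * cis (\<Sum>j<n. t j * x j))"
| add: "trig_poly n f \<Longrightarrow> trig_poly n g \<Longrightarrow> trig_poly n (\<lambda>x. f x + g x)"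

lemma trig_poly_mult:
  assumes "trig_poly n f" "trig_poly n g"
  shows "trig_poly n (\<lambda>x. f x * g x)"
  using assms
proof (induction f)
  case (cis c t)
  from cis show ?case
  proof (induction g)
    case (cis c' t')
    have "(\<lambda>x. (c * cis (\<Sum>j<n. t j * x j)) * (c' * cis (\<Sum>j<n. t' j * x j)))
      = (\<lambda>x. (c * c') * cis (\<Sum>j<n. (t j + t' j) * x j))"
    proof
      fix x :: "nat \<Rightarrow> real"
      have "(\<Sum>j<n. (t j + t' j) * x j) = (\<Sum>j<n. t j * x j) + (\<Sum>j<n. t' j * x j)"
        by (simp add: distrib_right sum.distrib)
      then show "(c * cis (\<Sum>j<n. t j * x j)) * (c' * cis (\<Sum>j<n. t' j * x j))
        = (c * c') * cis (\<Sum>j<n. (t j + t' j) * x j)"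
        by (simp add: cis_mult[symmetric])
    qed
    then show ?case by (simp only: trig_poly.cis)
  qed (simp add: distrib_left trig_poly.add)
qed (simp add: distrib_right trig_poly.add)

text \<open>Since sin is a combination of two characters, with coefficients -i/2 and i/2,
  polynomials in sines are finite sums of characters.\<close>

lemma trig_poly_sin:
  assumes "coord_poly n g"
  shows "trig_poly n (\<lambda>x. of_real (g (\<lambda>j. sin (a * x j))))"
  using assms
proof induction
  case (const c)
  then show ?case using trig_poly.cis[of n "of_real c" "\<lambda>_. 0"] by simp
next
  case (coord j)
  have "trig_poly n (\<lambda>x. (- \<i> / 2) * cis (\<Sum>i<n. (if i = j then a else 0) * x i)
      + (\<i> / 2) * cis (\<Sum>i<n. (if i = j then - a else 0) * x i))"
    by (intro trig_poly.intros)
  also have "(\<lambda>x. (- \<i> / 2) * cis (\<Sum>i<n. (if i = j then a else 0) * x i)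
      + (\<i> / 2) * cis (\<Sum>i<n. (if i = j then - a else 0) * x i)) = (\<lambda>x. of_real (sin (a * x j)))"
  proof
    fix x :: "nat \<Rightarrow> real"
    have "(\<Sum>i<n. (if i = j then b else 0) * x i) = b * x j" for b
    proof -
      have "(\<Sum>i<n. (if i = j then b else 0) * x i) = (\<Sum>i<n. if i = j then b * x i else 0)"
        by (intro sum.cong) auto
      then show ?thesis using coord by simp
    qed
    then show "(- \<i> / 2) * cis (\<Sum>i<n. (if i = j then a else 0) * x i)
      + (\<i> / 2) * cis (\<Sum>i<n. (if i = j then - a else 0) * x i) = of_real (sin (a * x j))"
      by (simp add: complex_eq_iff)
  qed
  finally show ?case .
qed (simp_all add: trig_poly.add trig_poly_mult)

text \<open>An n-dimensional cube realised inside the functions on all naturals: the value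
  \<open>undefined\<close> from index \<open>n\<close> on is that of extensional functions.
  Compactness is Tychonoff's theorem with singleton factors there.\<close>

lemma compact_cube:
  "compact {s :: nat \<Rightarrow> real. \<forall>j. s j \<in> (if j < n then {-a..a} else {undefined})}"
proof -
  have eq: "{s :: nat \<Rightarrow> real. \<forall>j. s j \<in> (if j < n then {-a..a} else {undefined})}
    = PiE UNIV (\<lambda>j. if j < n then {-a..a} else {undefined})"
    by (rule Set.set_eqI) (simp only: PiE_UNIV_domain Pi_iff mem_Collect_eq ball_UNIV)
  have "compactin (product_topology (\<lambda>_. euclidean) UNIV)
    (PiE UNIV (\<lambda>j::nat. if j < n then {-a..a} else {undefined::real}))"
    unfolding compactin_PiE by (auto simp: compactin_euclidean_iff)
  then show ?thesis unfolding eq euclidean_product_topology compactin_euclidean_iff .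
qed

text \<open>The function \<open>s \<mapsto> f (arcsin s / a)\<close> is approximated by a polynomial on the cube \<open>[-1, 1]\<^sup>n\<close>.
  Substituting \<open>s = sin (a x)\<close> gives a trigonometric polynomial which is bounded everywhere and close
  to \<open>f\<close> on \<open>[-R, R]\<^sup>n\<close>, without having to make \<open>f\<close> periodic.\<close>

lemma trig_poly_approx:
  fixes f :: "(nat \<Rightarrow> real) \<Rightarrow> real"
  assumes f: "continuous_on UNIV f" and B: "\<And>x. \<bar>f x\<bar> \<le> B" and R: "R > 0" and e: "e > 0"
  obtains g where "trig_poly n (\<lambda>x. of_real (g x))" "\<And>x. \<bar>g x\<bar> \<le> B + e"
    "\<And>x. x \<in> extensional {..<n} \<Longrightarrow> (\<And>j. j < n \<Longrightarrow> \<bar>x j\<bar> \<le> R) \<Longrightarrow> \<bar>f x - g x\<bar> \<le> e"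
proof -
  define S where "S = {s :: nat \<Rightarrow> real. \<forall>j. s j \<in> (if j < n then {-1..1} else {undefined})}"
  \<comment> \<open>The scaled arcsine maps [-1, 1] onto [-R, R].\<close>
  define F where "F s = f (\<lambda>j. if j < n then arcsin (s j) * (2 * R / pi) else undefined)" for s
  have contF: "continuous_on S F"
    unfolding F_def
  proof (rule continuous_on_compose2[OF f])
    have "continuous_on S (\<lambda>s. s j)" for j
      by (rule continuous_on_subset[OF continuous_on_product_coordinates]) simp
    moreover have "-1 \<le> s j \<and> s j \<le> 1" if "s \<in> S" "j < n" for s j
      using that unfolding S_def by (metis (mono_tags, lifting) atLeastAtMost_iff mem_Collect_eq)
    ultimately have "continuous_on S (\<lambda>s. if j < n then arcsin (s j) * (2 * R / pi) else undefined)" for j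
      by (cases "j < n") (auto intro!: continuous_intros)
    then show "continuous_on S (\<lambda>s j. if j < n then arcsin (s j) * (2 * R / pi) else undefined)"
      by (rule continuous_on_coordinatewise_then_product)
  qed simp
  interpret function_ring_on "Collect (coord_poly n)" S
  proof
    show "compact S" unfolding S_def by (rule compact_cube)
    fix f :: "(nat \<Rightarrow> real) \<Rightarrow> real" assume "f \<in> Collect (coord_poly n)"
    then have "coord_poly n f" by simp
    then show "continuous_on S f"
      by induction (auto intro!: continuous_intros continuous_on_subset[OF continuous_on_product_coordinates])
  next
    fix x y :: "nat \<Rightarrow> real" assume xy: "x \<in> S" "y \<in> S" "x \<noteq> y"
    then obtain j where j: "x j \<noteq> y j" by blast
    have "j < n"
    proof (rule ccontr)
      assume "\<not> j < n"
      then have "x j = undefined" "y j = undefined"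
        using xy unfolding S_def by (metis (mono_tags, lifting) mem_Collect_eq singletonD)+
      with j show False by simp
    qed
    then show "\<exists>f\<in>Collect (coord_poly n). f x \<noteq> f y"
      using j by (intro bexI[of _ "\<lambda>x. x j"]) (auto intro: coord_poly.coord)
  qed (auto intro: coord_poly.intros)
  obtain q where q: "coord_poly n q" "\<And>s. s \<in> S \<Longrightarrow> \<bar>F s - q s\<bar> < e"
    using Stone_Weierstrass_basic[OF contF e] by auto
  define a where "a = pi / (2 * R)"
  have local: "coord_poly n q \<Longrightarrow> (\<And>j. j < n \<Longrightarrow> s j = s' j) \<Longrightarrow> q s = q s'" for q s s'
    by (induction rule: coord_poly.induct) auto
  define g where "g x = q (\<lambda>j. sin (a * x j))" for x :: "nat \<Rightarrow> real"
  \<comment> \<open>The point \<open>sn x\<close> lies in the cube for every \<open>x\<close>, which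
    gives the bound on \<open>g\<close> everywhere. For |x_j| \<le> R the angle stays within
    [-pi/2, pi/2], where arcsin inverts sin.\<close>
  define sn where "sn x = (\<lambda>j. if j < n then sin (a * x j) else undefined)" for x :: "nat \<Rightarrow> real"
  have gq: "g x = q (sn x)" for x
    unfolding g_def by (rule local[OF q(1)]) (simp add: sn_def)
  have snS: "sn x \<in> S" for x by (auto simp: sn_def S_def)
  show thesis
  proof
    show "trig_poly n (\<lambda>x. of_real (g x))" unfolding g_def by (rule trig_poly_sin[OF q(1)])
    show "\<bar>g x\<bar> \<le> B + e" for x
      using q(2)[OF snS[of x]] B[of "\<lambda>j. if j < n then arcsin (sn x j) * (2 * R / pi) else undefined"]
      unfolding gq F_def by linarith
    show "\<bar>f x - g x\<bar> \<le> e" if x: "x \<in> extensional {..<n}" and xR: "\<And>j. j < n \<Longrightarrow> \<bar>x j\<bar> \<le> R" for x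
    proof -
      have "(\<lambda>j. if j < n then arcsin (sn x j) * (2 * R / pi) else undefined) = x"
      proof
        fix j show "(if j < n then arcsin (sn x j) * (2 * R / pi) else undefined) = x j"
        proof (cases "j < n")
          case True
          have "\<bar>a * x j\<bar> \<le> a * R"
          proof -
            have "a \<ge> 0" using R by (simp add: a_def)
            then show ?thesis using mult_left_mono[OF xR[OF True], of a] by (simp add: abs_mult)
          qed
          also have "a * R = pi / 2" using R by (simp add: a_def)
          finally have "arcsin (sin (a * x j)) = a * x j" by (intro arcsin_sin) auto
          then show ?thesis using True R by (simp add: sn_def a_def)
        next
          case False
          then show ?thesis using x by (simp add: extensional_def)
        qed
      qed
      then show ?thesis using q(2)[OF snS[of x]] by (simp add: F_def gq)
    qed
  qed
qed

text \<open>Test functions live on all of \<open>nat \<Rightarrow> real\<close> with its Borel sets,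
  the laws on the finite product. On the latter, coordinates from \<open>n\<close> on are constantly
  \<open>undefined\<close>, hence measurable.\<close>

lemma PiM_borel_to_borel:
  "(\<lambda>x. x) \<in> measurable (Pi\<^sub>M {..<n::nat} (\<lambda>_. borel :: real measure)) borel"
proof (rule measurable_coordinatewise_then_product)
  fix i
  show "(\<lambda>x. x i) \<in> borel_measurable (Pi\<^sub>M {..<n} (\<lambda>_. borel :: real measure))"
  proof (cases "i < n")
    case False
    have "(\<lambda>x. undefined) \<in> borel_measurable (Pi\<^sub>M {..<n} (\<lambda>_. borel :: real measure))" by simp
    then show ?thesis
      using False by (subst measurable_cong[where g = "\<lambda>_. undefined"]) (auto simp: space_PiM PiE_def extensional_def)
  qed (simp add: measurable_component_singleton)
qed

lemma trig_poly_measurable_bounded: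
  assumes "trig_poly n g"
  shows "g \<in> borel_measurable (Pi\<^sub>M {..<n} (\<lambda>_. borel))" "\<exists>C. \<forall>x. norm (g x) \<le> C"
  using assms
proof induction
  case (cis c t)
  {
    case 1
    have "(\<lambda>x. \<Sum>j<n. t j * x j) \<in> borel_measurable (Pi\<^sub>M {..<n} (\<lambda>_. borel))" by measurable
    then have "(\<lambda>x. cis (\<Sum>j<n. t j * x j)) \<in> borel_measurable (Pi\<^sub>M {..<n} (\<lambda>_. borel))"
      by (rule measurable_compose) (intro borel_measurable_continuous_onI continuous_intros)
    then show ?case by measurable
  next
    case 2
    show ?case by (rule exI[of _ "norm c"]) (simp add: norm_mult)
  }
next
  case (add f g)
  {
    case 1
    show ?case using add by auto
  next
    case 2
    obtain C D where "\<And>x. norm (f x) \<le> C" "\<And>x. norm (g x) \<le> D" using add by auto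
    then show ?case by (intro exI[of _ "C + D"]) (meson norm_triangle_mono)
  }
qed

text \<open>A common \<open>C\<close> for a family of measures supplies tightness in quantitative
  form, through Chebyshev's inequality.\<close>

locale second_moment_measure = prob_space P for P :: "(nat \<Rightarrow> real) measure" +
  fixes n :: nat and C :: real
  assumes sets_P: "sets P = sets (Pi\<^sub>M {..<n} (\<lambda>_. borel))"
    and square: "\<And>j. j < n \<Longrightarrow> integrable P (\<lambda>x. (x j)\<^sup>2)" "\<And>j. j < n \<Longrightarrow> (\<integral>x. (x j)\<^sup>2 \<partial>P) \<le> C"
begin

lemma measurable_P: "f \<in> borel_measurable (Pi\<^sub>M {..<n} (\<lambda>_. borel)) \<Longrightarrow> f \<in> borel_measurable P"
  using measurable_cong_sets[OF sets_P refl] by blast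

lemma trig_poly_integrable:
  assumes "trig_poly n g" shows "integrable P g"
proof -
  obtain D where "\<And>x. norm (g x) \<le> D" using trig_poly_measurable_bounded(2)[OF assms] by auto
  then show ?thesis
    using trig_poly_measurable_bounded(1)[OF assms]
    by (intro integrable_const_bound[where B = D] measurable_P) auto
qed

text \<open>Inside the cube the error is at most \<open>e\<close>. Outside, it is at most
  \<open>2 * B + e\<close>, and there the sum of squares divided by R^2 is at least 1.\<close>

lemma integral_approx:
  assumes f: "f \<in> borel_measurable borel" and B: "\<And>x. \<bar>f x\<bar> \<le> B" and R: "R > 0" and e: "e \<ge> 0"
    and g: "trig_poly n (\<lambda>x. of_real (g x))" "\<And>x. \<bar>g x\<bar> \<le> B + e"
      "\<And>x. x \<in> extensional {..<n} \<Longrightarrow> (\<And>j. j < n \<Longrightarrow> \<bar>x j\<bar> \<le> R) \<Longrightarrow> \<bar>f x - g x\<bar> \<le> e"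
  shows "\<bar>(\<integral>x. f x \<partial>P) - (\<integral>x. g x \<partial>P)\<bar> \<le> e + (2 * B + e) * (real n * C / R\<^sup>2)"
proof -
  have B0: "B \<ge> 0" using B[of undefined] by linarith
  have fi: "integrable P f"
    using measurable_compose[OF PiM_borel_to_borel f] B
    by (intro integrable_const_bound[where B = B] measurable_P) auto
  have gi: "integrable P g"
  proof -
    have "(\<lambda>x. Re (of_real (g x))) \<in> borel_measurable (Pi\<^sub>M {..<n} (\<lambda>_. borel))"
      using trig_poly_measurable_bounded(1)[OF g(1)] by measurable
    then show ?thesis
      using g(2) by (intro integrable_const_bound[where B = "B + e"] measurable_P) auto
  qed
  have si: "integrable P (\<lambda>x. e + (2 * B + e) * ((\<Sum>j<n. (x j)\<^sup>2) / R\<^sup>2))"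
    using square(1) by (intro Bochner_Integration.integrable_add integrable_mult_right
        Bochner_Integration.integrable_divide Bochner_Integration.integrable_sum) auto
  have ptw: "\<bar>f x - g x\<bar> \<le> e + (2 * B + e) * ((\<Sum>j<n. (x j)\<^sup>2) / R\<^sup>2)" if x: "x \<in> space P" for x
  proof (cases "\<forall>j<n. \<bar>x j\<bar> \<le> R")
    case True
    have "x \<in> extensional {..<n}"
      using x sets_eq_imp_space_eq[OF sets_P] by (auto simp: space_PiM PiE_def)
    then have "\<bar>f x - g x\<bar> \<le> e" using True by (intro g(3)) auto
    moreover have "(2 * B + e) * ((\<Sum>j<n. (x j)\<^sup>2) / R\<^sup>2) \<ge> 0"
      using B0 e by (auto intro!: mult_nonneg_nonneg divide_nonneg_nonneg sum_nonneg)
    ultimately show ?thesis by simp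
  next
    case False
    then obtain j where j: "j < n" "\<bar>x j\<bar> > R" by auto
    have "R\<^sup>2 \<le> (x j)\<^sup>2" using j R by (metis abs_le_square_iff abs_of_pos less_imp_le)
    also have "\<dots> \<le> (\<Sum>j<n. (x j)\<^sup>2)" using j by (intro member_le_sum) auto
    finally have 1: "1 \<le> (\<Sum>j<n. (x j)\<^sup>2) / R\<^sup>2" using R by simp
    have "\<bar>f x - g x\<bar> \<le> 2 * B + e" using B[of x] g(2)[of x] by linarith
    also have "\<dots> \<le> (2 * B + e) * ((\<Sum>j<n. (x j)\<^sup>2) / R\<^sup>2)"
      using mult_left_mono[OF 1, of "2 * B + e"] B0 e by simp
    finally show ?thesis using e by simp
  qed
  have "\<bar>(\<integral>x. f x \<partial>P) - (\<integral>x. g x \<partial>P)\<bar> = \<bar>\<integral>x. f x - g x \<partial>P\<bar>" using fi gi by simp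
  also have "\<dots> \<le> (\<integral>x. \<bar>f x - g x\<bar> \<partial>P)" using integral_norm_bound[of P "\<lambda>x. f x - g x"] by simp
  also have "\<dots> \<le> (\<integral>x. e + (2 * B + e) * ((\<Sum>j<n. (x j)\<^sup>2) / R\<^sup>2) \<partial>P)"
    using fi gi by (intro integral_mono si ptw) auto
  also have "\<dots> = e + (2 * B + e) * ((\<Sum>j<n. \<integral>x. (x j)\<^sup>2 \<partial>P) / R\<^sup>2)"
    using square(1) by (subst Bochner_Integration.integral_add)
      (auto simp: Bochner_Integration.integral_sum prob_space
        intro!: Bochner_Integration.integrable_divide Bochner_Integration.integrable_sum)
  also have "\<dots> \<le> e + (2 * B + e) * (real n * C / R\<^sup>2)"
    using sum_mono[of "{..<n}" "\<lambda>j. \<integral>x. (x j)\<^sup>2 \<partial>P" "\<lambda>_. C"] square(2) B0 e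
    by (intro add_left_mono mult_left_mono divide_right_mono) auto
  finally show ?thesis .
qed

end

text \<open>Convergence of characteristic functions is convergence on trigonometric polynomials; the
  uniform second moment makes the passage to bounded continuous functions uniform in
  \<open>k\<close>.\<close>

theorem levy_multivariate:
  fixes P :: "nat \<Rightarrow> (nat \<Rightarrow> real) measure"
  assumes P: "\<And>k. k \<ge> k0 \<Longrightarrow> second_moment_measure (P k) n C" and Q: "second_moment_measure Q n C"
    and char: "\<And>t. (\<lambda>k. \<integral>x. cis (\<Sum>j<n. t j * x j) \<partial>P k) \<longlonglongrightarrow> (\<integral>x. cis (\<Sum>j<n. t j * x j) \<partial>Q)"
    and f: "continuous_on UNIV f" and B: "\<And>x. \<bar>f x\<bar> \<le> (B::real)"
  shows "(\<lambda>k. \<integral>x. f x \<partial>P k) \<longlonglongrightarrow> (\<integral>x. f x \<partial>Q)"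
proof (rule LIMSEQ_I)
  fix e :: real assume e: "e > 0"
  have B0: "B \<ge> 0" using B[of undefined] by linarith
  \<comment> \<open>Replacing \<open>f\<close> by \<open>g\<close> costs \<open>2 * d\<close> for
    each of the two measures and the convergence of the integrals of \<open>g\<close> less than
    \<open>d\<close>: in total less than \<open>5 * d\<close>, hence below \<open>e\<close>.\<close>
  define d where "d = e / 8"
  have d: "d > 0" using e by (simp add: d_def)
  obtain R where R: "R > 0" "(2 * B + d) * (real n * \<bar>C\<bar> / R\<^sup>2) \<le> d"
  proof
    define D where "D = (2 * B + d) * (real n * \<bar>C\<bar>)"
    have D: "D \<ge> 0" using B0 d by (simp add: D_def)
    let ?R = "sqrt (D / d) + 1"
    show "?R > 0" using D d by (simp add: add_nonneg_pos)
    have "D / d \<le> ?R\<^sup>2"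
    proof -
      have "D / d = (sqrt (D / d))\<^sup>2" using D d by simp
      also have "\<dots> \<le> ?R\<^sup>2" using D d by (intro power_mono) auto
      finally show ?thesis .
    qed
    then have "D \<le> d * ?R\<^sup>2" using d by (simp add: field_simps)
    then have "D / ?R\<^sup>2 \<le> d" using \<open>?R > 0\<close> by (simp add: pos_divide_le_eq)
    then show "(2 * B + d) * (real n * \<bar>C\<bar> / ?R\<^sup>2) \<le> d" by (simp add: D_def)
  qed
  obtain g where g: "trig_poly n (\<lambda>x. of_real (g x))" "\<And>x. \<bar>g x\<bar> \<le> B + d"
    "\<And>x. x \<in> extensional {..<n} \<Longrightarrow> (\<And>j. j < n \<Longrightarrow> \<bar>x j\<bar> \<le> R) \<Longrightarrow> \<bar>f x - g x\<bar> \<le> d"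
    using trig_poly_approx[OF f B R(1) d] by metis
  have approx: "\<bar>(\<integral>x. f x \<partial>T) - (\<integral>x. g x \<partial>T)\<bar> \<le> 2 * d" if "second_moment_measure T n C" for T
  proof -
    have "(2 * B + d) * (real n * C / R\<^sup>2) \<le> (2 * B + d) * (real n * \<bar>C\<bar> / R\<^sup>2)"
      using B0 d by (intro mult_left_mono divide_right_mono) (auto intro: mult_left_mono)
    then have "(2 * B + d) * (real n * C / R\<^sup>2) \<le> d" using R(2) by (rule order.trans)
    moreover have "\<bar>(\<integral>x. f x \<partial>T) - (\<integral>x. g x \<partial>T)\<bar> \<le> d + (2 * B + d) * (real n * C / R\<^sup>2)"
      by (rule second_moment_measure.integral_approx[OF that borel_measurable_continuous_onI[OF f] B R(1)])
        (use d g in auto)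
    ultimately show ?thesis by simp
  qed
  have "(\<lambda>k. \<integral>x. h x \<partial>P k) \<longlonglongrightarrow> (\<integral>x. h x \<partial>Q)" if "trig_poly n h" for h
    using that
  proof induction
    case (cis c t)
    then show ?case using tendsto_mult_left[OF char] by simp
  next
    case (add f g)
    have "\<forall>\<^sub>F k in sequentially. (\<integral>x. f x \<partial>P k) + (\<integral>x. g x \<partial>P k) = (\<integral>x. f x + g x \<partial>P k)"
      using eventually_ge_at_top[of k0]
    proof eventually_elim
      case (elim k)
      interpret second_moment_measure "P k" n C using P[OF elim] .
      show ?case using trig_poly_integrable add.hyps by simp
    qed
    moreover have "(\<lambda>k. (\<integral>x. f x \<partial>P k) + (\<integral>x. g x \<partial>P k)) \<longlonglongrightarrow> (\<integral>x. f x + g x \<partial>Q)"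
    proof -
      interpret second_moment_measure Q n C by (rule Q)
      show ?thesis using tendsto_add[OF add.IH] trig_poly_integrable add.hyps by simp
    qed
    ultimately show ?case using tendsto_cong by force
  qed
  from this[OF g(1)] have "(\<lambda>k. complex_of_real (\<integral>x. g x \<partial>P k)) \<longlonglongrightarrow> complex_of_real (\<integral>x. g x \<partial>Q)"
    by simp
  then have "(\<lambda>k. \<integral>x. g x \<partial>P k) \<longlonglongrightarrow> (\<integral>x. g x \<partial>Q)" by (simp only: tendsto_of_real_iff)
  then obtain k1 where k1: "\<And>k. k \<ge> k1 \<Longrightarrow> \<bar>(\<integral>x. g x \<partial>P k) - (\<integral>x. g x \<partial>Q)\<bar> < d"
    using d unfolding LIMSEQ_iff by auto
  show "\<exists>no. \<forall>k\<ge>no. norm ((\<integral>x. f x \<partial>P k) - (\<integral>x. f x \<partial>Q)) < e"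
  proof (intro exI[of _ "max k0 k1"] allI impI)
    fix k assume k: "k \<ge> max k0 k1"
    have "\<bar>(\<integral>x. f x \<partial>P k) - (\<integral>x. g x \<partial>P k)\<bar> \<le> 2 * d" "\<bar>(\<integral>x. f x \<partial>Q) - (\<integral>x. g x \<partial>Q)\<bar> \<le> 2 * d"
      "\<bar>(\<integral>x. g x \<partial>P k) - (\<integral>x. g x \<partial>Q)\<bar> < d"
      using k by (auto intro!: approx P Q k1)
    moreover have "8 * d = e" by (simp add: d_def)
    ultimately show "norm ((\<integral>x. f x \<partial>P k) - (\<integral>x. f x \<partial>Q)) < e"
      unfolding real_norm_def using d by linarith
  qed
qed

section \<open>The standard Gaussian vector\<close>

lemma second_moment_std_gaussian: "second_moment_measure (std_gaussian n) n 1"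
proof -
  interpret prob_space std_normal_distribution
    using real_dist_normal_dist by (simp add: real_distribution_def)
  interpret PP: product_prob_space "\<lambda>_::nat. std_normal_distribution" "{..<n}"
    by standard
  have sq: "integrable std_normal_distribution (\<lambda>x. x\<^sup>2)" "(\<integral>x. x\<^sup>2 \<partial>std_normal_distribution) = 1"
    using integrable_std_normal_distribution_moment[of 2] std_normal_distribution_even_moments[of 1]
    by (auto simp: fact_numeral)
  have distr: "distr (std_gaussian n) std_normal_distribution (\<lambda>x. x j) = std_normal_distribution" if "j < n" for j
    unfolding std_gaussian_def using PP.PiM_component[of j] that by simp
  have meas: "(\<lambda>x. x j) \<in> measurable (std_gaussian n) std_normal_distribution" if "j < n" for j
    unfolding std_gaussian_def using that by (intro measurable_component_singleton) simp
  show ?thesis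
  proof (intro second_moment_measure.intro second_moment_measure_axioms.intro prob_spaceI)
    show "emeasure (std_gaussian n) (space (std_gaussian n)) = 1"
      using PP.emeasure_space_1 by (simp add: std_gaussian_def)
    show "sets (std_gaussian n) = sets (Pi\<^sub>M {..<n} (\<lambda>_. borel))"
      unfolding std_gaussian_def by (intro sets_PiM_cong) auto
    fix j assume j: "j < n"
    show "integrable (std_gaussian n) (\<lambda>x. (x j)\<^sup>2)"
      using sq(1) integrable_distr_eq[OF meas[OF j], of "\<lambda>x. x\<^sup>2"] distr[OF j] by simp
    show "(\<integral>x. (x j)\<^sup>2 \<partial>std_gaussian n) \<le> 1"
      using sq(2) integral_distr[OF meas[OF j], of "\<lambda>x. x\<^sup>2"] distr[OF j] by simp
  qed
qed

lemma char_std_gaussian: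
  "(\<integral>x. cis (\<Sum>j<n. t j * x j) \<partial>std_gaussian n) = of_real (exp (- (\<Sum>j<n. (t j)\<^sup>2) / 2))"
proof -
  interpret prob_space std_normal_distribution
    using real_dist_normal_dist by (simp add: real_distribution_def)
  interpret PP: product_prob_space "\<lambda>_::nat. std_normal_distribution" "{..<n}"
    by standard
  have cis_sum: "cis (\<Sum>j<n. y j) = (\<Prod>j<n. cis (y j))" for y :: "nat \<Rightarrow> real"
    by (induction n) (simp_all add: cis_mult[symmetric])
  have int: "integrable std_normal_distribution (\<lambda>x. cis (s * x))" for s
  proof (rule integrable_const_bound[where B = 1])
    have "(\<lambda>x. cis (s * x)) \<in> borel_measurable borel"
      by (intro borel_measurable_continuous_onI continuous_intros)
    then show "(\<lambda>x. cis (s * x)) \<in> borel_measurable std_normal_distribution" by simp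
  qed simp
  have one: "(\<integral>x. cis (s * x) \<partial>std_normal_distribution) = of_real (exp (- (s\<^sup>2) / 2))" for s
    using fun_cong[OF char_std_normal_distribution, of s] by (simp add: char_def cis_conv_exp)
  have "(\<integral>x. cis (\<Sum>j<n. t j * x j) \<partial>std_gaussian n)
     = (\<Prod>j<n. \<integral>x. cis (t j * x) \<partial>std_normal_distribution)"
    unfolding std_gaussian_def cis_sum by (rule PP.product_integral_prod) (auto intro: int)
  also have "\<dots> = of_real (\<Prod>j<n. exp (- ((t j)\<^sup>2) / 2))" by (simp add: one)
  also have "(\<Prod>j<n. exp (- ((t j)\<^sup>2) / 2)) = exp (- (\<Sum>j<n. (t j)\<^sup>2) / 2)"
    by (simp add: exp_sum[symmetric] sum_negf sum_divide_distrib)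
  finally show ?thesis .
qed

section \<open>Homogeneous polynomials\<close>

definition monomial_eval :: "(nat \<Rightarrow>\<^sub>0 nat) \<Rightarrow> (nat \<Rightarrow> real) \<Rightarrow> complex" where
  "monomial_eval m x = (\<Prod>j\<in>Poly_Mapping.keys m. of_real (x j) ^ Poly_Mapping.lookup m j)"

lemma monomial_eval_superset:
  assumes "finite S" "Poly_Mapping.keys m \<subseteq> S"
  shows "monomial_eval m x = (\<Prod>j\<in>S. of_real (x j) ^ Poly_Mapping.lookup m j)"
  unfolding monomial_eval_def using assms
  by (intro prod.mono_neutral_left) (auto simp: in_keys_iff)

lemma monomial_eval_add: "monomial_eval (m + m') x = monomial_eval m x * monomial_eval m' x"
proof -
  let ?S = "Poly_Mapping.keys m \<union> Poly_Mapping.keys m'"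
  have "Poly_Mapping.keys (m + m') \<subseteq> ?S" by (rule Poly_Mapping.keys_add)
  then show ?thesis
    by (simp add: monomial_eval_superset[of ?S] lookup_add power_add prod.distrib)
qed

definition monomial_degree :: "(nat \<Rightarrow>\<^sub>0 nat) \<Rightarrow> nat" where
  "monomial_degree m = (\<Sum>j\<in>Poly_Mapping.keys m. Poly_Mapping.lookup m j)"

lemma monomial_degree_superset:
  assumes "finite S" "Poly_Mapping.keys m \<subseteq> S"
  shows "monomial_degree m = (\<Sum>j\<in>S. Poly_Mapping.lookup m j)"
  unfolding monomial_degree_def using assms
  by (intro sum.mono_neutral_left) (auto simp: in_keys_iff)

lemma monomial_degree_add: "monomial_degree (m + m') = monomial_degree m + monomial_degree m'"
proof -
  let ?S = "Poly_Mapping.keys m \<union> Poly_Mapping.keys m'"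
  have "Poly_Mapping.keys (m + m') \<subseteq> ?S" by (rule Poly_Mapping.keys_add)
  then show ?thesis
    by (simp add: monomial_degree_superset[of ?S] lookup_add sum.distrib)
qed

lemma mv_eval_superset:
  assumes "finite S" "Poly_Mapping.keys Q \<subseteq> S"
  shows "mv_eval Q x = (\<Sum>m\<in>S. Poly_Mapping.lookup Q m * monomial_eval m x)"
  unfolding mv_eval_def monomial_eval_def[symmetric] using assms
  by (intro sum.mono_neutral_left) (auto simp: in_keys_iff)

lemma mv_eval_add: "mv_eval (P + Q) x = mv_eval P x + mv_eval Q x"
proof -
  let ?S = "Poly_Mapping.keys P \<union> Poly_Mapping.keys Q"
  have "Poly_Mapping.keys (P + Q) \<subseteq> ?S" by (rule Poly_Mapping.keys_add)
  then show ?thesis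
    by (simp add: mv_eval_superset[of ?S] lookup_add distrib_right sum.distrib)
qed

lemma mv_eval_scale:
  assumes "mv_homogeneous d Q"
  shows "mv_eval Q (\<lambda>j. c * x j) = of_real c ^ d * mv_eval Q x"
proof -
  have "monomial_eval m (\<lambda>j. c * x j) = of_real c ^ d * monomial_eval m x"
    if "m \<in> Poly_Mapping.keys Q" for m
    using assms that
    by (auto simp: mv_homogeneous_def monomial_eval_def power_mult_distrib prod.distrib power_sum[symmetric])
  then show ?thesis
    unfolding mv_eval_def monomial_eval_def[symmetric] sum_distrib_left
    by (intro sum.cong) auto
qed

lemma continuous_on_mv_eval: "continuous_on UNIV (mv_eval Q)"
proof -
  have "continuous_on UNIV (\<lambda>x. x j :: real)" for j :: nat
    by (rule continuous_on_product_coordinates)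
  then show ?thesis unfolding mv_eval_def[abs_def] by (intro continuous_intros)
qed

text \<open>Working with functions lets coefficients be chosen only at the end. The zero function is
  homogeneous of every degree here, which is convenient for missing components.\<close>

definition hom_fun :: "nat \<Rightarrow> nat \<Rightarrow> ((nat \<Rightarrow> real) \<Rightarrow> complex) \<Rightarrow> bool" where
  "hom_fun n d f \<longleftrightarrow> (\<exists>Q. mv_poly_in n Q \<and> mv_homogeneous d Q \<and> f = mv_eval Q)"

lemma hom_fun_zero: "hom_fun n d (\<lambda>_. 0)"
  unfolding hom_fun_def by (rule exI[of _ 0]) (auto simp: mv_poly_in_def mv_homogeneous_def mv_eval_def)

lemma hom_fun_add: "hom_fun n d f \<Longrightarrow> hom_fun n d g \<Longrightarrow> hom_fun n d (\<lambda>x. f x + g x)"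
proof -
  assume "hom_fun n d f" "hom_fun n d g"
  then obtain P Q where P: "mv_poly_in n P" "mv_homogeneous d P" "f = mv_eval P"
    and Q: "mv_poly_in n Q" "mv_homogeneous d Q" "g = mv_eval Q" unfolding hom_fun_def by blast
  have "Poly_Mapping.keys (P + Q) \<subseteq> Poly_Mapping.keys P \<union> Poly_Mapping.keys Q" by (rule Poly_Mapping.keys_add)
  then have "mv_poly_in n (P + Q)" "mv_homogeneous d (P + Q)"
    using P Q unfolding mv_poly_in_def mv_homogeneous_def by blast+
  then show ?thesis unfolding hom_fun_def using P Q
    by (intro exI[of _ "P + Q"]) (auto simp: mv_eval_add)
qed

lemma hom_fun_sum: "(\<And>i. i \<in> A \<Longrightarrow> hom_fun n d (f i)) \<Longrightarrow> hom_fun n d (\<lambda>x. \<Sum>i\<in>A. f i x)"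
  by (induction A rule: infinite_finite_induct) (auto intro: hom_fun_zero hom_fun_add)

lemma hom_fun_monomial:
  assumes "Poly_Mapping.keys m \<subseteq> {..<n}"
  shows "hom_fun n (monomial_degree m) (\<lambda>x. c * monomial_eval m x)"
  unfolding hom_fun_def
proof (intro exI[of _ "Poly_Mapping.single m c"] conjI)
  have "mv_eval (Poly_Mapping.single m c) x = c * monomial_eval m x" for x
    by (subst mv_eval_superset[of "{m}"]) auto
  then show "(\<lambda>x. c * monomial_eval m x) = mv_eval (Poly_Mapping.single m c)" by auto
qed (use assms in \<open>auto simp: mv_poly_in_def mv_homogeneous_def monomial_degree_def split: if_splits\<close>)

lemma hom_fun_const: "hom_fun n 0 (\<lambda>_. c)"
  using hom_fun_monomial[of 0 n c] by (simp add: monomial_degree_def monomial_eval_def)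

lemma hom_fun_coord: "j < n \<Longrightarrow> hom_fun n 1 (\<lambda>x. of_real (x j))"
  using hom_fun_monomial[of "Poly_Mapping.single j 1" n 1]
  by (simp add: monomial_degree_def monomial_eval_def)

lemma hom_fun_mult:
  assumes "hom_fun n d f" "hom_fun n e g"
  shows "hom_fun n (d + e) (\<lambda>x. f x * g x)"
proof -
  obtain P Q where P: "mv_poly_in n P" "mv_homogeneous d P" "f = mv_eval P"
    and Q: "mv_poly_in n Q" "mv_homogeneous e Q" "g = mv_eval Q" using assms unfolding hom_fun_def by blast
  have "f x * g x = (\<Sum>m\<in>Poly_Mapping.keys P. \<Sum>m'\<in>Poly_Mapping.keys Q.
      (Poly_Mapping.lookup P m * Poly_Mapping.lookup Q m') * monomial_eval (m + m') x)" for x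
    unfolding P Q mv_eval_def monomial_eval_def[symmetric] sum_product monomial_eval_add
    by (intro sum.cong) auto
  moreover have "hom_fun n (d + e) (\<lambda>x. \<Sum>m\<in>Poly_Mapping.keys P. \<Sum>m'\<in>Poly_Mapping.keys Q.
      (Poly_Mapping.lookup P m * Poly_Mapping.lookup Q m') * monomial_eval (m + m') x)"
  proof (intro hom_fun_sum)
    fix m m' assume mm: "m \<in> Poly_Mapping.keys P" "m' \<in> Poly_Mapping.keys Q"
    have "monomial_degree m = d" "monomial_degree m' = e"
      using mm P(2) Q(2) by (auto simp: mv_homogeneous_def monomial_degree_def)
    then have "monomial_degree (m + m') = d + e" by (simp add: monomial_degree_add)
    moreover have "Poly_Mapping.keys (m + m') \<subseteq> {..<n}"
      using mm P(1) Q(1) Poly_Mapping.keys_add[of m m'] unfolding mv_poly_in_def by blast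
    ultimately show "hom_fun n (d + e) (\<lambda>x. Poly_Mapping.lookup P m * Poly_Mapping.lookup Q m' * monomial_eval (m + m') x)"
      using hom_fun_monomial by metis
  qed
  ultimately show ?thesis by presburger
qed

text \<open>Polynomial functions, generated as sums of homogeneous ones so that the decomposition by
  degree is an induction.\<close>

inductive poly_fun :: "nat \<Rightarrow> ((nat \<Rightarrow> real) \<Rightarrow> complex) \<Rightarrow> bool" for n where
  hom: "hom_fun n d f \<Longrightarrow> poly_fun n f"
| add: "poly_fun n f \<Longrightarrow> poly_fun n g \<Longrightarrow> poly_fun n (\<lambda>x. f x + g x)"

lemma poly_fun_const: "poly_fun n (\<lambda>_. c)"
  by (rule poly_fun.hom[OF hom_fun_const])

lemma poly_fun_coord: "j < n \<Longrightarrow> poly_fun n (\<lambda>x. of_real (x j))"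
  by (rule poly_fun.hom[OF hom_fun_coord])

lemma poly_fun_mult:
  assumes "poly_fun n f" "poly_fun n g"
  shows "poly_fun n (\<lambda>x. f x * g x)"
  using assms
proof (induction f)
  case (hom d f)
  from hom(2,1) show ?case
  proof (induction g)
    case (hom e g)
    then show ?case by (intro poly_fun.hom[OF hom_fun_mult])
  qed (simp add: distrib_left poly_fun.add)
qed (simp add: distrib_right poly_fun.add)

lemma poly_fun_minus: "poly_fun n f \<Longrightarrow> poly_fun n (\<lambda>x. - f x)"
  using poly_fun_mult[OF poly_fun_const[of n "-1"]] by simp

lemma poly_fun_sum: "(\<And>i. i \<in> A \<Longrightarrow> poly_fun n (f i)) \<Longrightarrow> poly_fun n (\<lambda>x. \<Sum>i\<in>A. f i x)"
  by (induction A rule: infinite_finite_induct) (auto intro: poly_fun_const poly_fun.add)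

lemma poly_fun_prod: "(\<And>i. i \<in> A \<Longrightarrow> poly_fun n (f i)) \<Longrightarrow> poly_fun n (\<lambda>x. \<Prod>i\<in>A. f i x)"
  by (induction A rule: infinite_finite_induct) (auto intro: poly_fun_const poly_fun_mult)

lemma poly_fun_det:
  fixes f :: "(nat \<Rightarrow> real) \<Rightarrow> complex mat"
  assumes carrier: "\<And>x. f x \<in> carrier_mat m m"
    and entry: "\<And>i j. i < m \<Longrightarrow> j < m \<Longrightarrow> poly_fun n (\<lambda>x. f x $$ (i, j))"
  shows "poly_fun n (\<lambda>x. Determinant.det (f x))"
proof -
  have "poly_fun n (\<lambda>x. f x $$ (i, p i))" if "p permutes {0..<m}" "i \<in> {0..<m}" for p i
    using entry[of i "p i"] that permutes_in_image[of p "{0..<m}" i] by auto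
  then show ?thesis
    unfolding det_def'[OF carrier]
    by (intro poly_fun_sum poly_fun_mult poly_fun_const poly_fun_prod) auto
qed

lemma poly_fun_homogeneous_decomposition:
  assumes "poly_fun n f"
  obtains F D where "\<And>d. hom_fun n d (F d)" "\<And>d x. d \<ge> D \<Longrightarrow> F d x = 0" "\<And>x. f x = (\<Sum>d<D. F d x)"
proof -
  have "\<exists>F D. (\<forall>d. hom_fun n d (F d)) \<and> (\<forall>d x. d \<ge> D \<longrightarrow> F d x = 0) \<and> (\<forall>x. f x = (\<Sum>d<D. F d x))"
    using assms
  proof induction
    case (hom d f)
    show ?case
    proof (intro exI conjI allI impI)
      let ?F = "\<lambda>e x. if e = d then f x else 0"
      show "hom_fun n e (?F e)" for e
        using hom hom_fun_zero by (cases "e = d") auto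
      show "e \<ge> Suc d \<Longrightarrow> ?F e x = 0" for e x by auto
      show "f x = (\<Sum>e<Suc d. ?F e x)" for x by simp
    qed
  next
    case (add f g)
    obtain F D where F: "\<And>d. hom_fun n d (F d)" "\<And>d x. d \<ge> D \<Longrightarrow> F d x = 0" "\<And>x. f x = (\<Sum>d<D. F d x)"
      using add.IH(1) by blast
    obtain G E where G: "\<And>d. hom_fun n d (G d)" "\<And>d x. d \<ge> E \<Longrightarrow> G d x = 0" "\<And>x. g x = (\<Sum>d<E. G d x)"
      using add.IH(2) by blast
    show ?case
    proof (intro exI conjI allI impI)
      show "hom_fun n d (\<lambda>x. F d x + G d x)" for d by (intro hom_fun_add F G)
      show "d \<ge> max D E \<Longrightarrow> F d x + G d x = 0" for d x using F(2) G(2) by simp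
      have "(\<Sum>d<D. F d x) = (\<Sum>d<max D E. F d x)" for x
        by (rule sum.mono_neutral_left) (auto simp: F(2))
      moreover have "(\<Sum>d<E. G d x) = (\<Sum>d<max D E. G d x)" for x
        by (rule sum.mono_neutral_left) (auto simp: G(2))
      ultimately show "f x + g x = (\<Sum>d<max D E. F d x + G d x)" for x
        by (simp add: F(3) G(3) sum.distrib)
    qed
  qed
  then show thesis using that by blast
qed

text \<open>Coordinates of \<open>\<real>\<^bsup>2 r\<^sup>2\<^esup>\<close> are read as real and imaginary parts of the entries of an
  \<open>r \<times> r\<close> matrix, normalised so that standard Gaussian coordinates give entries with
  \<open>E \<bar>w\<bar>\<^sup>2 = 1\<close>.\<close>

definition coords_mat :: "nat \<Rightarrow> (nat \<Rightarrow> real) \<Rightarrow> complex mat" where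
  "coords_mat r x = Matrix.mat r r (\<lambda>(a, b).
     (of_real (x (2 * (a * r + b))) + \<i> * of_real (x (2 * (a * r + b) + 1))) / of_real (sqrt 2))"

lemma coord_index_less:
  assumes "a < r" "b < (r::nat)"
  shows "2 * (a * r + b) + 1 < 2 * r\<^sup>2"
proof -
  have "a * r + b + 1 \<le> a * r + r" using assms by simp
  also have "\<dots> = (a + 1) * r" by simp
  also have "\<dots> \<le> r * r" using assms by (intro mult_right_mono) auto
  finally show ?thesis by (simp add: power2_eq_square)
qed

text \<open>Conjugates are included because \<open>a_block\<close> contains the adjoint of the
  truncation. The polynomials are therefore taken in real and imaginary parts.\<close>

lemma poly_fun_coords_mat:
  assumes "a < r" "b < r"
  shows "poly_fun (2 * r\<^sup>2) (\<lambda>x. coords_mat r x $$ (a, b))"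
    "poly_fun (2 * r\<^sup>2) (\<lambda>x. cnj (coords_mat r x $$ (a, b)))"
proof -
  have 1: "2 * (a * r + b) + 1 < 2 * r\<^sup>2" "2 * (a * r + b) < 2 * r\<^sup>2"
    using coord_index_less[OF assms] by auto
  have eq: "coords_mat r x $$ (a, b) = of_real (1 / sqrt 2) * of_real (x (2 * (a * r + b)))
      + (\<i> * of_real (1 / sqrt 2)) * of_real (x (2 * (a * r + b) + 1))"
    "cnj (coords_mat r x $$ (a, b)) = of_real (1 / sqrt 2) * of_real (x (2 * (a * r + b)))
      + (- \<i> * of_real (1 / sqrt 2)) * of_real (x (2 * (a * r + b) + 1))" for x
    using assms by (auto simp: coords_mat_def add_divide_distrib)
  show "poly_fun (2 * r\<^sup>2) (\<lambda>x. coords_mat r x $$ (a, b))"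
    unfolding eq(1) by (intro poly_fun.add poly_fun_mult poly_fun_const poly_fun_coord 1)
  show "poly_fun (2 * r\<^sup>2) (\<lambda>x. cnj (coords_mat r x $$ (a, b)))"
    unfolding eq(2) by (intro poly_fun.add poly_fun_mult poly_fun_const poly_fun_coord 1)
qed

section \<open>Polynomial dependence of the characteristic polynomial on the truncation\<close>

lemma poly_fun_mult_mat:
  fixes f g :: "(nat \<Rightarrow> real) \<Rightarrow> complex mat"
  assumes "\<And>x. f x \<in> carrier_mat p q" "\<And>x. g x \<in> carrier_mat q s"
    and "\<And>i j. i < p \<Longrightarrow> j < q \<Longrightarrow> poly_fun n (\<lambda>x. f x $$ (i, j))"
    and "\<And>i j. i < q \<Longrightarrow> j < s \<Longrightarrow> poly_fun n (\<lambda>x. g x $$ (i, j))"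
    and "i < p" "j < s"
  shows "poly_fun n (\<lambda>x. (f x * g x) $$ (i, j))"
proof -
  have "(f x * g x) $$ (i, j) = (\<Sum>k<q. f x $$ (i, k) * g x $$ (k, j))" for x
    by (rule mult_mat_index[OF assms(1,2,5,6)])
  moreover have "poly_fun n (\<lambda>x. \<Sum>k<q. f x $$ (i, k) * g x $$ (k, j))"
    using assms(3-6) by (intro poly_fun_sum poly_fun_mult) auto
  ultimately show ?thesis by simp
qed

lemma poly_fun_block_polynomial:
  assumes A: "\<And>i. i < k \<Longrightarrow> A i \<in> carrier_mat r r" and B: "\<And>j. j < l \<Longrightarrow> B j \<in> carrier_mat r r"
    and P: "nc_poly_in (k + l) P" and ij: "i < 2 * r" "j < 2 * r"
  shows "poly_fun (2 * r\<^sup>2) (\<lambda>x. block_polynomial r k l P A B (coords_mat r x) $$ (i, j))"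
proof -
  let ?n = "2 * r\<^sup>2"
  have W: "coords_mat r x \<in> carrier_mat r r" for x by (simp add: coords_mat_def)
  have W': "mat_adjoint (coords_mat r x) \<in> carrier_mat r r" for x using W by auto
  define Xs where "Xs x = map (\<lambda>i. a_block r (A i) (coords_mat r x)) [0..<k]
    @ map (\<lambda>j. b_block r (B j) (coords_mat r x)) [0..<l]" for x
  have Xs_carrier: "Xs x ! h \<in> carrier_mat (2 * r) (2 * r)" if h: "h < k + l" for h x
  proof (cases "h < k")
    case True
    then show ?thesis
      using four_block_carrier_mat[OF mult_carrier_mat[OF A[OF True] W'] zero_carrier_mat[of r r]]
      by (simp add: Xs_def nth_append a_block_def mult_2)
  next
    case False
    then have "h - k < l" using h by simp
    then show ?thesis
      using False four_block_carrier_mat[OF zero_carrier_mat[of r r] mult_carrier_mat[OF B W]]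
      by (simp add: Xs_def nth_append b_block_def mult_2)
  qed
  have Xs_entry: "poly_fun ?n (\<lambda>x. (Xs x ! h) $$ (i, j))" if h: "h < k + l" "i < 2 * r" "j < 2 * r" for h i j
  proof (cases "h < k")
    case True
    have AW: "poly_fun ?n (\<lambda>x. (A h * mat_adjoint (coords_mat r x)) $$ (i, j))" if "i < r" "j < r" for i j
      by (rule poly_fun_mult_mat[of "\<lambda>_. A h" r r _ r])
        (use A[OF True] W' that in \<open>auto simp: mat_adjoint_index[OF W] intro: poly_fun_const poly_fun_coords_mat\<close>)
    have "(Xs x ! h) $$ (i, j) = (if i < r then if j < r then (A h * mat_adjoint (coords_mat r x)) $$ (i, j)
        else A h $$ (i, j - r) else 0)" for x
      using True h A[OF True] W'[of x] by (auto simp: Xs_def nth_append a_block_def)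
    then show ?thesis using AW by (cases "i < r"; cases "j < r") (auto intro: poly_fun_const)
  next
    case False
    then have l: "h - k < l" using h by simp
    have BW: "poly_fun ?n (\<lambda>x. (B (h - k) * coords_mat r x) $$ (i, j))" if "i < r" "j < r" for i j
      by (rule poly_fun_mult_mat[of "\<lambda>_. B (h - k)" r r _ r])
        (use B[OF l] W that in \<open>auto intro: poly_fun_const poly_fun_coords_mat\<close>)
    have "(Xs x ! h) $$ (i, j) = (if i < r then 0 else if j < r then B (h - k) $$ (i - r, j)
        else (B (h - k) * coords_mat r x) $$ (i - r, j - r))" for x
      using False h B[OF l] W[of x] l by (auto simp: Xs_def nth_append b_block_def)
    then show ?thesis using BW h by (cases "i < r"; cases "j < r") (auto intro: poly_fun_const)
  qed
  have len: "length (Xs x) = k + l" for x by (simp add: Xs_def)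
  have word: "poly_fun ?n (\<lambda>x. word_eval (2 * r) (Xs x) w $$ (i, j))"
    if "set w \<subseteq> {..<k + l}" "i < 2 * r" "j < 2 * r" for w i j
    using that
  proof (induction w arbitrary: i j)
    case Nil
    then show ?case by (simp add: word_eval_def poly_fun_const)
  next
    case (Cons h w)
    then have h: "h < k + l" and w: "set w \<subseteq> {..<k + l}" by auto
    have c: "word_eval (2 * r) (Xs x) w \<in> carrier_mat (2 * r) (2 * r)" for x
      using word_eval_carrier[of "Xs x" "2 * r" w] Xs_carrier w len by simp
    have "poly_fun ?n (\<lambda>x. (Xs x ! h * word_eval (2 * r) (Xs x) w) $$ (i, j))"
      by (rule poly_fun_mult_mat[OF Xs_carrier[OF h] c Xs_entry[OF h] Cons.IH[OF w] Cons.prems(2,3)])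
    then show ?case by (simp add: word_eval_def)
  qed
  have "block_polynomial r k l P A B (coords_mat r x) $$ (i, j)
    = (\<Sum>w\<in>Poly_Mapping.keys P. Poly_Mapping.lookup P w * word_eval (2 * r) (Xs x) w $$ (i, j))" for x
    using ij by (simp add: block_polynomial_def nc_eval_def Xs_def)
  moreover have "poly_fun ?n (\<lambda>x. \<Sum>w\<in>Poly_Mapping.keys P. Poly_Mapping.lookup P w * word_eval (2 * r) (Xs x) w $$ (i, j))"
    using P ij by (intro poly_fun_sum poly_fun_mult poly_fun_const word) (auto simp: nc_poly_in_def)
  ultimately show ?thesis by simp
qed

lemma poly_fun_char_poly:
  assumes A: "\<And>i. i < k \<Longrightarrow> A i \<in> carrier_mat r r" and B: "\<And>j. j < l \<Longrightarrow> B j \<in> carrier_mat r r"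
    and P: "nc_poly_in (k + l) P"
  shows "poly_fun (2 * r\<^sup>2) (\<lambda>x. poly (char_poly (block_polynomial r k l P A B (coords_mat r x))) z)"
proof -
  let ?Y = "\<lambda>x. block_polynomial r k l P A B (coords_mat r x)"
  have Y: "?Y x \<in> carrier_mat (2 * r) (2 * r)" for x by (simp add: block_polynomial_def)
  have c: "- char_matrix (?Y x) z \<in> carrier_mat (2 * r) (2 * r)" for x
    using Y[of x] by (simp add: char_matrix_def)
  have e: "(- char_matrix (?Y x) z) $$ (i, j) = - (?Y x $$ (i, j)) + (if i = j then z else 0)"
    if "i < 2 * r" "j < 2 * r" for i j x
    using Y[of x] that by (auto simp: char_matrix_def)
  show ?thesis
    unfolding char_poly_matrix[OF Y]
    by (rule poly_fun_det[OF c])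
      (simp only: e, intro poly_fun.add poly_fun_minus poly_fun_const poly_fun_block_polynomial A B P)
qed

section \<open>Convergence in law\<close>

lemma tendsto_fun_componentwise:
  fixes g :: "nat \<Rightarrow> 'i \<Rightarrow> 'b::topological_space"
  assumes "\<And>i. (\<lambda>n. g n i) \<longlonglongrightarrow> l i"
  shows "g \<longlonglongrightarrow> l"
proof -
  have "limitin (product_topology (\<lambda>_. euclidean) UNIV) g l sequentially"
    unfolding limitin_componentwise using assms by simp
  then show ?thesis unfolding euclidean_product_topology limitin_canonical_iff .
qed

text \<open>Provides the compact set on which the test function in \<open>slutsky\<close> is
  uniformly continuous.\<close>

lemma compact_range_with_limit:
  fixes f :: "nat \<Rightarrow> 'a::topological_space"
  assumes "f \<longlonglongrightarrow> l"
  shows "compact (insert l (range f))"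
  unfolding compact_eq_Heine_Borel
proof (intro allI impI, elim conjE)
  fix C assume C: "\<forall>t\<in>C. open t" "insert l (range f) \<subseteq> \<Union>C"
  obtain T where T: "T \<in> C" "l \<in> T" using C(2) by auto
  have "\<forall>\<^sub>F n in sequentially. f n \<in> T" using assms T C(1) by (auto dest: topological_tendstoD)
  then obtain N where N: "\<And>n. n \<ge> N \<Longrightarrow> f n \<in> T" unfolding eventually_sequentially by blast
  have "\<exists>V\<in>C. f n \<in> V" for n using C(2) by auto
  then obtain V where V: "\<And>n. V n \<in> C" "\<And>n. f n \<in> V n" by metis
  have "insert l (range f) \<subseteq> \<Union>(insert T (V ` {..<N}))"
  proof
    fix x assume "x \<in> insert l (range f)"
    then consider "x = l" | n where "x = f n" by auto
    then show "x \<in> \<Union>(insert T (V ` {..<N}))"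
    proof cases
      case 2
      then show ?thesis using N[of n] V(2)[of n] by (cases "n < N") auto
    qed (use T in auto)
  qed
  moreover have "insert T (V ` {..<N}) \<subseteq> C" using T V by auto
  ultimately show "\<exists>C'\<subseteq>C. finite C' \<and> insert l (range f) \<subseteq> \<Union>C'"
    by (intro exI[of _ "insert T (V ` {..<N})"]) auto
qed

text \<open>The random variables are controlled only from \<open>N0\<close> on, and the shift
  discards the initial terms, where measurability may fail.\<close>

lemma converges_in_lawI:
  assumes X: "\<And>N. N \<ge> N0 \<Longrightarrow> X N \<in> borel_measurable M"
    and lim: "\<And>f B. continuous_on UNIV f \<Longrightarrow> (\<And>x. \<bar>f x\<bar> \<le> (B::real)) \<Longrightarrow>
      (\<lambda>N. \<integral>\<omega>. f (X (N + N0) \<omega>) \<partial>M) \<longlonglongrightarrow> (\<integral>x. f x \<partial>\<nu>)"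
  shows "converges_in_law M X \<nu>"
  unfolding converges_in_law_def
proof (intro allI impI, elim conjE)
  fix f :: "'b \<Rightarrow> real" assume f: "continuous_on UNIV f" "bounded (range f)"
  obtain B where B: "\<And>x. \<bar>f x\<bar> \<le> B" using f(2) unfolding bounded_iff by auto
  have "(\<integral>x. f x \<partial>distr M borel (X (N + N0))) = (\<integral>\<omega>. f (X (N + N0) \<omega>) \<partial>M)" for N
    by (rule integral_distr) (use X borel_measurable_continuous_onI[OF f(1)] in auto)
  then have "(\<lambda>N. \<integral>x. f x \<partial>distr M borel (X (N + N0))) \<longlonglongrightarrow> (\<integral>x. f x \<partial>\<nu>)"
    using lim[OF f(1) B] by simp
  then show "(\<lambda>N. \<integral>x. f x \<partial>distr M borel (X N)) \<longlonglongrightarrow> (\<integral>x. f x \<partial>\<nu>)"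
    by (rule LIMSEQ_offset)
qed

lemma converges_in_lawD:
  assumes X: "\<And>N. N \<ge> N0 \<Longrightarrow> X N \<in> borel_measurable M"
    and conv: "converges_in_law M X \<nu>"
    and f: "continuous_on UNIV f" and B: "\<And>x. \<bar>f x\<bar> \<le> (B::real)"
  shows "(\<lambda>N. \<integral>\<omega>. f (X (N + N0) \<omega>) \<partial>M) \<longlonglongrightarrow> (\<integral>x. f x \<partial>\<nu>)"
proof -
  have "bounded (range f)" using B unfolding bounded_iff by auto
  then have "(\<lambda>N. \<integral>x. f x \<partial>distr M borel (X N)) \<longlonglongrightarrow> (\<integral>x. f x \<partial>\<nu>)"
    using conv f unfolding converges_in_law_def by blast
  then have "(\<lambda>N. \<integral>x. f x \<partial>distr M borel (X (N + N0))) \<longlonglongrightarrow> (\<integral>x. f x \<partial>\<nu>)"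
    by (rule LIMSEQ_ignore_initial_segment)
  moreover have "(\<integral>x. f x \<partial>distr M borel (X (N + N0))) = (\<integral>\<omega>. f (X (N + N0) \<omega>) \<partial>M)" for N
    by (rule integral_distr) (use X borel_measurable_continuous_onI[OF f(1)] in auto)
  ultimately show ?thesis by simp
qed

text \<open>The test function is merely continuous, so the difference is small only while
  \<open>X N\<close> stays in a compact cube; the second moment controls the complement. On the cube
  the difference tends to 0 almost surely and dominated convergence applies.\<close>

lemma (in prob_space) slutsky:
  fixes X :: "nat \<Rightarrow> 'a \<Rightarrow> nat \<Rightarrow> real" and Y :: "nat \<Rightarrow> 'a \<Rightarrow> 'b::{metric_space, second_countable_topology}"
  assumes X: "\<And>N. X N \<in> borel_measurable M" "\<And>N \<omega>. X N \<omega> \<in> extensional {..<n}"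
    and sq: "\<And>N j. j < n \<Longrightarrow> integrable M (\<lambda>\<omega>. (X N \<omega> j)\<^sup>2)" "\<And>N j. j < n \<Longrightarrow> expectation (\<lambda>\<omega>. (X N \<omega> j)\<^sup>2) \<le> C"
    and Y: "\<And>N. Y N \<in> borel_measurable M" "AE \<omega> in M. (\<lambda>N. Y N \<omega>) \<longlonglongrightarrow> y"
    and f: "continuous_on UNIV f" and B: "\<And>z. \<bar>f z\<bar> \<le> (B::real)"
  shows "(\<lambda>N. expectation (\<lambda>\<omega>. f (X N \<omega>, Y N \<omega>)) - expectation (\<lambda>\<omega>. f (X N \<omega>, y))) \<longlonglongrightarrow> 0"
proof (rule LIMSEQ_I)
  fix e :: real assume e: "e > 0"
  have B0: "B \<ge> 0" using B[of undefined] by linarith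
  have C0: "real n * C \<ge> 0"
  proof (cases "n = 0")
    case False
    have "0 \<le> expectation (\<lambda>\<omega>. (X 0 \<omega> 0)\<^sup>2)" by simp
    also have "\<dots> \<le> C" using sq(2)[of 0 0] False by simp
    finally show ?thesis by simp
  qed simp
  \<comment> \<open>Chosen so that the Chebyshev bound for leaving the cube costs at most
    \<open>e / 2\<close>.\<close>
  define R where "R = sqrt (2 * (2 * B * (real n * C)) / e) + 1"
  have R: "R > 0" using B0 C0 e by (simp add: R_def add_nonneg_pos)
  have R2: "2 * B * (real n * C) / R\<^sup>2 \<le> e / 2"
  proof -
    let ?a = "2 * (2 * B * (real n * C)) / e"
    have a: "?a \<ge> 0" using B0 C0 e by simp
    have "?a = (sqrt ?a)\<^sup>2" using a by simp
    also have "\<dots> \<le> R\<^sup>2" unfolding R_def using a by (intro power_mono) auto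
    finally have "2 * (2 * B * (real n * C)) \<le> e * R\<^sup>2" using e by (simp add: pos_divide_le_eq mult.commute)
    then show ?thesis using R by (simp add: pos_divide_le_eq)
  qed
  define K where "K = {s :: nat \<Rightarrow> real. \<forall>j. s j \<in> (if j < n then {-R..R} else {undefined})}"
  have K: "compact K" unfolding K_def by (rule compact_cube)
  have Kin: "X N \<omega> \<in> K \<longleftrightarrow> (\<forall>j<n. \<bar>X N \<omega> j\<bar> \<le> R)" for N \<omega>
    using X(2)[of N \<omega>] by (auto simp: K_def extensional_def abs_le_iff)
  define D where "D N \<omega> = (if \<forall>j<n. \<bar>X N \<omega> j\<bar> \<le> R then \<bar>f (X N \<omega>, Y N \<omega>) - f (X N \<omega>, y)\<bar> else 0)" for N \<omega>
  have Xj: "(\<lambda>\<omega>. X N \<omega> j) \<in> borel_measurable M" for N j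
    using X(1)[of N] by (rule measurable_product_then_coordinatewise)
  have fm: "(\<lambda>\<omega>. f (X N \<omega>, Y N \<omega>)) \<in> borel_measurable M" "(\<lambda>\<omega>. f (X N \<omega>, y)) \<in> borel_measurable M" for N
    by (rule measurable_compose[OF _ borel_measurable_continuous_onI[OF f]],
        intro borel_measurable_Pair X Y borel_measurable_const)+
  have Dm: "D N \<in> borel_measurable M" for N
    unfolding D_def using Xj[measurable] fm[measurable] by measurable
  have D_lim: "AE \<omega> in M. (\<lambda>N. D N \<omega>) \<longlonglongrightarrow> 0"
    using Y(2)
  proof eventually_elim
    case (elim \<omega>)
    \<comment> \<open>In the application the values of \<open>Y\<close> lie in a space that is not
      locally compact, so a ball around \<open>y\<close> will not do. A convergent sequence with its
      limit is compact; the set depends on the sample point.\<close>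
    define T where "T = K \<times> insert y (range (\<lambda>N. Y N \<omega>))"
    have "compact (insert y (range (\<lambda>N. Y N \<omega>)))"
      using compact_range_with_limit[OF elim] .
    then have "compact T" unfolding T_def by (intro compact_Times K)
    then have unif: "uniformly_continuous_on T f"
      by (intro compact_uniformly_continuous continuous_on_subset[OF f]) auto
    show ?case
    proof (rule LIMSEQ_I)
      fix d :: real assume "d > 0"
      then obtain h where h: "h > 0" "\<And>u v. u \<in> T \<Longrightarrow> v \<in> T \<Longrightarrow> dist v u < h \<Longrightarrow> dist (f v) (f u) < d"
        using unif unfolding uniformly_continuous_on_def by metis
      obtain N0 where N0: "\<And>N. N \<ge> N0 \<Longrightarrow> dist (Y N \<omega>) y < h"
        using elim h(1) unfolding lim_sequentially by blast
      have "norm (D N \<omega> - 0) < d" if "N \<ge> N0" for N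
      proof (cases "\<forall>j<n. \<bar>X N \<omega> j\<bar> \<le> R")
        case True
        then have "X N \<omega> \<in> K" by (simp add: Kin)
        then have "(X N \<omega>, y) \<in> T" "(X N \<omega>, Y N \<omega>) \<in> T" by (auto simp: T_def)
        moreover have "dist (X N \<omega>, Y N \<omega>) (X N \<omega>, y) < h"
          using N0[OF that] by (simp add: dist_Pair_Pair)
        ultimately have "dist (f (X N \<omega>, Y N \<omega>)) (f (X N \<omega>, y)) < d" by (rule h(2))
        then show ?thesis using True by (simp add: D_def dist_real_def)
      next
        case False
        then show ?thesis using \<open>d > 0\<close> by (auto simp: D_def)
      qed
      then show "\<exists>N0. \<forall>N\<ge>N0. norm (D N \<omega> - 0) < d" by blast
    qed
  qed
  have D_bound: "norm (D N \<omega>) \<le> 2 * B" for N \<omega>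
    using B[of "(X N \<omega>, Y N \<omega>)"] B[of "(X N \<omega>, y)"] B0 by (auto simp: D_def)
  have "(\<lambda>N. expectation (D N)) \<longlonglongrightarrow> expectation (\<lambda>_. 0)"
    by (rule integral_dominated_convergence[where w = "\<lambda>_. 2 * B"]) (use Dm D_lim D_bound in auto)
  then have "(\<lambda>N. expectation (D N)) \<longlonglongrightarrow> 0" by simp
  then have "\<exists>N0. \<forall>N\<ge>N0. norm (expectation (D N) - 0) < e / 2"
    using e by (intro LIMSEQ_D) auto
  then obtain N0 where N0: "\<And>N. N \<ge> N0 \<Longrightarrow> \<bar>expectation (D N)\<bar> < e / 2" by auto
  show "\<exists>N0. \<forall>N\<ge>N0. norm (expectation (\<lambda>\<omega>. f (X N \<omega>, Y N \<omega>)) - expectation (\<lambda>\<omega>. f (X N \<omega>, y)) - 0) < e"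
  proof (intro exI[of _ N0] allI impI)
    fix N assume N: "N \<ge> N0"
    have fi: "integrable M (\<lambda>\<omega>. f (X N \<omega>, Y N \<omega>))" "integrable M (\<lambda>\<omega>. f (X N \<omega>, y))"
      using B by (auto intro!: integrable_const_bound[where B = B] fm)
    have Di: "integrable M (D N)"
      using D_bound by (intro integrable_const_bound[where B = "2 * B"] Dm) auto
    have si: "integrable M (\<lambda>\<omega>. 2 * B * ((\<Sum>j<n. (X N \<omega> j)\<^sup>2) / R\<^sup>2))"
      using sq(1) by (intro integrable_mult_right Bochner_Integration.integrable_divide
          Bochner_Integration.integrable_sum) auto
    have ptw: "\<bar>f (X N \<omega>, Y N \<omega>) - f (X N \<omega>, y)\<bar> \<le> D N \<omega> + 2 * B * ((\<Sum>j<n. (X N \<omega> j)\<^sup>2) / R\<^sup>2)" for \<omega>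
    proof (cases "\<forall>j<n. \<bar>X N \<omega> j\<bar> \<le> R")
      case True
      have "2 * B * ((\<Sum>j<n. (X N \<omega> j)\<^sup>2) / R\<^sup>2) \<ge> 0"
        using B0 by (auto intro!: mult_nonneg_nonneg divide_nonneg_nonneg sum_nonneg)
      then show ?thesis using True by (simp add: D_def)
    next
      case False
      then obtain j where j: "j < n" "\<bar>X N \<omega> j\<bar> > R" by auto
      have "R\<^sup>2 \<le> (X N \<omega> j)\<^sup>2" using j R by (metis abs_le_square_iff abs_of_pos less_imp_le)
      also have "\<dots> \<le> (\<Sum>j<n. (X N \<omega> j)\<^sup>2)" using j by (intro member_le_sum) auto
      finally have 1: "1 \<le> (\<Sum>j<n. (X N \<omega> j)\<^sup>2) / R\<^sup>2" using R by simp
      have "\<bar>f (X N \<omega>, Y N \<omega>) - f (X N \<omega>, y)\<bar> \<le> 2 * B"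
        using B[of "(X N \<omega>, Y N \<omega>)"] B[of "(X N \<omega>, y)"] by linarith
      also have "\<dots> \<le> 2 * B * ((\<Sum>j<n. (X N \<omega> j)\<^sup>2) / R\<^sup>2)"
        using mult_left_mono[OF 1, of "2 * B"] B0 by simp
      finally show ?thesis using False by (auto simp: D_def)
    qed
    have "\<bar>expectation (\<lambda>\<omega>. f (X N \<omega>, Y N \<omega>)) - expectation (\<lambda>\<omega>. f (X N \<omega>, y))\<bar>
      = \<bar>expectation (\<lambda>\<omega>. f (X N \<omega>, Y N \<omega>) - f (X N \<omega>, y))\<bar>" using fi by simp
    also have "\<dots> \<le> expectation (\<lambda>\<omega>. \<bar>f (X N \<omega>, Y N \<omega>) - f (X N \<omega>, y)\<bar>)"
      using integral_norm_bound[of M "\<lambda>\<omega>. f (X N \<omega>, Y N \<omega>) - f (X N \<omega>, y)"] by simp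
    also have "\<dots> \<le> expectation (\<lambda>\<omega>. D N \<omega> + 2 * B * ((\<Sum>j<n. (X N \<omega> j)\<^sup>2) / R\<^sup>2))"
      using fi by (intro integral_mono Bochner_Integration.integrable_add Di si ptw) auto
    also have "\<dots> = expectation (D N) + 2 * B * ((\<Sum>j<n. expectation (\<lambda>\<omega>. (X N \<omega> j)\<^sup>2)) / R\<^sup>2)"
      using Di si sq(1) by (simp add: Bochner_Integration.integral_sum)
    also have "\<dots> \<le> expectation (D N) + 2 * B * (real n * C) / R\<^sup>2"
    proof -
      have "(\<Sum>j<n. expectation (\<lambda>\<omega>. (X N \<omega> j)\<^sup>2)) \<le> real n * C"
        using sum_mono[of "{..<n}" "\<lambda>j. expectation (\<lambda>\<omega>. (X N \<omega> j)\<^sup>2)" "\<lambda>_. C"] sq(2) by simp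
      then have "2 * B * ((\<Sum>j<n. expectation (\<lambda>\<omega>. (X N \<omega> j)\<^sup>2)) / R\<^sup>2) \<le> 2 * B * (real n * C / R\<^sup>2)"
        using B0 by (intro mult_left_mono divide_right_mono) auto
      then show ?thesis by simp
    qed
    also have "\<dots> < e" using N0[OF N] R2 by (simp add: abs_less_iff)
    finally show "norm (expectation (\<lambda>\<omega>. f (X N \<omega>, Y N \<omega>)) - expectation (\<lambda>\<omega>. f (X N \<omega>, y)) - 0) < e" by simp
  qed
qed

text \<open>The Gaussian law has full support: where \<open>g\<close> is positive there is an open
  box, and a null box would have a null side, which the positive normal density excludes.\<close>

lemma std_gaussian_open_positive:
  fixes g :: "(nat \<Rightarrow> real) \<Rightarrow> real"
  assumes g: "continuous_on UNIV g" and local: "\<And>x y. (\<And>j. j < n \<Longrightarrow> x j = y j) \<Longrightarrow> g x = g y"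
    and nonneg: "\<And>x. 0 \<le> g x" and bound: "\<And>x. g x \<le> B" and x0: "g x0 > 0"
  shows "(\<integral>x. g x \<partial>std_gaussian n) > 0"
proof -
  interpret G: second_moment_measure "std_gaussian n" n 1 by (rule second_moment_std_gaussian)
  interpret prob_space std_normal_distribution
    using real_dist_normal_dist by (simp add: real_distribution_def)
  interpret PP: product_prob_space "\<lambda>_::nat. std_normal_distribution" "{..<n}"
    by standard
  have gm: "g \<in> borel_measurable (std_gaussian n)"
    using measurable_compose[OF PiM_borel_to_borel borel_measurable_continuous_onI[OF g]] by (rule G.measurable_P)
  have gi: "integrable (std_gaussian n) g"
    using bound nonneg by (intro G.integrable_const_bound[where B = B] gm) auto
  have "(\<integral>x. g x \<partial>std_gaussian n) \<noteq> 0"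
  proof
    assume "(\<integral>x. g x \<partial>std_gaussian n) = 0"
    then have AE0: "AE x in std_gaussian n. g x = 0"
      using integral_nonneg_eq_0_iff_AE[OF gi] nonneg by simp
    have "open {x. g x > 0}" using open_Collect_less[OF _ g] by (simp add: continuous_on_const)
    then have "openin (product_topology (\<lambda>_. euclidean) UNIV) {x. g x > 0}"
      by (simp add: euclidean_product_topology)
    then obtain V where V: "x0 \<in> PiE UNIV V" "\<And>i. openin euclidean (V i)" "PiE UNIV V \<subseteq> {x. g x > 0}"
      using product_topology_open_contains_basis[of "\<lambda>_. euclidean" UNIV "{x. g x > 0}" x0] x0 by blast
    have "{x \<in> space (std_gaussian n). \<not> g x = 0} \<in> null_sets (std_gaussian n)"
    proof (subst AE_iff_null_sets)
      show "{x \<in> space (std_gaussian n). \<not> g x = 0} \<in> sets (std_gaussian n)" using gm by measurable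
      show "AE x in std_gaussian n. x \<notin> {x \<in> space (std_gaussian n). \<not> g x = 0}"
        using AE0 by eventually_elim simp
    qed
    moreover have "PiE {..<n} V \<subseteq> {x \<in> space (std_gaussian n). \<not> g x = 0}"
    proof
      fix x assume x: "x \<in> PiE {..<n} V"
      \<comment> \<open>The box constrains finitely or infinitely indexed coordinates alike, while
        \<open>x\<close> is \<open>undefined\<close> from \<open>n\<close> on. Filling in the values
        of \<open>x0\<close> there puts the point into the box and, by \<open>local\<close>, leaves
        \<open>g\<close> unchanged.\<close>
      define z where "z j = (if j < n then x j else x0 j)" for j
      have "z \<in> PiE UNIV V" using x V(1) by (auto simp: z_def PiE_iff)
      then have "g z > 0" using V(3) by auto
      moreover have "g z = g x" by (rule local) (simp add: z_def)
      moreover have "x \<in> space (std_gaussian n)"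
        using x by (auto simp: std_gaussian_def space_PiM PiE_iff)
      ultimately show "x \<in> {x \<in> space (std_gaussian n). \<not> g x = 0}" by simp
    qed
    moreover have Vs: "V j \<in> sets std_normal_distribution" for j using V(2)[of j] by simp
    then have "PiE {..<n} V \<in> sets (std_gaussian n)"
      unfolding std_gaussian_def by (intro sets_PiM_I_finite) auto
    ultimately have "PiE {..<n} V \<in> null_sets (std_gaussian n)"
      by (meson null_sets_subset)
    then have "(\<Prod>j<n. emeasure std_normal_distribution (V j)) = 0"
      using PP.emeasure_PiM[of "{..<n}" V] Vs by (simp add: std_gaussian_def null_sets_def)
    then obtain j where "emeasure std_normal_distribution (V j) = 0" by auto
    then have "V j \<in> null_sets std_normal_distribution" using Vs by (simp add: null_sets_def)
    then have "AE x in lborel. x \<in> V j \<longrightarrow> ennreal (std_normal_density x) = 0"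
      by (subst (asm) null_sets_density_iff) auto
    then have AEV: "AE x in lborel. x \<notin> V j"
    proof eventually_elim
      case (elim x)
      have "0 < std_normal_density x" by (rule normal_density_pos) simp
      with elim show ?case by auto
    qed
    obtain e where e: "e > 0" "ball (x0 j) e \<subseteq> V j"
      using V(1) V(2)[of j] by (metis PiE_mem UNIV_I open_contains_ball open_openin)
    have "AE x in lborel. x \<notin> {x0 j - e<..<x0 j + e}"
      using AEV by eventually_elim (use e(2) in \<open>auto simp: subset_eq dist_real_def abs_less_iff\<close>)
    then have "{x0 j - e<..<x0 j + e} \<in> null_sets lborel"
      by (subst AE_iff_null_sets) auto
    then have "emeasure lborel {x0 j - e<..<x0 j + e} = 0" by (rule null_setsD1)
    then show False using e(1) by simp
  qed
  moreover have "(\<integral>x. g x \<partial>std_gaussian n) \<ge> 0" using nonneg by simp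
  ultimately show ?thesis by simp
qed

text \<open>For an exponent above \<open>d\<close> the scaled deviation eventually exceeds
  \<open>m + 1\<close> times the one at \<open>d\<close>. A limit law \<open>\<nu>'\<close> would
  then satisfy E min(1, |z|) under \<open>\<nu>\<close> \<le> E min(1, |z| / (m + 1)) under
  \<open>\<nu>'\<close>, and the right side tends to 0 with \<open>m\<close>.\<close>

lemma fluctuation_exponent_eq:
  fixes X :: "nat \<Rightarrow> 'w \<Rightarrow> complex"
  assumes M: "prob_space M" and X: "\<And>N. N \<ge> N0 \<Longrightarrow> X N \<in> borel_measurable M"
    and \<nu>: "prob_space \<nu>" "sets \<nu> = sets borel" and conv: "converges_in_law M (scaled_deviation X c d) \<nu>"
    and pos: "(\<integral>z. min 1 (norm z) \<partial>\<nu>) > 0"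
  shows "fluctuation_exponent M X c = ereal d"
proof -
  interpret prob_space M by (rule M)
  have sm: "scaled_deviation X c \<theta> N \<in> borel_measurable M" if "N \<ge> N0" for \<theta> N
    unfolding scaled_deviation_def[abs_def] using X[OF that] by measurable
  have not: "\<not> converges_in_law M (scaled_deviation X c \<theta>) \<nu>'"
    if \<theta>: "\<theta> > d" and \<nu>': "prob_space \<nu>'" "sets \<nu>' = sets borel" for \<theta> \<nu>'
  proof
    assume conv': "converges_in_law M (scaled_deviation X c \<theta>) \<nu>'"
    interpret N': prob_space \<nu>' by (rule \<nu>')
    define g where "g m z = min 1 (norm z / real (Suc m))" for m and z :: complex
    have gc: "continuous_on UNIV (g m)" for m unfolding g_def by (intro continuous_intros) auto
    have gb: "\<bar>g m z\<bar> \<le> 1" for m z by (simp add: g_def)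
    have g0: "(\<integral>z. g 0 z \<partial>\<nu>) \<le> (\<integral>z. g m z \<partial>\<nu>')" for m
    proof (rule LIMSEQ_le)
      show "(\<lambda>N. expectation (\<lambda>\<omega>. g 0 (scaled_deviation X c d (N + N0) \<omega>))) \<longlonglongrightarrow> (\<integral>z. g 0 z \<partial>\<nu>)"
        by (rule converges_in_lawD[OF sm conv gc gb])
      show "(\<lambda>N. expectation (\<lambda>\<omega>. g m (scaled_deviation X c \<theta> (N + N0) \<omega>))) \<longlonglongrightarrow> (\<integral>z. g m z \<partial>\<nu>')"
        by (rule converges_in_lawD[OF sm conv' gc gb])
      \<comment> \<open>This threshold is the solution of N^((\<theta> - d) / 2) = m + 1.\<close>
      have "\<forall>\<^sub>F N in sequentially. real (Suc m) powr (2 / (\<theta> - d)) \<le> real N"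
        using filterlim_real_sequentially unfolding filterlim_at_top by blast
      then have "\<forall>\<^sub>F N in sequentially. real (N + N0) powr ((\<theta> - d) / 2) \<ge> real (Suc m)"
      proof eventually_elim
        case (elim N)
        have "real (Suc m) = (real (Suc m) powr (2 / (\<theta> - d))) powr ((\<theta> - d) / 2)"
        proof -
          have "2 / (\<theta> - d) * ((\<theta> - d) / 2) = 1" using \<theta> by simp
          then show ?thesis by (simp only: powr_powr powr_one of_nat_0_le_iff)
        qed
        also have "\<dots> \<le> real (N + N0) powr ((\<theta> - d) / 2)"
          using elim \<theta> by (intro powr_mono2) auto
        finally show ?case .
      qed
      then have "\<forall>\<^sub>F N in sequentially. expectation (\<lambda>\<omega>. g 0 (scaled_deviation X c d (N + N0) \<omega>))
        \<le> expectation (\<lambda>\<omega>. g m (scaled_deviation X c \<theta> (N + N0) \<omega>))"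
      proof eventually_elim
        case (elim N)
        have int: "integrable M (\<lambda>\<omega>. g k (scaled_deviation X c t (N + N0) \<omega>))" for k t
          using gb by (intro integrable_const_bound[where B = 1]
              measurable_compose[OF sm borel_measurable_continuous_onI[OF gc]]) auto
        show ?case
        proof (rule integral_mono[OF int int])
          fix \<omega>
          let ?a = "norm (X (N + N0) \<omega> - c)" and ?n = "real (N + N0)"
          have "real (Suc m) * (?n powr (d / 2) * ?a) \<le> ?n powr ((\<theta> - d) / 2) * (?n powr (d / 2) * ?a)"
            using elim by (intro mult_right_mono) auto
          also have "\<dots> = ?n powr (\<theta> / 2) * ?a"
            by (simp flip: mult.assoc powr_add add: diff_divide_distrib)
          finally have "?n powr (d / 2) * ?a \<le> ?n powr (\<theta> / 2) * ?a / real (Suc m)"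
            by (simp add: field_simps)
          then show "g 0 (scaled_deviation X c d (N + N0) \<omega>) \<le> g m (scaled_deviation X c \<theta> (N + N0) \<omega>)"
            unfolding g_def scaled_deviation_def norm_mult by (intro min.mono) auto
        qed
      qed
      then show "\<exists>K. \<forall>N\<ge>K. expectation (\<lambda>\<omega>. g 0 (scaled_deviation X c d (N + N0) \<omega>))
        \<le> expectation (\<lambda>\<omega>. g m (scaled_deviation X c \<theta> (N + N0) \<omega>))"
        unfolding eventually_sequentially .
    qed
    have "(\<lambda>m. \<integral>z. g m z \<partial>\<nu>') \<longlonglongrightarrow> (\<integral>z. 0 \<partial>\<nu>')"
    proof (rule integral_dominated_convergence[where w = "\<lambda>_. 1"])
      show "g m \<in> borel_measurable \<nu>'" for m
        using borel_measurable_continuous_onI[OF gc] measurable_cong_sets[OF \<nu>'(2) refl] by blast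
      show "AE z in \<nu>'. (\<lambda>m. g m z) \<longlonglongrightarrow> 0"
      proof (rule AE_I2)
        fix z :: complex
        have "(\<lambda>m. norm z / real (Suc m)) \<longlonglongrightarrow> 0"
          by (intro LIMSEQ_Suc lim_const_over_n)
        then have "(\<lambda>m. min 1 (norm z / real (Suc m))) \<longlonglongrightarrow> min 1 0"
          by (intro tendsto_min tendsto_const)
        then show "(\<lambda>m. g m z) \<longlonglongrightarrow> 0" by (simp add: g_def)
      qed
    qed (use gb in auto)
    then have "(\<lambda>m. \<integral>z. g m z \<partial>\<nu>') \<longlonglongrightarrow> 0" by simp
    then have "(\<integral>z. g 0 z \<partial>\<nu>) \<le> 0"
      by (rule LIMSEQ_le_const) (use g0 in blast)
    with pos show False by (simp add: g_def)
  qed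
  show ?thesis
    unfolding fluctuation_exponent_def
  proof (rule Sup_eqI)
    fix x assume "x \<in> ereal ` {\<kappa>. \<exists>\<nu>. prob_space \<nu> \<and> sets \<nu> = sets borel \<and> converges_in_law M (scaled_deviation X c \<kappa>) \<nu>}"
    then show "x \<le> ereal d" using not by (force simp: not_less[symmetric])
  next
    fix x assume "\<And>z. z \<in> ereal ` {\<kappa>. \<exists>\<nu>. prob_space \<nu> \<and> sets \<nu> = sets borel \<and> converges_in_law M (scaled_deviation X c \<kappa>) \<nu>} \<Longrightarrow> z \<le> x"
    then show "ereal d \<le> x" using \<nu> conv by blast
  qed
qed

text \<open>Along almost every path the deviation is eventually exactly zero, so no power of N can
  make it visible; the exponents are then unbounded.\<close>

lemma fluctuation_exponent_degenerate:
  fixes X :: "nat \<Rightarrow> 'w \<Rightarrow> complex"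
  assumes M: "prob_space M" and X: "\<And>N. N \<ge> N0 \<Longrightarrow> X N \<in> borel_measurable M"
    and eq: "AE \<omega> in M. \<forall>\<^sub>F N in sequentially. X N \<omega> = c"
  shows "converges_in_law M (scaled_deviation X c \<theta>) (return borel 0)"
    and "fluctuation_exponent M X c = \<infinity>"
proof -
  interpret prob_space M by (rule M)
  show conv: "converges_in_law M (scaled_deviation X c \<theta>) (return borel 0)" for \<theta>
  proof (rule converges_in_lawI)
    show sm: "scaled_deviation X c \<theta> N \<in> borel_measurable M" if "N \<ge> N0" for N
      unfolding scaled_deviation_def[abs_def] using X[OF that] by measurable
    fix f :: "complex \<Rightarrow> real" and B assume f: "continuous_on UNIV f" and B: "\<And>x. \<bar>f x\<bar> \<le> B"
    have "(\<lambda>N. expectation (\<lambda>\<omega>. f (scaled_deviation X c \<theta> (N + N0) \<omega>))) \<longlonglongrightarrow> expectation (\<lambda>_. f 0)"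
    proof (rule integral_dominated_convergence[where w = "\<lambda>_. B"])
      show "(\<lambda>\<omega>. f (scaled_deviation X c \<theta> (N + N0) \<omega>)) \<in> borel_measurable M" for N
        by (rule measurable_compose[OF sm borel_measurable_continuous_onI[OF f]]) simp
      show "AE \<omega> in M. (\<lambda>N. f (scaled_deviation X c \<theta> (N + N0) \<omega>)) \<longlonglongrightarrow> f 0"
        using eq
      proof eventually_elim
        case (elim \<omega>)
        have "\<forall>\<^sub>F N in sequentially. f (scaled_deviation X c \<theta> N \<omega>) = f 0"
          using elim by eventually_elim (simp add: scaled_deviation_def)
        then have "(\<lambda>N. f (scaled_deviation X c \<theta> N \<omega>)) \<longlonglongrightarrow> f 0" by (rule tendsto_eventually)
        then show ?case by (rule LIMSEQ_ignore_initial_segment)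
      qed
    qed (use B in auto)
    moreover have "(\<integral>x. f x \<partial>return borel 0) = f 0"
      by (rule integral_return) (use borel_measurable_continuous_onI[OF f] in auto)
    ultimately show "(\<lambda>N. expectation (\<lambda>\<omega>. f (scaled_deviation X c \<theta> (N + N0) \<omega>))) \<longlonglongrightarrow> (\<integral>x. f x \<partial>return borel 0)"
      by (simp add: prob_space)
  qed
  have "{\<kappa>. \<exists>\<nu>. prob_space \<nu> \<and> sets \<nu> = sets borel \<and> converges_in_law M (scaled_deviation X c \<kappa>) \<nu>} = UNIV"
    using conv prob_space_return[of 0 "borel :: complex measure"] by (auto intro!: exI[of _ "return borel 0"])
  then have "fluctuation_exponent M X c = Sup (range ereal)"
    by (simp add: fluctuation_exponent_def)
  also have "\<dots> = \<infinity>"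
  by (rule SUP_PInfty) auto
  finally show "fluctuation_exponent M X c = \<infinity>" .
qed

section \<open>The central limit theorem for the truncation\<close>

lemma sum_double: "(\<Sum>c<2 * (m::nat). g c) = (\<Sum>i<m. g (2 * i) + g (2 * i + 1) :: 'b::comm_monoid_add)"
  by (induction m) (simp_all add: add.assoc)

lemma sum_square: "(\<Sum>i<r * (r::nat). g i) = (\<Sum>p\<in>{..<r} \<times> {..<r}. g (fst p * r + snd p) :: 'b::comm_monoid_add)"
proof -
  have "(\<Sum>i<r * r. g i) = (\<Sum>a<r. sum g {a * r..<a * r + r})" by (rule sum.nat_group[symmetric])
  also have "\<dots> = (\<Sum>a<r. \<Sum>b<r. g (a * r + b))"
  proof (rule sum.cong[OF refl])
    fix a
    show "sum g {a * r..<a * r + r} = (\<Sum>b<r. g (a * r + b))"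
      using sum.shift_bounds_nat_ivl[of g 0 "a * r" r] by (simp add: atLeast0LessThan add.commute)
  qed
  finally show ?thesis by (simp add: sum.cartesian_product split_def)
qed

text \<open>Flattened as in \<open>coords_mat\<close>. An entry has second moment 1 / N shared by
  its real and imaginary part, so \<open>sqrt (2 * real N)\<close> gives coordinates of unit
  variance.\<close>

definition trunc_coords :: "nat \<Rightarrow> nat \<Rightarrow> complex mat \<Rightarrow> nat \<Rightarrow> real" where
  "trunc_coords r N V = (\<lambda>c\<in>{..<2 * r\<^sup>2}. sqrt (2 * real N) *
     (let z = V $$ (c div 2 div r, c div 2 mod r) in if even c then Re z else Im z))"

lemma trunc_coords_extensional: "trunc_coords r N V \<in> extensional {..<2 * r\<^sup>2}"
  by (simp add: trunc_coords_def)

lemma trunc_coords_even_odd: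
  assumes "a < r" "b < r"
  shows "trunc_coords r N V (2 * (a * r + b)) = sqrt (2 * real N) * Re (V $$ (a, b))"
    "trunc_coords r N V (2 * (a * r + b) + 1) = sqrt (2 * real N) * Im (V $$ (a, b))"
proof -
  have lt: "2 * (a * r + b) + 1 < 2 * r\<^sup>2" by (rule coord_index_less[OF assms])
  have 1: "2 * (a * r + b) div 2 = a * r + b" "(2 * (a * r + b) + 1) div 2 = a * r + b" by simp_all
  have 2: "(a * r + b) div r = a" "(a * r + b) mod r = b" using assms by simp_all
  have "2 * (a * r + b) < 2 * r\<^sup>2" "even (2 * (a * r + b))" using lt by simp_all
  then show "trunc_coords r N V (2 * (a * r + b)) = sqrt (2 * real N) * Re (V $$ (a, b))"
    unfolding trunc_coords_def Let_def 1 2 restrict_def by simp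
  have "odd (2 * (a * r + b) + 1)" by simp
  with lt show "trunc_coords r N V (2 * (a * r + b) + 1) = sqrt (2 * real N) * Im (V $$ (a, b))"
    unfolding trunc_coords_def Let_def 1 2 restrict_def by simp
qed

lemma coords_mat_trunc_coords:
  assumes "N > 0"
  shows "coords_mat r (\<lambda>c. (1 / sqrt (real N)) * trunc_coords r N V c) = upper_left_block r V"
proof (rule eq_matI)
  fix a b assume "a < dim_row (upper_left_block r V)" "b < dim_col (upper_left_block r V)"
  then have ab: "a < r" "b < r" by (simp_all add: upper_left_block_def)
  have s: "(1 / sqrt (real N)) * (sqrt (2 * real N) * y) = sqrt 2 * y" for y
    using assms by (simp add: real_sqrt_mult)
  have "coords_mat r f $$ (a, b)
    = (of_real (f (2 * (a * r + b))) + \<i> * of_real (f (2 * (a * r + b) + 1))) / of_real (sqrt 2)" for f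
    using ab by (simp add: coords_mat_def)
  then have "coords_mat r (\<lambda>c. (1 / sqrt (real N)) * trunc_coords r N V c) $$ (a, b)
    = (of_real (sqrt 2 * Re (V $$ (a, b))) + \<i> * of_real (sqrt 2 * Im (V $$ (a, b)))) / of_real (sqrt 2)"
    by (simp only: trunc_coords_even_odd[OF ab] s)
  also have "\<dots> = of_real (Re (V $$ (a, b))) + \<i> * of_real (Im (V $$ (a, b)))"
    by (simp add: field_simps)
  also have "\<dots> = V $$ (a, b)" by (simp flip: complex_eq)
  finally show "coords_mat r (\<lambda>c. (1 / sqrt (real N)) * trunc_coords r N V c) $$ (a, b)
    = upper_left_block r V $$ (a, b)"
    using ab by (simp add: upper_left_block_def)
qed (simp_all add: coords_mat_def upper_left_block_def)

context haar_matrix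
begin

lemma trunc_coords_component:
  assumes r: "r \<le> N"
  shows "(\<lambda>\<omega>. trunc_coords r N (U \<omega>) c) \<in> borel_measurable M"
proof (cases "c < 2 * r\<^sup>2")
  case True
  then have "c div 2 < r * r" by (simp add: power2_eq_square less_mult_imp_div_less mult.commute)
  then have "c div 2 div r < r" by (simp add: less_mult_imp_div_less)
  moreover have "c div 2 mod r < r" using True by (cases r) auto
  ultimately have "c div 2 div r < N" "c div 2 mod r < N" using r by (meson less_le_trans)+
  then have "(\<lambda>\<omega>. U \<omega> $$ (c div 2 div r, c div 2 mod r)) \<in> borel_measurable M" by measurable
  then show ?thesis using True unfolding trunc_coords_def Let_def by (cases "even c") (auto simp: restrict_def)
qed (simp add: trunc_coords_def restrict_def)

lemma trunc_coords_measurable: "r \<le> N \<Longrightarrow> (\<lambda>\<omega>. trunc_coords r N (U \<omega>)) \<in> borel_measurable M"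
  by (intro measurable_coordinatewise_then_product trunc_coords_component)

lemma trunc_coords_second_moment:
  assumes r: "r \<le> N" and c: "c < 2 * r\<^sup>2"
  shows "integrable M (\<lambda>\<omega>. (trunc_coords r N (U \<omega>) c)\<^sup>2)"
    "expectation (\<lambda>\<omega>. (trunc_coords r N (U \<omega>) c)\<^sup>2) \<le> 4"
proof -
  have "c div 2 < r * r" using c by (simp add: power2_eq_square less_mult_imp_div_less mult.commute)
  then have "c div 2 div r < r" by (simp add: less_mult_imp_div_less)
  moreover have "c div 2 mod r < r" using c by (cases r) auto
  ultimately have ij: "c div 2 div r < N" "c div 2 mod r < N" using r by (meson less_le_trans)+
  then have "N > 0" by simp
  define p where "p = (c div 2 div r, c div 2 mod r)"
  have le: "(trunc_coords r N (U \<omega>) c)\<^sup>2 \<le> 2 * real N * (norm (U \<omega> $$ p))\<^sup>2" for \<omega>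
  proof -
    have "\<bar>let z = U \<omega> $$ p in if even c then Re z else Im z\<bar> \<le> \<bar>norm (U \<omega> $$ p)\<bar>"
      by (simp add: Let_def abs_Re_le_cmod abs_Im_le_cmod)
    then have "(let z = U \<omega> $$ p in if even c then Re z else Im z)\<^sup>2 \<le> (norm (U \<omega> $$ p))\<^sup>2"
      by (simp only: abs_le_square_iff)
    then show ?thesis
      using c by (simp add: trunc_coords_def power_mult_distrib p_def mult_left_mono)
  qed
  have t2: "tame (\<lambda>x. (norm (x p))\<^sup>2)"
    unfolding p_def using ij by (intro tame_cont[where g = "\<lambda>z. (norm z)\<^sup>2"] tame_coord continuous_intros)
  have i2: "integrable M (\<lambda>\<omega>. 2 * real N * (norm (U \<omega> $$ p))\<^sup>2)"
    by (intro integrable_mult_right tame_integrable_U[OF t2])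
  show int: "integrable M (\<lambda>\<omega>. (trunc_coords r N (U \<omega>) c)\<^sup>2)"
    by (rule Bochner_Integration.integrable_bound[OF i2])
      (use trunc_coords_component[OF r, of c] le in auto)
  have "expectation (\<lambda>\<omega>. (trunc_coords r N (U \<omega>) c)\<^sup>2) \<le> expectation (\<lambda>\<omega>. 2 * real N * (norm (U \<omega> $$ p))\<^sup>2)"
    by (intro integral_mono int i2 le)
  also have "\<dots> \<le> 2 * real N * (2 / real N)"
    unfolding integral_mult_right_zero using second_moment[OF ij(1,2)]
    by (intro mult_left_mono) (auto simp: p_def)
  also have "\<dots> = 4" using \<open>N > 0\<close> by simp
  finally show "expectation (\<lambda>\<omega>. (trunc_coords r N (U \<omega>) c)\<^sup>2) \<le> 4" .
qed

text \<open>A real linear form in the coordinates is the real part of a Hermitian pairing, with its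
  coefficients combined in pairs into the complex matrix \<open>h\<close>.\<close>

lemma trunc_coords_char:
  assumes r: "r \<le> N" and N: "N > 0"
  defines "B \<equiv> {..<r} \<times> {..<r}"
  defines "K t \<equiv> \<Sum>p\<in>B. norm (Complex (t (2 * (fst p * r + snd p))) (t (2 * (fst p * r + snd p) + 1)))"
  shows "norm ((\<integral>\<omega>. cis (\<Sum>c<2 * r\<^sup>2. t c * trunc_coords r N (U \<omega>) c) \<partial>M) - of_real (exp (- (\<Sum>c<2 * r\<^sup>2. (t c)\<^sup>2) / 2)))
    \<le> 2 * K t ^ 4 * real r ^ 4 / real N + (K t)\<^sup>2 / sqrt (real N)"
proof -
  define h where "h p = Complex (t (2 * (fst p * r + snd p))) (t (2 * (fst p * r + snd p) + 1))" for p
  have H: "(\<Sum>c<2 * r\<^sup>2. (t c)\<^sup>2) = (\<Sum>p\<in>B. (norm (h p))\<^sup>2)"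
    unfolding sum_double power2_eq_square[of r] sum_square B_def by (simp add: h_def cmod_power2)
  have "(\<Sum>c<2 * r\<^sup>2. t c * trunc_coords r N V c) = sqrt (2 * real N) * Re (\<Sum>p\<in>B. cnj (h p) * V $$ p)" for V
    unfolding sum_double power2_eq_square[of r] sum_square Re_sum sum_distrib_left B_def
  proof (intro sum.cong refl)
    fix p assume "p \<in> {..<r} \<times> {..<r}"
    then obtain a b where p: "p = (a, b)" "a < r" "b < r" by auto
    show "t (2 * (fst p * r + snd p)) * trunc_coords r N V (2 * (fst p * r + snd p))
       + t (2 * (fst p * r + snd p) + 1) * trunc_coords r N V (2 * (fst p * r + snd p) + 1)
       = sqrt (2 * real N) * Re (cnj (h p) * V $$ p)"
      unfolding p fst_conv snd_conv trunc_coords_even_odd[OF p(2,3)]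
      by (simp add: h_def algebra_simps)
  qed
  then show ?thesis
    using char_approx[OF r N, of h] unfolding H K_def B_def[symmetric] h_def[symmetric]
    by (simp add: sum_divide_distrib)
qed

end

text \<open>The error bound for the characteristic function tends to 0 for each fixed
  \<open>t\<close>, and the second moments are bounded uniformly in \<open>N\<close>.\<close>

theorem truncation_clt:
  fixes U :: "nat \<Rightarrow> 'w \<Rightarrow> complex mat"
  assumes M: "prob_space M" and haar: "\<And>N. N \<ge> N0 \<Longrightarrow> haar_unitary M N (U N)"
    and N0: "r \<le> N0" "N0 > 0"
    and f: "continuous_on UNIV f" and B: "\<And>x. \<bar>f x\<bar> \<le> (B::real)"
  shows "(\<lambda>N. \<integral>\<omega>. f (trunc_coords r N (U N \<omega>)) \<partial>M) \<longlonglongrightarrow> (\<integral>x. f x \<partial>std_gaussian (2 * r\<^sup>2))"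
proof -
  interpret prob_space M by (rule M)
  let ?n = "2 * r\<^sup>2"
  let ?PM = "Pi\<^sub>M {..<?n} (\<lambda>_. borel :: real measure)"
  define P where "P N = distr M ?PM (\<lambda>\<omega>. trunc_coords r N (U N \<omega>))" for N
  have H: "haar_matrix M N (U N)" if "N \<ge> N0" for N
    using M haar[OF that] by (simp add: haar_matrix_def haar_matrix_axioms_def)
  have meas: "(\<lambda>\<omega>. trunc_coords r N (U N \<omega>)) \<in> measurable M ?PM" if "N \<ge> N0" for N
  proof (rule measurable_PiM_single')
    interpret haar_matrix M N "U N" by (rule H[OF that])
    show "(\<lambda>\<omega>. trunc_coords r N (U N \<omega>) i) \<in> borel_measurable M" for i
      using that N0 by (intro trunc_coords_component) simp
  qed (simp add: PiE_UNIV_domain PiE_iff trunc_coords_extensional)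
  have int: "(\<integral>x. g x \<partial>P N) = (\<integral>\<omega>. g (trunc_coords r N (U N \<omega>)) \<partial>M)"
    if "N \<ge> N0" "g \<in> borel_measurable ?PM" for N and g :: "(nat \<Rightarrow> real) \<Rightarrow> 'c::{banach, second_countable_topology}"
    unfolding P_def by (rule integral_distr[OF meas[OF that(1)] that(2)])
  have sm: "second_moment_measure (P N) ?n 4" if N: "N \<ge> N0" for N
  proof (intro second_moment_measure.intro second_moment_measure_axioms.intro)
    interpret haar_matrix M N "U N" by (rule H[OF N])
    have rN: "r \<le> N" using N N0 by simp
    show "prob_space (P N)" unfolding P_def by (rule prob_space_distr[OF meas[OF N]])
    show "sets (P N) = sets ?PM" by (simp add: P_def)
    fix j assume j: "j < ?n"
    have sq: "(\<lambda>x. (x j)\<^sup>2) \<in> borel_measurable ?PM"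
      using j by (intro borel_measurable_power measurable_component_singleton) auto
    show "integrable (P N) (\<lambda>x. (x j)\<^sup>2)"
      unfolding P_def using trunc_coords_second_moment(1)[OF rN j]
      by (subst integrable_distr_eq[OF meas[OF N] sq])
    show "(\<integral>x. (x j)\<^sup>2 \<partial>P N) \<le> 4"
      using trunc_coords_second_moment(2)[OF rN j] by (subst int[OF N sq])
  qed
  \<comment> \<open>The Gaussian bound 1 is relaxed to 4 so that all laws share one
    constant.\<close>
  have smG: "second_moment_measure (std_gaussian ?n) ?n 4"
  proof -
    interpret G: second_moment_measure "std_gaussian ?n" ?n 1 by (rule second_moment_std_gaussian)
    have "(\<integral>x. (x j)\<^sup>2 \<partial>std_gaussian ?n) \<le> 4" if "j < ?n" for j
      using G.square(2)[OF that] by simp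
    then show ?thesis
      using G.prob_space_axioms G.sets_P G.square(1)
      by (intro second_moment_measure.intro second_moment_measure_axioms.intro)
  qed
  have "(\<lambda>N. \<integral>x. f x \<partial>P N) \<longlonglongrightarrow> (\<integral>x. f x \<partial>std_gaussian ?n)"
  proof (rule levy_multivariate[OF sm smG _ f B])
    fix t :: "nat \<Rightarrow> real"
    define K where "K = (\<Sum>p\<in>{..<r} \<times> {..<r}. norm (Complex (t (2 * (fst p * r + snd p))) (t (2 * (fst p * r + snd p) + 1))))"
    let ?L = "\<integral>x. cis (\<Sum>j<?n. t j * x j) \<partial>std_gaussian ?n"
    have L: "?L = of_real (exp (- (\<Sum>c<2 * r\<^sup>2. (t c)\<^sup>2) / 2))" by (rule char_std_gaussian)
    have "(\<lambda>N. (\<integral>x. cis (\<Sum>j<?n. t j * x j) \<partial>P N) - ?L) \<longlonglongrightarrow> 0"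
    proof (rule Lim_null_comparison)
      show "\<forall>\<^sub>F N in sequentially. norm ((\<integral>x. cis (\<Sum>j<?n. t j * x j) \<partial>P N) - ?L)
        \<le> 2 * K ^ 4 * real r ^ 4 / real N + K\<^sup>2 / sqrt (real N)"
        using eventually_ge_at_top[of N0]
      proof eventually_elim
        case (elim N)
        interpret haar_matrix M N "U N" by (rule H[OF elim])
        have c: "(\<lambda>x. cis (\<Sum>j<?n. t j * x j)) \<in> borel_measurable ?PM"
          using trig_poly_measurable_bounded(1)[OF trig_poly.cis[of ?n 1 t]] by simp
        show ?case
          unfolding int[OF elim c] L K_def using N0 elim by (intro trunc_coords_char) auto
      qed
      have "(\<lambda>N. 2 * K ^ 4 * real r ^ 4 / real N + K\<^sup>2 / sqrt (real N)) \<longlonglongrightarrow> 0 + 0"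
        by (intro tendsto_add lim_const_over_n tendsto_divide_0[OF tendsto_const]
            filterlim_at_top_imp_at_infinity filterlim_compose[OF sqrt_at_top filterlim_real_sequentially])
      then show "(\<lambda>N. 2 * K ^ 4 * real r ^ 4 / real N + K\<^sup>2 / sqrt (real N)) \<longlonglongrightarrow> 0" by simp
    qed
    then show "(\<lambda>N. \<integral>x. cis (\<Sum>j<?n. t j * x j) \<partial>P N) \<longlonglongrightarrow> ?L" by (rule LIM_zero_cancel)
  qed
  moreover have "\<forall>\<^sub>F N in sequentially. (\<integral>x. f x \<partial>P N) = (\<integral>\<omega>. f (trunc_coords r N (U N \<omega>)) \<partial>M)"
    using eventually_ge_at_top[of N0]
  proof eventually_elim
    case (elim N)
    show ?case
      by (rule int[OF elim measurable_compose[OF PiM_borel_to_borel borel_measurable_continuous_onI[OF f]]])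
  qed
  ultimately show ?thesis by (rule Lim_transform_eventually)
qed

text \<open>The eigenvalues are given only as a multiset; the product does not see the order of the
  labels.\<close>

lemma poly_char_poly_eigenvalues:
  assumes A: "A \<in> carrier_mat n n" and ev: "{#v i. i \<in># mset_set I#} = eigenvalues_mset A"
  shows "poly (char_poly A) z = (\<Prod>i\<in>I. z - v i)"
proof -
  obtain as where as: "char_poly A = (\<Prod>a\<leftarrow>as. [:- a, 1:])" using char_poly_factorized[OF A] by blast
  have nz: "(\<Prod>a\<leftarrow>bs. [:- a, 1:]) \<noteq> (0 :: complex poly)" for bs
    by (induction bs) (simp_all del: mult_pCons_left)
  have "proots (\<Prod>a\<leftarrow>bs. [:- a, 1:]) = mset bs" for bs :: "complex list"
  proof (induction bs)
    case (Cons a bs)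
    have "proots ([:- a, 1:] * (\<Prod>a\<leftarrow>bs. [:- a, 1:])) = {#a#} + mset bs"
      using proots_mult[OF _ nz[of bs], of "[:- a, 1:]"] Cons by (simp del: mult_pCons_left)
    then show ?case by (simp del: mult_pCons_left)
  qed simp
  then have "mset as = {#v i. i \<in># mset_set I#}" using ev as by (simp add: eigenvalues_mset_def)
  then have "(\<Prod>a\<in>#mset as. z - a) = (\<Prod>i\<in>I. z - v i)"
    by (simp add: prod_unfold_prod_mset image_mset.compositionality o_def)
  moreover have "poly (\<Prod>a\<leftarrow>bs. [:- a, 1:]) z = (\<Prod>a\<in>#mset bs. z - a)" for bs
    by (induction bs) (simp_all add: left_diff_distrib)
  ultimately show ?thesis using as by simp
qed

section \<open>Fluctuations of simple roots\<close>

lemma hom_fun_scale: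
  assumes "hom_fun n d f"
  shows "f (\<lambda>j. c * x j) = of_real c ^ d * f x"
  using assms mv_eval_scale unfolding hom_fun_def by blast

lemma hom_fun_cmult:
  assumes "hom_fun n d f" shows "hom_fun n d (\<lambda>x. c * f x)"
  using hom_fun_mult[OF hom_fun_const assms] by simp

lemma continuous_on_hom_fun: "hom_fun n d f \<Longrightarrow> continuous_on UNIV f"
  using continuous_on_mv_eval unfolding hom_fun_def by blast

lemma mv_eval_local:
  assumes "mv_poly_in n Q" "\<And>j. j < n \<Longrightarrow> x j = y j"
  shows "mv_eval Q x = mv_eval Q y"
  unfolding mv_eval_def using assms
  by (intro sum.cong prod.cong refl arg_cong2[of _ _ _ _ "(*)"]) (force simp: mv_poly_in_def)

text \<open>Group by degree, let \<open>d\<close> be the least degree with a nonzero component and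
  pull out its power of the scale. The component \<open>E e\<close> has degree \<open>d + e\<close>,
  so \<open>E 0\<close> is the leading form at the origin.\<close>

lemma poly_fun_leading_form:
  assumes q: "poly_fun n q" and q0: "q (\<lambda>_. 0) = 0" and nz: "q x0 \<noteq> 0"
  shows "\<exists>d D E. d \<ge> 1 \<and> D \<ge> 1 \<and> (\<forall>e. hom_fun n (d + e) (E e)) \<and> (\<exists>x. E 0 x \<noteq> 0) \<and>
    (\<forall>\<eta> x. q (\<lambda>j. \<eta> * x j) = of_real \<eta> ^ d * (\<Sum>e<D. of_real \<eta> ^ e * E e x))"
proof -
  obtain F D where F: "\<And>d. hom_fun n d (F d)" "\<And>d x. d \<ge> D \<Longrightarrow> F d x = 0" "\<And>x. q x = (\<Sum>d<D. F d x)"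
    using poly_fun_homogeneous_decomposition[OF q] by blast
  have ex: "\<exists>d x. F d x \<noteq> 0"
  proof (rule ccontr)
    assume "\<not> ?thesis"
    then have "q x0 = 0" by (simp add: F(3))
    with nz show False by simp
  qed
  define d where "d = (LEAST d. \<exists>x. F d x \<noteq> 0)"
  have d: "\<exists>x. F d x \<noteq> 0" unfolding d_def by (rule LeastI_ex[OF ex])
  have below: "F e x = 0" if "e < d" for e x
    using not_less_Least[of e "\<lambda>d. \<exists>x. F d x \<noteq> 0"] that unfolding d_def by blast
  have D: "D \<ge> 1" using d F(2)[of d] by (cases D) auto
  \<comment> \<open>The degree 0 component is constant and equals the value of \<open>q\<close> at
    the origin; this is what makes \<open>d\<close> positive.\<close>
  have "F 0 x = 0" for x
  proof -
    have zero: "F e (\<lambda>_. 0) = 0" if "e > 0" for e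
      using hom_fun_scale[OF F(1), of e 0 "\<lambda>_. 0"] that by (auto simp: zero_power)
    have "F 0 x = F 0 (\<lambda>_. 0)" using hom_fun_scale[OF F(1), of 0 0 x] by simp
    also have "\<dots> = (\<Sum>e<D. if e = 0 then F 0 (\<lambda>_. 0) else 0)" using D by simp
    also have "\<dots> = (\<Sum>e<D. F e (\<lambda>_. 0))" using zero by (intro sum.cong) auto
    also have "\<dots> = 0" using q0 by (simp add: F(3))
    finally show ?thesis .
  qed
  then have d1: "d \<ge> 1" using d by (cases d) auto
  have "q (\<lambda>j. \<eta> * x j) = of_real \<eta> ^ d * (\<Sum>e<D. of_real \<eta> ^ e * F (d + e) x)" for \<eta> x
  proof -
    let ?g = "\<lambda>e. of_real \<eta> ^ e * F e x"
    have "q (\<lambda>j. \<eta> * x j) = (\<Sum>e<D. ?g e)" by (simp add: F(3) hom_fun_scale[OF F(1)])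
    also have "\<dots> = (\<Sum>e<d + D. ?g e)" by (rule sum.mono_neutral_left) (auto simp: F(2))
    also have "\<dots> = (\<Sum>e\<in>{d..<d + D}. ?g e)"
      by (rule sum.mono_neutral_right) (auto simp: below)
    also have "\<dots> = (\<Sum>e<D. ?g (d + e))"
      using sum.shift_bounds_nat_ivl[of ?g 0 d D] by (simp add: atLeast0LessThan add.commute)
    finally show ?thesis by (simp add: sum_distrib_left power_add mult.assoc)
  qed
  then show ?thesis
    by (intro exI[of _ d] exI[of _ D] exI[of _ "\<lambda>e. F (d + e)"]) (use d1 D F(1) d in simp)
qed

lemma sets_std_gaussian: "sets (std_gaussian n) = sets (Pi\<^sub>M {..<n} (\<lambda>_. borel))"
  using second_moment_measure.sets_P[OF second_moment_std_gaussian] .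

lemma measurable_std_gaussian:
  assumes "G \<in> borel_measurable borel" shows "G \<in> borel_measurable (std_gaussian n)"
  using measurable_compose[OF PiM_borel_to_borel assms] measurable_cong_sets[OF sets_std_gaussian refl] by blast

lemma prob_space_std_gaussian: "prob_space (std_gaussian n)"
  using second_moment_std_gaussian by (simp add: second_moment_measure_def)

text \<open>The probabilistic core, free of matrices: roots whose product over the labels is a
  polynomial in a rescaled, asymptotically Gaussian vector.\<close>

theorem simple_root_fluctuations:
  fixes X :: "nat \<Rightarrow> 'w \<Rightarrow> nat \<Rightarrow> real" and v :: "nat \<Rightarrow> nat \<Rightarrow> 'w \<Rightarrow> complex"
    and \<mu> :: "nat \<Rightarrow> complex" and q :: "nat \<Rightarrow> (nat \<Rightarrow> real) \<Rightarrow> complex"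
    and \<kappa> :: "nat \<Rightarrow> ereal" and I :: "nat set"
  assumes M: "prob_space M" and N0: "N0 > 0"
    and X: "\<And>N. N \<ge> N0 \<Longrightarrow> X N \<in> borel_measurable M" "\<And>N \<omega>. X N \<omega> \<in> extensional {..<n}"
    and sq: "\<And>N j. N \<ge> N0 \<Longrightarrow> j < n \<Longrightarrow> integrable M (\<lambda>\<omega>. (X N \<omega> j)\<^sup>2)"
      "\<And>N j. N \<ge> N0 \<Longrightarrow> j < n \<Longrightarrow> (\<integral>\<omega>. (X N \<omega> j)\<^sup>2 \<partial>M) \<le> C"
    and clt: "\<And>f B. continuous_on UNIV f \<Longrightarrow> (\<And>x. \<bar>f x\<bar> \<le> (B::real)) \<Longrightarrow>
      (\<lambda>N. \<integral>\<omega>. f (X N \<omega>) \<partial>M) \<longlonglongrightarrow> (\<integral>x. f x \<partial>std_gaussian n)"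
    and v: "\<And>i N. i < m \<Longrightarrow> N \<ge> N0 \<Longrightarrow> v i N \<in> borel_measurable M"
    and lim: "\<And>i. i < m \<Longrightarrow> AE \<omega> in M. (\<lambda>N. v i N \<omega>) \<longlonglongrightarrow> \<mu> i"
    and inj: "inj_on \<mu> {..<m}"
    and q: "\<And>i. i < m \<Longrightarrow> poly_fun n (q i)" and q0: "\<And>i. i < m \<Longrightarrow> q i (\<lambda>_. 0) = 0"
    and root: "AE \<omega> in M. \<forall>N\<ge>N0. \<forall>i<m. q i (\<lambda>c. (1 / sqrt (real N)) * X N \<omega> c) = (\<Prod>j<m. \<mu> i - v j N \<omega>)"
  defines "\<kappa> \<equiv> \<lambda>i. fluctuation_exponent M (v i) (\<mu> i)"
    and "I \<equiv> {i. i < m \<and> \<kappa> i < \<infinity>}"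
  shows "(\<forall>i < m. \<kappa> i = \<infinity> \<or> (\<exists>d::nat. d \<ge> 1 \<and> \<kappa> i = ereal (real d))) \<and>
         (\<forall>i < m. \<kappa> i = \<infinity> \<longrightarrow>
            (\<forall>\<theta>::real. converges_in_law M (scaled_deviation (v i) (\<mu> i) \<theta>) (return borel 0)) \<and>
            (AE \<omega> in M. \<forall>\<^sub>F N in sequentially. v i N \<omega> = \<mu> i)) \<and>
         (\<exists>Q :: nat \<Rightarrow> mv_poly.
            (\<forall>i\<in>I. Q i \<noteq> 0 \<and> mv_poly_in n (Q i) \<and>
               (\<exists>d. \<kappa> i = ereal (real d) \<and> mv_homogeneous d (Q i))) \<and>
            converges_in_law M
              (\<lambda>N \<omega>. \<lambda>i\<in>I. scaled_deviation (v i) (\<mu> i) (real_of_ereal (\<kappa> i)) N \<omega>)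
              (distr (std_gaussian n) borel (\<lambda>x. \<lambda>i\<in>I. mv_eval (Q i) x)))"
proof -
  interpret prob_space M by (rule M)
  \<comment> \<open>This turns out to be \<open>I\<close>; it is defined through the polynomials
    because the exponents are not yet known.\<close>
  define J where "J = {i. i < m \<and> (\<exists>x. q i x \<noteq> 0)}"
  have JD: "i < m" if "i \<in> J" for i using that by (simp add: J_def)
  have lims: "AE \<omega> in M. \<forall>i<m. (\<lambda>N. v i N \<omega>) \<longlonglongrightarrow> \<mu> i"
  proof -
    have "AE \<omega> in M. \<forall>i\<in>{..<m}. (\<lambda>N. v i N \<omega>) \<longlonglongrightarrow> \<mu> i"
      using lim by (subst AE_ball_countable) auto
    then show ?thesis by eventually_elim auto
  qed
  have "\<forall>i. \<exists>d D E. i \<in> J \<longrightarrow> d \<ge> 1 \<and> D \<ge> 1 \<and> (\<forall>e. hom_fun n (d + e) (E e)) \<and> (\<exists>x. E 0 x \<noteq> 0) \<and>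
    (\<forall>\<eta> x. q i (\<lambda>j. \<eta> * x j) = of_real \<eta> ^ d * (\<Sum>e<D. of_real \<eta> ^ e * E e x))"
  proof
    fix i show "\<exists>d D E. i \<in> J \<longrightarrow> d \<ge> 1 \<and> D \<ge> 1 \<and> (\<forall>e. hom_fun n (d + e) (E e)) \<and> (\<exists>x. E 0 x \<noteq> 0) \<and>
      (\<forall>\<eta> x. q i (\<lambda>j. \<eta> * x j) = of_real \<eta> ^ d * (\<Sum>e<D. of_real \<eta> ^ e * E e x))"
    proof (cases "i \<in> J")
      case True
      then obtain x0 where "q i x0 \<noteq> 0" by (auto simp: J_def)
      from poly_fun_leading_form[OF q[OF JD[OF True]] q0[OF JD[OF True]] this] show ?thesis
        by (simp only: True simp_thms)
    qed simp
  qed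
  then have "\<exists>d D E. \<forall>i. i \<in> J \<longrightarrow> d i \<ge> 1 \<and> D i \<ge> 1 \<and> (\<forall>e. hom_fun n (d i + e) (E i e)) \<and> (\<exists>x. E i 0 x \<noteq> 0) \<and>
    (\<forall>\<eta> x. q i (\<lambda>j. \<eta> * x j) = of_real \<eta> ^ d i * (\<Sum>e<D i. of_real \<eta> ^ e * E i e x))"
    unfolding choice_iff .
  then obtain d D E where dDE: "\<And>i. i \<in> J \<Longrightarrow> d i \<ge> 1" "\<And>i. i \<in> J \<Longrightarrow> D i \<ge> 1"
    "\<And>i e. i \<in> J \<Longrightarrow> hom_fun n (d i + e) (E i e)" "\<And>i. i \<in> J \<Longrightarrow> \<exists>x. E i 0 x \<noteq> 0"
    "\<And>i \<eta> x. i \<in> J \<Longrightarrow> q i (\<lambda>j. \<eta> * x j) = of_real \<eta> ^ d i * (\<Sum>e<D i. of_real \<eta> ^ e * E i e x)"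
    by (elim exE) blast
  define den where "den i = (\<Prod>j\<in>{..<m} - {i}. \<mu> i - \<mu> j)" for i
  have den: "den i \<noteq> 0" if "i \<in> J" for i
    unfolding den_def using inj JD[OF that] by (auto simp: inj_on_def)
  define denN where "denN i N \<omega> = (\<Prod>j\<in>{..<m} - {i}. \<mu> i - v j N \<omega>)" for i N \<omega>
  \<comment> \<open>The factors with j \<noteq> i, normalised by their limit: a random correction
    tending to 1.\<close>
  define \<rho> where "\<rho> i N \<omega> = den i / denN i N \<omega>" for i N \<omega>
  \<comment> \<open>The sign comes from \<open>\<mu> i - v i N \<omega>\<close> being the factor of
    the product while the deviation is its negative.\<close>
  define G where "G i e x = - E i e x / den i" for i e x
  have G_hom: "hom_fun n (d i + e) (G i e)" if "i \<in> J" for i e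
    using hom_fun_cmult[OF dDE(3)[OF that, of e], of "- 1 / den i"] by (simp add: G_def[abs_def])
  have "\<forall>i. \<exists>Q. i \<in> J \<longrightarrow> mv_poly_in n Q \<and> mv_homogeneous (d i) Q \<and> G i 0 = mv_eval Q"
  proof
    fix i show "\<exists>Q. i \<in> J \<longrightarrow> mv_poly_in n Q \<and> mv_homogeneous (d i) Q \<and> G i 0 = mv_eval Q"
      using G_hom[of i 0] unfolding hom_fun_def by (cases "i \<in> J") auto
  qed
  then obtain Q where Q: "\<And>i. i \<in> J \<Longrightarrow> mv_poly_in n (Q i)" "\<And>i. i \<in> J \<Longrightarrow> mv_homogeneous (d i) (Q i)"
    "\<And>i. i \<in> J \<Longrightarrow> G i 0 = mv_eval (Q i)" by metis
  have Q_nz: "\<exists>x. mv_eval (Q i) x \<noteq> 0" if "i \<in> J" for i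
    using dDE(4)[OF that] den[OF that] unfolding Q(3)[OF that, symmetric] G_def by auto
  have denN_lim: "AE \<omega> in M. \<forall>i\<in>J. (\<lambda>N. denN i N \<omega>) \<longlonglongrightarrow> den i"
    using lims
  proof eventually_elim
    case (elim \<omega>)
    then show ?case unfolding denN_def den_def by (auto intro!: tendsto_intros)
  qed
  have expansion: "scaled_deviation (v i) (\<mu> i) (real (d i)) N \<omega>
      = \<rho> i N \<omega> * (\<Sum>e<D i. of_real (1 / sqrt (real N)) ^ e * G i e (X N \<omega>))"
    if i: "i \<in> J" and N: "N \<ge> N0" and nz: "denN i N \<omega> \<noteq> 0"
      and eq: "q i (\<lambda>c. (1 / sqrt (real N)) * X N \<omega> c) = (\<Prod>j<m. \<mu> i - v j N \<omega>)" for i N \<omega>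
  proof -
    have sN: "sqrt (real N) > 0" using N N0 by simp
    let ?S = "\<Sum>e<D i. of_real (1 / sqrt (real N)) ^ e * E i e (X N \<omega>)"
    have "(\<mu> i - v i N \<omega>) * denN i N \<omega> = of_real (1 / sqrt (real N)) ^ d i * ?S"
      using eq dDE(5)[OF i, of "1 / sqrt (real N)" "X N \<omega>"] JD[OF i]
        prod.remove[of "{..<m}" i "\<lambda>j. \<mu> i - v j N \<omega>"] by (simp add: denN_def)
    then have "v i N \<omega> - \<mu> i = - (of_real (1 / sqrt (real N)) ^ d i * ?S) / denN i N \<omega>"
      using nz by (metis minus_diff_eq minus_divide_left nonzero_eq_divide_eq)
    moreover have "complex_of_real (real N powr (real (d i) / 2)) * of_real (1 / sqrt (real N)) ^ d i = 1"
    proof -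
      have "real N powr (real (d i) / 2) = sqrt (real N) ^ d i"
        using N N0 by (simp add: powr_half_sqrt[symmetric] powr_powr flip: powr_realpow)
      then have "real N powr (real (d i) / 2) * (1 / sqrt (real N)) ^ d i = 1"
        using sN by (simp add: power_divide)
      then show ?thesis by (metis of_real_1 of_real_mult of_real_power)
    qed
    ultimately have "scaled_deviation (v i) (\<mu> i) (real (d i)) N \<omega> = - ?S / denN i N \<omega>"
      unfolding scaled_deviation_def by (simp flip: mult.assoc)
    also have "\<dots> = \<rho> i N \<omega> * (- ?S / den i)" using den[OF i] by (simp add: \<rho>_def)
    also have "- ?S / den i = (\<Sum>e<D i. of_real (1 / sqrt (real N)) ^ e * G i e (X N \<omega>))"
      by (simp add: G_def sum_negf[symmetric] sum_divide_distrib)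
    finally show ?thesis .
  qed
  define V where "V N \<omega> = (\<lambda>i\<in>J. scaled_deviation (v i) (\<mu> i) (real (d i)) N \<omega>)" for N \<omega>
  have sd: "scaled_deviation (v i) (\<mu> i) \<theta> N \<in> borel_measurable M" if "i < m" "N \<ge> N0" for i \<theta> N
    unfolding scaled_deviation_def[abs_def] using v[OF that] by measurable
  have V: "V N \<in> borel_measurable M" if "N \<ge> N0" for N
  proof (rule measurable_coordinatewise_then_product)
    show "(\<lambda>\<omega>. V N \<omega> i) \<in> borel_measurable M" for i
      using sd[OF JD that] by (cases "i \<in> J") (auto simp: V_def)
  qed
  have G_cont: "continuous_on UNIV (G i e)" if "i \<in> J" for i e
    using continuous_on_hom_fun[OF G_hom[OF that]] .
  \<comment> \<open>Everything that converges almost surely to a constant: the correction factors,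
    set to 1 off \<open>J\<close> to have a limit in every coordinate, and the scale 1 / sqrt N.
    \<open>\<Psi>\<close> is jointly continuous in these and in \<open>X N\<close>.\<close>
  define Y where "Y N \<omega> = (\<lambda>i. if i \<in> J then \<rho> i N \<omega> else 1, 1 / sqrt (real N))" for N \<omega>
  define \<Psi> where "\<Psi> z = (\<lambda>i\<in>J. fst (snd z) i * (\<Sum>e<D i. of_real (snd (snd z)) ^ e * G i e (fst z)))"
    for z :: "(nat \<Rightarrow> real) \<times> (nat \<Rightarrow> complex) \<times> real"
  have \<Psi>_cont: "continuous_on UNIV \<Psi>"
  proof (rule continuous_on_coordinatewise_then_product)
    fix i show "continuous_on UNIV (\<lambda>z. \<Psi> z i)"
    proof (cases "i \<in> J")
      case True
      have "continuous_on UNIV (\<lambda>z :: (nat \<Rightarrow> real) \<times> (nat \<Rightarrow> complex) \<times> real. G i e (fst z))" for e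
        by (rule continuous_on_compose2[OF G_cont[OF True]]) (auto intro: continuous_intros)
      moreover have "continuous_on UNIV (\<lambda>z :: (nat \<Rightarrow> real) \<times> (nat \<Rightarrow> complex) \<times> real. fst (snd z) i)"
        by (rule continuous_on_product_then_coordinatewise) (intro continuous_intros)
      ultimately show ?thesis using True unfolding \<Psi>_def by (auto intro!: continuous_intros)
    qed (simp add: \<Psi>_def)
  qed
  have Y_meas: "Y N \<in> borel_measurable M" if "N \<ge> N0" for N
  proof -
    have "(\<lambda>\<omega>. \<rho> i N \<omega>) \<in> borel_measurable M" if "i \<in> J" for i
      unfolding \<rho>_def denN_def
      by (intro borel_measurable_divide borel_measurable_const borel_measurable_prod borel_measurable_diff v)
        (use \<open>N \<ge> N0\<close> in auto)
    then have "(\<lambda>\<omega>. if i \<in> J then \<rho> i N \<omega> else 1) \<in> borel_measurable M" for i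
      by (cases "i \<in> J") auto
    then show ?thesis unfolding Y_def
      by (intro borel_measurable_Pair measurable_coordinatewise_then_product borel_measurable_const)
  qed
  have Y_lim: "AE \<omega> in M. (\<lambda>N. Y (N + N0) \<omega>) \<longlonglongrightarrow> (\<lambda>_. 1, 0)"
    using denN_lim
  proof eventually_elim
    case (elim \<omega>)
    have "(\<lambda>N. \<rho> i N \<omega>) \<longlonglongrightarrow> 1" if "i \<in> J" for i
      using tendsto_divide[OF tendsto_const[of "den i"], of "\<lambda>N. denN i N \<omega>" "den i"] elim that den[OF that]
      by (simp add: \<rho>_def)
    then have "(\<lambda>N. if i \<in> J then \<rho> i N \<omega> else 1) \<longlonglongrightarrow> 1" for i by (cases "i \<in> J") auto
    moreover have "(\<lambda>N. 1 / sqrt (real N)) \<longlonglongrightarrow> 0"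
      by (intro tendsto_divide_0[OF tendsto_const] filterlim_at_top_imp_at_infinity
          filterlim_compose[OF sqrt_at_top filterlim_real_sequentially])
    ultimately have "(\<lambda>N. Y N \<omega>) \<longlonglongrightarrow> (\<lambda>_. 1, 0)"
      unfolding Y_def by (intro tendsto_Pair tendsto_fun_componentwise)
    then show ?case by (rule LIMSEQ_ignore_initial_segment)
  qed
  have \<Psi>_limit: "\<Psi> (x, (\<lambda>_. 1, 0)) = (\<lambda>i\<in>J. mv_eval (Q i) x)" for x
    unfolding \<Psi>_def
  proof (rule restrict_ext)
    fix i assume i: "i \<in> J"
    \<comment> \<open>At scale 0 only the term with e = 0 survives, by \<open>0 ^ 0 = 1\<close>; the
      bound \<open>D i \<ge> 1\<close> ensures that it occurs.\<close>
    have "(\<Sum>e<D i. complex_of_real 0 ^ e * G i e x) = (\<Sum>e<D i. if e = 0 then G i 0 x else 0)"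
      by (intro sum.cong) auto
    also have "\<dots> = G i 0 x" using dDE(2)[OF i] by simp
    finally show "fst (snd (x, (\<lambda>_. 1, 0))) i * (\<Sum>e<D i. complex_of_real (snd (snd (x, (\<lambda>_. 1, 0)))) ^ e * G i e (fst (x, (\<lambda>_. 1, 0)))) = mv_eval (Q i) x"
      using Q(3)[OF i] by simp
  qed
  \<comment> \<open>The expansion needs \<open>denN i N \<omega> \<noteq> 0\<close>, which holds
    from an index depending on the sample point. Dominated convergence therefore carries the
    identity to expectations.\<close>
  have eventually_eq: "AE \<omega> in M. \<forall>\<^sub>F N in sequentially. V N \<omega> = \<Psi> (X N \<omega>, Y N \<omega>)"
    using denN_lim root
  proof eventually_elim
    case (elim \<omega>)
    have "\<forall>\<^sub>F N in sequentially. \<forall>i\<in>J. denN i N \<omega> \<noteq> 0"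
    proof (rule eventually_ball_finite)
      show "finite J" by (simp add: J_def)
      show "\<forall>i\<in>J. \<forall>\<^sub>F N in sequentially. denN i N \<omega> \<noteq> 0"
        using elim(1) den by (auto intro: tendsto_imp_eventually_ne)
    qed
    then show ?case using eventually_ge_at_top[of N0]
    proof eventually_elim
      case (elim N)
      have "\<And>i. i \<in> J \<Longrightarrow> q i (\<lambda>c. (1 / sqrt (real N)) * X N \<omega> c) = (\<Prod>j<m. \<mu> i - v j N \<omega>)"
        using \<open>\<forall>N\<ge>N0. \<forall>i<m. q i (\<lambda>c. (1 / sqrt (real N)) * X N \<omega> c) = (\<Prod>j<m. \<mu> i - v j N \<omega>)\<close> elim(2) JD by blast
      then show ?case
        unfolding V_def \<Psi>_def using elim
        by (intro restrict_ext) (simp add: expansion Y_def)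
    qed
  qed
  have limit: "(\<lambda>N. \<integral>\<omega>. f (V (N + N0) \<omega>) \<partial>M) \<longlonglongrightarrow> (\<integral>x. f (\<lambda>i\<in>J. mv_eval (Q i) x) \<partial>std_gaussian n)"
    if f: "continuous_on UNIV f" and B: "\<And>x. \<bar>f x\<bar> \<le> B" for f :: "(nat \<Rightarrow> complex) \<Rightarrow> real" and B
  proof -
    have f\<Psi>: "continuous_on UNIV (\<lambda>z. f (\<Psi> z))" by (rule continuous_on_compose2[OF f \<Psi>_cont]) simp
    let ?X = "\<lambda>N. X (N + N0)" and ?Y = "\<lambda>N. Y (N + N0)" and ?V = "\<lambda>N. V (N + N0)"
    have m1: "(\<lambda>\<omega>. f (?V N \<omega>)) \<in> borel_measurable M" for N
      by (rule measurable_compose[OF V borel_measurable_continuous_onI[OF f]]) simp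
    have m2: "(\<lambda>\<omega>. f (\<Psi> (?X N \<omega>, ?Y N \<omega>))) \<in> borel_measurable M" for N
      by (rule measurable_compose[OF _ borel_measurable_continuous_onI[OF f\<Psi>]])
        (intro borel_measurable_Pair X Y_meas; simp)
    have "(\<lambda>N. expectation (\<lambda>\<omega>. f (?V N \<omega>) - f (\<Psi> (?X N \<omega>, ?Y N \<omega>)))) \<longlonglongrightarrow> expectation (\<lambda>_. 0)"
    proof (rule integral_dominated_convergence[where w = "\<lambda>_. 2 * B"])
      show "AE \<omega> in M. (\<lambda>N. f (?V N \<omega>) - f (\<Psi> (?X N \<omega>, ?Y N \<omega>))) \<longlonglongrightarrow> 0"
        using eventually_eq
      proof eventually_elim
        case (elim \<omega>)
        have "(\<lambda>N. f (V N \<omega>) - f (\<Psi> (X N \<omega>, Y N \<omega>))) \<longlonglongrightarrow> 0"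
          by (rule tendsto_eventually) (use elim in eventually_elim, simp)
        then show ?case by (rule LIMSEQ_ignore_initial_segment)
      qed
      show "AE \<omega> in M. norm (f (?V N \<omega>) - f (\<Psi> (?X N \<omega>, ?Y N \<omega>))) \<le> 2 * B" for N
      proof (rule AE_I2)
        fix \<omega>
        show "norm (f (?V N \<omega>) - f (\<Psi> (?X N \<omega>, ?Y N \<omega>))) \<le> 2 * B"
          using B[of "?V N \<omega>"] B[of "\<Psi> (?X N \<omega>, ?Y N \<omega>)"] unfolding real_norm_def by linarith
      qed
    qed (use m1 m2 in auto)
    moreover have "integrable M (\<lambda>\<omega>. f (?V N \<omega>))" "integrable M (\<lambda>\<omega>. f (\<Psi> (?X N \<omega>, ?Y N \<omega>)))" for N
      using B by (auto intro!: integrable_const_bound[where B = B] m1 m2)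
    ultimately have l1: "(\<lambda>N. expectation (\<lambda>\<omega>. f (?V N \<omega>)) - expectation (\<lambda>\<omega>. f (\<Psi> (?X N \<omega>, ?Y N \<omega>)))) \<longlonglongrightarrow> 0"
      by simp
    have l2: "(\<lambda>N. expectation (\<lambda>\<omega>. f (\<Psi> (?X N \<omega>, ?Y N \<omega>))) - expectation (\<lambda>\<omega>. f (\<Psi> (?X N \<omega>, (\<lambda>_. 1, 0))))) \<longlonglongrightarrow> 0"
      by (rule slutsky[where n = n and C = C and B = B, OF _ _ _ _ _ _ f\<Psi>])
        (use X sq Y_meas Y_lim B in auto)
    have l3: "(\<lambda>N. expectation (\<lambda>\<omega>. f (\<Psi> (?X N \<omega>, (\<lambda>_. 1, 0))))) \<longlonglongrightarrow> (\<integral>x. f (\<lambda>i\<in>J. mv_eval (Q i) x) \<partial>std_gaussian n)"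
    proof -
      have "continuous_on UNIV (\<lambda>x. f (\<Psi> (x, (\<lambda>_. 1, 0))))"
        by (rule continuous_on_compose2[OF f\<Psi>]) (auto intro!: continuous_intros)
      from LIMSEQ_ignore_initial_segment[OF clt[OF this B], of N0] show ?thesis
        by (simp only: \<Psi>_limit)
    qed
    show ?thesis using tendsto_add[OF tendsto_add[OF l1 l2] l3] by simp
  qed
  let ?Z = "\<lambda>x. \<lambda>i\<in>J. mv_eval (Q i) x"
  have Z_cont: "continuous_on UNIV ?Z"
  proof (rule continuous_on_coordinatewise_then_product)
    show "continuous_on UNIV (\<lambda>x. ?Z x i)" for i
      using continuous_on_mv_eval by (cases "i \<in> J") auto
  qed
  have joint: "converges_in_law M V (distr (std_gaussian n) borel ?Z)"
  proof (rule converges_in_lawI[OF V])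
    fix f :: "(nat \<Rightarrow> complex) \<Rightarrow> real" and B assume f: "continuous_on UNIV f" and B: "\<And>x. \<bar>f x\<bar> \<le> B"
    have "(\<integral>x. f x \<partial>distr (std_gaussian n) borel ?Z) = (\<integral>x. f (?Z x) \<partial>std_gaussian n)"
      by (intro integral_distr measurable_std_gaussian borel_measurable_continuous_onI Z_cont f)
    then show "(\<lambda>N. \<integral>\<omega>. f (V (N + N0) \<omega>) \<partial>M) \<longlonglongrightarrow> (\<integral>x. f x \<partial>distr (std_gaussian n) borel ?Z)"
      using limit[OF f B] by simp
  qed
  have \<kappa>_J: "\<kappa> i = ereal (real (d i))" if i: "i \<in> J" for i
    unfolding \<kappa>_def
  proof (rule fluctuation_exponent_eq[OF M])
    let ?\<nu> = "distr (std_gaussian n) borel (mv_eval (Q i))"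
    have Qm: "mv_eval (Q i) \<in> borel_measurable (std_gaussian n)"
      by (intro measurable_std_gaussian borel_measurable_continuous_onI continuous_on_mv_eval)
    show "N \<ge> N0 \<Longrightarrow> v i N \<in> borel_measurable M" for N using v JD[OF i] by simp
    show "prob_space ?\<nu>" by (rule prob_space.prob_space_distr[OF prob_space_std_gaussian Qm])
    show "sets ?\<nu> = sets borel" by simp
    show "converges_in_law M (scaled_deviation (v i) (\<mu> i) (real (d i))) ?\<nu>"
    proof (rule converges_in_lawI[OF sd[OF JD[OF i]]])
      fix f :: "complex \<Rightarrow> real" and B assume f: "continuous_on UNIV f" and B: "\<And>x. \<bar>f x\<bar> \<le> B"
      have "continuous_on UNIV (\<lambda>w :: nat \<Rightarrow> complex. f (w i))"
        by (rule continuous_on_compose2[OF f continuous_on_product_coordinates]) simp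
      from limit[OF this B] i
      have "(\<lambda>N. \<integral>\<omega>. f (scaled_deviation (v i) (\<mu> i) (real (d i)) (N + N0) \<omega>) \<partial>M) \<longlonglongrightarrow> (\<integral>x. f (mv_eval (Q i) x) \<partial>std_gaussian n)"
        by (simp add: V_def)
      also have "(\<integral>x. f (mv_eval (Q i) x) \<partial>std_gaussian n) = (\<integral>x. f x \<partial>?\<nu>)"
        by (rule integral_distr[symmetric, OF Qm borel_measurable_continuous_onI[OF f]])
      finally show "(\<lambda>N. \<integral>\<omega>. f (scaled_deviation (v i) (\<mu> i) (real (d i)) (N + N0) \<omega>) \<partial>M) \<longlonglongrightarrow> (\<integral>x. f x \<partial>?\<nu>)" .
    qed
    obtain x0 where x0: "mv_eval (Q i) x0 \<noteq> 0" using Q_nz[OF i] by blast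
    have mc: "continuous_on UNIV (\<lambda>z :: complex. min 1 (norm z))" by (intro continuous_intros)
    have "(\<integral>z. min 1 (norm z) \<partial>?\<nu>) = (\<integral>x. min 1 (norm (mv_eval (Q i) x)) \<partial>std_gaussian n)"
      by (rule integral_distr[OF Qm borel_measurable_continuous_onI[OF mc]])
    also have "\<dots> > 0"
    proof (rule std_gaussian_open_positive)
      show "continuous_on UNIV (\<lambda>x. min 1 (norm (mv_eval (Q i) x)))"
        by (rule continuous_on_compose2[OF mc continuous_on_mv_eval]) simp
      show "min 1 (norm (mv_eval (Q i) x)) = min 1 (norm (mv_eval (Q i) y))" if "\<And>j. j < n \<Longrightarrow> x j = y j" for x y
        using mv_eval_local[OF Q(1)[OF i] that] by simp
      show "0 < min 1 (norm (mv_eval (Q i) x0))" using x0 by simp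
      show "min 1 (norm (mv_eval (Q i) x)) \<le> 1" for x by simp
    qed simp
    finally show "0 < (\<integral>z. min 1 (norm z) \<partial>?\<nu>)" .
  qed
  \<comment> \<open>The product vanishes identically, but its factors with j \<noteq> i are
    eventually nonzero because the limits are distinct; so the factor for \<open>i\<close> must
    vanish.\<close>
  have degenerate: "AE \<omega> in M. \<forall>\<^sub>F N in sequentially. v i N \<omega> = \<mu> i" if i: "i < m" "i \<notin> J" for i
    using lims root
  proof eventually_elim
    case (elim \<omega>)
    have "\<forall>\<^sub>F N in sequentially. \<forall>j\<in>{..<m} - {i}. v j N \<omega> \<noteq> \<mu> i"
    proof (rule eventually_ball_finite)
      show "\<forall>j\<in>{..<m} - {i}. \<forall>\<^sub>F N in sequentially. v j N \<omega> \<noteq> \<mu> i"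
        using elim(1) inj i(1) by (auto simp: inj_on_def intro!: tendsto_imp_eventually_ne)
    qed simp
    then show ?case using eventually_ge_at_top[of N0]
    proof eventually_elim
      case (elim N)
      have "q i (\<lambda>c. (1 / sqrt (real N)) * X N \<omega> c) = 0" using i by (simp add: J_def)
      then have "(\<Prod>j<m. \<mu> i - v j N \<omega>) = 0"
        using \<open>\<forall>N\<ge>N0. \<forall>i<m. q i (\<lambda>c. (1 / sqrt (real N)) * X N \<omega> c) = (\<Prod>j<m. \<mu> i - v j N \<omega>)\<close> elim(2) i(1)
        by metis
      then obtain j where "j < m" "v j N \<omega> = \<mu> i" by auto
      then show ?case using elim(1) by (cases "j = i") auto
    qed
  qed
  have \<kappa>_notJ: "\<kappa> i = \<infinity>" if "i < m" "i \<notin> J" for i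
    unfolding \<kappa>_def by (rule fluctuation_exponent_degenerate(2)[OF M v[OF that(1)] degenerate[OF that]])
  have IJ: "I = J" unfolding I_def using \<kappa>_J \<kappa>_notJ JD by (force simp: less_top[symmetric])
  have Qn0: "Q i \<noteq> 0" if "i \<in> J" for i
    using Q_nz[OF that] by (auto simp: mv_eval_def)
  have V_eq: "(\<lambda>N \<omega>. \<lambda>i\<in>I. scaled_deviation (v i) (\<mu> i) (real_of_ereal (\<kappa> i)) N \<omega>) = V"
    unfolding IJ V_def by (intro ext) (simp add: \<kappa>_J restrict_def)
  show ?thesis
  proof (intro conjI allI impI)
    fix i assume i: "i < m"
    show "\<kappa> i = \<infinity> \<or> (\<exists>d::nat. d \<ge> 1 \<and> \<kappa> i = ereal (real d))"
      using \<kappa>_J[of i] \<kappa>_notJ[OF i] dDE(1)[of i] by blast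
  next
    fix i \<theta> assume i: "i < m" "\<kappa> i = \<infinity>"
    then have "i \<notin> J" using \<kappa>_J[of i] by auto
    then show "converges_in_law M (scaled_deviation (v i) (\<mu> i) \<theta>) (return borel 0)"
      by (intro fluctuation_exponent_degenerate(1)[OF M v[OF i(1)] degenerate[OF i(1)]])
  next
    fix i assume i: "i < m" "\<kappa> i = \<infinity>"
    then have "i \<notin> J" using \<kappa>_J[of i] by auto
    then show "AE \<omega> in M. \<forall>\<^sub>F N in sequentially. v i N \<omega> = \<mu> i" by (rule degenerate[OF i(1)])
  next
    show "\<exists>Q :: nat \<Rightarrow> mv_poly.
            (\<forall>i\<in>I. Q i \<noteq> 0 \<and> mv_poly_in n (Q i) \<and>
               (\<exists>d. \<kappa> i = ereal (real d) \<and> mv_homogeneous d (Q i))) \<and>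
            converges_in_law M
              (\<lambda>N \<omega>. \<lambda>i\<in>I. scaled_deviation (v i) (\<mu> i) (real_of_ereal (\<kappa> i)) N \<omega>)
              (distr (std_gaussian n) borel (\<lambda>x. \<lambda>i\<in>I. mv_eval (Q i) x))"
      unfolding V_eq unfolding IJ using Qn0 Q(1,2) \<kappa>_J joint by blast
  qed
qed

section \<open>Application to the nontrivial eigenvalues\<close>

theorem theorem1p2:
  fixes r k l :: nat
    and A B :: "nat \<Rightarrow> complex mat"
    and P :: nc_poly
    and M :: "'w measure"
    and U :: "nat \<Rightarrow> 'w \<Rightarrow> complex mat"
    and \<mu>N :: "nat \<Rightarrow> nat \<Rightarrow> 'w \<Rightarrow> complex"
    and \<mu> :: "nat \<Rightarrow> complex"
    and \<kappa> :: "nat \<Rightarrow> ereal"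
    and I :: "nat set"
  assumes "r \<ge> 1" and "k \<ge> 1" and "l \<ge> 1"
    and "\<And>i. i < k \<Longrightarrow> A i \<in> carrier_mat r r"
    and "\<And>j. j < l \<Longrightarrow> B j \<in> carrier_mat r r"
    and "nc_poly_in (k + l) P" and "nc_no_constant_term P"
    and "prob_space M"
    and "\<And>N. N \<ge> 2 * r \<Longrightarrow> haar_unitary M N (U N)"
    and "\<And>i N. i < 2 * r \<Longrightarrow> N \<ge> 2 * r \<Longrightarrow> \<mu>N i N \<in> borel_measurable M"
    and "\<And>N. N \<ge> 2 * r \<Longrightarrow> AE \<omega> in M.
           {#\<mu>N i N \<omega>. i \<in># mset_set {..<2 * r}#} = nontrivial_eigenvalues r k l P A B N (U N \<omega>)"
    and "{#\<mu> i. i \<in># mset_set {..<2 * r}#} = eigenvalues_mset (limit_matrix r k l P A B)"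
    and "\<And>i. i < 2 * r \<Longrightarrow> AE \<omega> in M. (\<lambda>N. \<mu>N i N \<omega>) \<longlonglongrightarrow> \<mu> i"
    and "inj_on \<mu> {..<2 * r}"
  defines "\<kappa> \<equiv> \<lambda>i. fluctuation_exponent M (\<mu>N i) (\<mu> i)"
    and "I \<equiv> {i. i < 2 * r \<and> \<kappa> i < \<infinity>}"
  shows "(\<forall>i < 2 * r. \<kappa> i = \<infinity> \<or> (\<exists>d::nat. d \<ge> 1 \<and> \<kappa> i = ereal (real d))) \<and>
         (\<forall>i < 2 * r. \<kappa> i = \<infinity> \<longrightarrow>
            (\<forall>\<theta>::real. converges_in_law M (scaled_deviation (\<mu>N i) (\<mu> i) \<theta>) (return borel 0)) \<and>
            (AE \<omega> in M. \<forall>\<^sub>F N in sequentially. \<mu>N i N \<omega> = \<mu> i)) \<and>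
         (\<exists>Q :: nat \<Rightarrow> mv_poly.
            (\<forall>i\<in>I. Q i \<noteq> 0 \<and> mv_poly_in (2 * r\<^sup>2) (Q i) \<and>
               (\<exists>d. \<kappa> i = ereal (real d) \<and> mv_homogeneous d (Q i))) \<and>
            converges_in_law M
              (\<lambda>N \<omega>. \<lambda>i\<in>I. scaled_deviation (\<mu>N i) (\<mu> i) (real_of_ereal (\<kappa> i)) N \<omega>)
              (distr (std_gaussian (2 * r\<^sup>2)) borel (\<lambda>x. \<lambda>i\<in>I. mv_eval (Q i) x)))"
proof -
  interpret prob_space M by (rule assms(8))
  let ?Y = "\<lambda>W. block_polynomial r k l P A B W"
  let ?X = "\<lambda>N \<omega>. trunc_coords r N (U N \<omega>)"
  define q where "q i x = poly (char_poly (?Y (coords_mat r x))) (\<mu> i)" for i x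
  have H: "haar_matrix M N (U N)" if "N \<ge> 2 * r" for N
    using assms(8) assms(9)[OF that] by (simp add: haar_matrix_def haar_matrix_axioms_def)
  have r: "r \<le> 2 * r" "2 * r > 0" using assms(1) by simp_all
  have Y: "?Y W \<in> carrier_mat (2 * r) (2 * r)" for W by (simp add: block_polynomial_def)
  have good: "AE \<omega> in M. nontrivial_eigenvalues r k l P A B N (U N \<omega>)
      = eigenvalues_mset (?Y (upper_left_block r (U N \<omega>)))" if N: "N \<ge> 2 * r" for N
  proof -
    interpret haar_matrix M N "U N" by (rule H[OF N])
    have "r \<le> N" using N by simp
    from lower_corner_nonzero[OF this] AE_space show ?thesis
    proof eventually_elim
      case (elim \<omega>)
      show ?case by (rule nontrivial_eigenvalues_eq[OF N unitary[OF elim(2)] assms(4,5,6) elim(1)])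
    qed
  qed
  \<comment> \<open>There are countably many \<open>N\<close>, so one null set serves all of them;
    the root identity is needed along whole paths.\<close>
  have "AE \<omega> in M. \<forall>N\<in>{2 * r..}. {#\<mu>N i N \<omega>. i \<in># mset_set {..<2 * r}#}
      = eigenvalues_mset (?Y (upper_left_block r (U N \<omega>)))"
  proof (subst AE_ball_countable, simp, intro ballI)
    fix N assume "N \<in> {2 * r..}"
    then have N: "N \<ge> 2 * r" by simp
    from assms(11)[OF N] good[OF N]
    show "AE \<omega> in M. {#\<mu>N i N \<omega>. i \<in># mset_set {..<2 * r}#}
      = eigenvalues_mset (?Y (upper_left_block r (U N \<omega>)))" by eventually_elim simp
  qed
  then have root: "AE \<omega> in M. \<forall>N\<ge>2 * r. \<forall>i<2 * r.
      q i (\<lambda>c. (1 / sqrt (real N)) * ?X N \<omega> c) = (\<Prod>j<2 * r. \<mu> i - \<mu>N j N \<omega>)"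
  proof eventually_elim
    case (elim \<omega>)
    show ?case
    proof (intro allI impI)
      fix N i assume N: "2 * r \<le> N"
      then have "N > 0" using r by linarith
      have "{#\<mu>N i N \<omega>. i \<in># mset_set {..<2 * r}#} = eigenvalues_mset (?Y (upper_left_block r (U N \<omega>)))"
        using elim N by simp
      from poly_char_poly_eigenvalues[OF Y this]
      show "q i (\<lambda>c. (1 / sqrt (real N)) * ?X N \<omega> c) = (\<Prod>j<2 * r. \<mu> i - \<mu>N j N \<omega>)"
        unfolding q_def coords_mat_trunc_coords[OF \<open>N > 0\<close>] .
    qed
  qed
  have q0: "q i (\<lambda>_. 0) = 0" if "i < 2 * r" for i
  proof -
    have "coords_mat r (\<lambda>_. 0) = 0\<^sub>m r r" by (intro eq_matI) (auto simp: coords_mat_def)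
    then have "q i (\<lambda>_. 0) = (\<Prod>j<2 * r. \<mu> i - \<mu> j)"
      using poly_char_poly_eigenvalues[OF Y assms(12)[unfolded limit_matrix_def]] by (simp add: q_def)
    then show ?thesis using that by auto
  qed
  have X: "?X N \<in> borel_measurable M" if "N \<ge> 2 * r" for N
    using haar_matrix.trunc_coords_measurable[OF H[OF that], of r] that by simp
  have sq: "integrable M (\<lambda>\<omega>. (?X N \<omega> j)\<^sup>2)" "(\<integral>\<omega>. (?X N \<omega> j)\<^sup>2 \<partial>M) \<le> 4"
    if "N \<ge> 2 * r" "j < 2 * r\<^sup>2" for N j
    using haar_matrix.trunc_coords_second_moment[OF H[OF that(1)], of r j] that by simp_all
  show ?thesis
    unfolding I_def \<kappa>_def
    by (rule simple_root_fluctuations[where X = ?X and q = q and ?N0.0 = "2 * r" and C = 4, OF assms(8) r(2) X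
          trunc_coords_extensional sq truncation_clt[OF assms(8,9) r] assms(10,13,14) _ q0 root])
      (auto simp: q_def[abs_def] intro!: poly_fun_char_poly assms(4,5,6))
qed

end
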